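(* The equality $$\mathbf{X}_{p,r}=\mathrm{cl}\left(\mathbf{X}^*_{p,r}\right)$$ holds, where $\mathrm{cl}$ denotes the closure in $L_p(\Omega;\mathbb{R}^n)$, $\mathbf{X}_{p,r}$ is the set of all trajectories of system (E) generated by controls $u(\cdot)\in L_q(\Omega;\mathbb{R}^m)$ with $\|u(\cdot)\|_q\le r$, and $\mathbf{X}^*_{p,r}$ is the set of all trajectories of system (E) generated by controls $u(\cdot)\in L_q(\Omega;\mathbb{R}^m)$ with $\|u(\cdot)\|_q=r$.
   Context: Setting. Let $k,n,m$ be positive integers, $\Omega\subset\mathbb{R}^k$ a compact set with $\mu(\Omega)>0$, where $\mu$ is Lebesgue measure, $\lambda\ge 0$, $r>0$, $q\in(1,\infty)$ and $p\in(1,\infty)$ with $\frac1p+\frac1q=1$. $\|\cdot\|$ is the Euclidean norm, $\|\cdot\|_p,\|\cdot\|_q,\|\cdot\|_\infty$ are the usual Lebesgue space norms. The system is the Urysohn type integral equation $$\text{(E)}\qquad x(\xi)=f(\xi,x(\xi))+\lambda\int_\Omega\left[K_1(\xi,s,x(s))+K_2(\xi,s,x(s))u(s)\right]ds,$$ where $f:\Omega\times\mathbb{R}^n\to\mathbb{R}^n$, $K_1:\Omega\times\Omega\times\mathbb{R}^n\to\mathbb{R}^n$, $K_2:\Omega\times\Omega\times\mathbb{R}^n\to\mathbb{R}^{n\times m}$. The following conditions are assumed. (A) $f(\cdot,x)$ is Lebesgue measurable for every fixed $x\in\mathbb{R}^n$, $f(\cdot,0)\in L_p(\Omega;\mathbb{R}^n)$,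 and there is $\gamma_0\in L_\infty(\Omega;[0,\infty))$ such that for a.a. $\xi\in\Omega$: $\|f(\xi,x_1)-f(\xi,x_2)\|\le\gamma_0(\xi)\|x_1-x_2\|$ for all $x_1,x_2\in\mathbb{R}^n$. (B) $K_1(\cdot,\cdot,x)$ is Lebesgue measurable for every fixed $x$, $K_1(\cdot,\cdot,0)\in L_p(\Omega\times\Omega;\mathbb{R}^n)$, and there is $\gamma_1:\Omega\times\Omega\to[0,\infty)$ for which the integral $\int_\Omega\left(\int_\Omega\gamma_1(\xi,s)^q\,ds\right)^{p/q}d\xi$ is defined and finite, such that for a.a. $(\xi,s)\in\Omega\times\Omega$: $\|K_1(\xi,s,x_1)-K_1(\xi,s,x_2)\|\le\gamma_1(\xi,s)\|x_1-x_2\|$ for all $x_1,x_2\in\mathbb{R}^n$. (C) $K_2(\cdot,\cdot,x)$ is Lebesgue measurable for every fixed $x$, $K_2(\cdot,\cdot,0)\in L_p(\Omega\times\Omega;\mathbb{R}^{n\times m})$, and there is $\gamma_2\in L_\infty(\Omega\times\Omega;[0,\infty))$ such that for a.a. $(\xi,s)\in\Omega\times\Omega$: $\|K_2(\xi,s,x_1)-K_2(\xi,s,x_2)\|\le\gamma_2(\xi,s)\|x_1-x_2\|$ for all $x_1,x_2\in\mathbb{R}^n$. (D) With $\kappa_0=\|\gamma_0\|_\infty$, $\kappa_1=\left(\int_\Omega\left(\int_\Omega\gamma_1(\xi,s)^q\,ds\right)^{p/q}d\xi\right)^{1/p}$, $\kappa_2=\|\gamma_2\|_\infty$, $$6^{p-1}\left[\kappa_0^p+\lambda^p\kappa_1^p+\lambda^pr^p\kappa_2^p\mu(\Omega)\right]<1.$$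 Trajectories. For $u\in L_q(\Omega;\mathbb{R}^m)$ with $\|u\|_q\le r$, a function $x\in L_p(\Omega;\mathbb{R}^n)$ satisfying (E) for a.a. $\xi\in\Omega$ is called a trajectory of (E) generated by $u$ (under (A)–(D) each such $u$ generates exactly one trajectory). *)

theory Defs
  imports "HOL-Probability.Essential_Supremum"
begin

text \<open>
  Lebesgue spaces are represented by sets of functions, not of equivalence classes modulo equality
  almost everywhere. Functions are total; only their restriction to the space of the measure matters.
\<close>

definition Lp_space :: "'a measure \<Rightarrow> real \<Rightarrow> ('a \<Rightarrow> 'b::real_normed_vector) set" where
  "Lp_space M p = {g \<in> borel_measurable M. integrable M (\<lambda>t. norm (g t) powr p)}"

definition Lp_norm :: "'a measure \<Rightarrow> real \<Rightarrow> ('a \<Rightarrow> 'b::real_normed_vector) \<Rightarrow> real" where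
  "Lp_norm M p g = (\<integral>t. norm (g t) powr p \<partial>M) powr (1 / p)"

definition Linf_space :: "'a measure \<Rightarrow> ('a \<Rightarrow> 'b::real_normed_vector) set" where
  "Linf_space M = {g \<in> borel_measurable M. esssup M (\<lambda>t. ereal (norm (g t))) < \<infinity>}"

definition Linf_norm :: "'a measure \<Rightarrow> ('a \<Rightarrow> 'b::real_normed_vector) \<Rightarrow> real" where
  "Linf_norm M g = real_of_ereal (esssup M (\<lambda>t. ereal (norm (g t))))"

text \<open>
  The closure with respect to the \<open>L\<^sub>p\<close> seminorm; it is invariant under changes of the functions
  on null sets, so it is the preimage of the closure in the normed space of equivalence classes.
\<close>

definition Lp_closure ::
    "'a measure \<Rightarrow> real \<Rightarrow> ('a \<Rightarrow> 'b::real_normed_vector) set \<Rightarrow> ('a \<Rightarrow> 'b) set" where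
  "Lp_closure M p S =
     {x \<in> Lp_space M p. \<forall>e>0. \<exists>y\<in>S. Lp_norm M p (\<lambda>t. x t - y t) < e}"

text \<open>
  Integrability of the integrand is required explicitly, because the Bochner integral of a
  non-integrable function is 0 by convention.
\<close>

definition trajectory ::
    "(real ^ 'k) set \<Rightarrow> real \<Rightarrow> real
     \<Rightarrow> (real ^ 'k \<Rightarrow> real ^ 'n \<Rightarrow> real ^ 'n)
     \<Rightarrow> (real ^ 'k \<Rightarrow> real ^ 'k \<Rightarrow> real ^ 'n \<Rightarrow> real ^ 'n)
     \<Rightarrow> (real ^ 'k \<Rightarrow> real ^ 'k \<Rightarrow> real ^ 'n \<Rightarrow> real ^ 'm ^ 'n)
     \<Rightarrow> (real ^ 'k \<Rightarrow> real ^ 'm) \<Rightarrow> (real ^ 'k \<Rightarrow> real ^ 'n) \<Rightarrow> bool" where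
  "trajectory \<Omega> p lam f K1 K2 u x \<longleftrightarrow>
     x \<in> Lp_space (lebesgue_on \<Omega>) p \<and>
     (AE \<xi> in lebesgue_on \<Omega>.
        integrable (lebesgue_on \<Omega>) (\<lambda>s. K1 \<xi> s (x s) + K2 \<xi> s (x s) *v u s) \<and>
        x \<xi> = f \<xi> (x \<xi>)
          + lam *\<^sub>R (\<integral>s. K1 \<xi> s (x s) + K2 \<xi> s (x s) *v u s \<partial>(lebesgue_on \<Omega>)))"

definition trajectories_ball ::
    "(real ^ 'k) set \<Rightarrow> real \<Rightarrow> real \<Rightarrow> real \<Rightarrow> real
     \<Rightarrow> (real ^ 'k \<Rightarrow> real ^ 'n \<Rightarrow> real ^ 'n)
     \<Rightarrow> (real ^ 'k \<Rightarrow> real ^ 'k \<Rightarrow> real ^ 'n \<Rightarrow> real ^ 'n)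
     \<Rightarrow> (real ^ 'k \<Rightarrow> real ^ 'k \<Rightarrow> real ^ 'n \<Rightarrow> real ^ 'm ^ 'n)
     \<Rightarrow> (real ^ 'k \<Rightarrow> real ^ 'n) set" where
  "trajectories_ball \<Omega> p q r lam f K1 K2 =
     {x. \<exists>u \<in> Lp_space (lebesgue_on \<Omega>) q.
           Lp_norm (lebesgue_on \<Omega>) q u \<le> r \<and> trajectory \<Omega> p lam f K1 K2 u x}"

definition trajectories_sphere ::
    "(real ^ 'k) set \<Rightarrow> real \<Rightarrow> real \<Rightarrow> real \<Rightarrow> real
     \<Rightarrow> (real ^ 'k \<Rightarrow> real ^ 'n \<Rightarrow> real ^ 'n)
     \<Rightarrow> (real ^ 'k \<Rightarrow> real ^ 'k \<Rightarrow> real ^ 'n \<Rightarrow> real ^ 'n)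
     \<Rightarrow> (real ^ 'k \<Rightarrow> real ^ 'k \<Rightarrow> real ^ 'n \<Rightarrow> real ^ 'm ^ 'n)
     \<Rightarrow> (real ^ 'k \<Rightarrow> real ^ 'n) set" where
  "trajectories_sphere \<Omega> p q r lam f K1 K2 =
     {x. \<exists>u \<in> Lp_space (lebesgue_on \<Omega>) q.
           Lp_norm (lebesgue_on \<Omega>) q u = r \<and> trajectory \<Omega> p lam f K1 K2 u x}"

end

theory Submission
  imports Defs
begin

text \<open>
  Write \<open>T u x\<close> for the right-hand side of the integral equation, so that the trajectories of the control
  \<open>u\<close> are the almost everywhere fixed points of \<open>T u\<close> in \<open>L\<^sub>p\<close>, and let \<open>N g\<close> be the integral of \<open>|g|\<^sup>p\<close>, the
  \<open>p\<close>-th power of the norm of \<open>L\<^sub>p\<close>. For \<open>u\<close> in the ball of radius \<open>r\<close>, the Hoelder inequality together with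
  \<open>(a + b + c)\<^sup>p \<le> 3\<^sup>p\<^sup>-\<^sup>1 (a\<^sup>p + b\<^sup>p + c\<^sup>p)\<close> gives \<open>N (T u x - T u y) \<le> c N (x - y)\<close>, where \<open>c\<close> is \<open>3\<^sup>p\<^sup>-\<^sup>1\<close> times the
  bracket of the smallness hypothesis (\<open>rhs_contraction\<close>). Working with \<open>N\<close> instead of the norm, the triangle
  inequality costs a factor \<open>2\<^sup>p\<^sup>-\<^sup>1\<close>; the hypothesis says exactly that \<open>2\<^sup>p\<^sup>-\<^sup>1 c < 1\<close>, which is where the
  constant \<open>6\<close> comes from. Picard iteration started at \<open>x0\<close> therefore yields a trajectory \<open>x\<close> of \<open>u\<close> for
  which \<open>N (x - x0)\<close> is at most a constant times \<open>N (T u x0 - x0)\<close> (\<open>trajectory_near_approximate_solution\<close>).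
  
  Density of the sphere trajectories. Let \<open>x\<close> be a trajectory of \<open>u\<close>. On a set \<open>E\<close> of small positive measure
  replace \<open>u\<close> by a constant vector, so long that the new control \<open>v\<close> has norm exactly \<open>r\<close>. Then \<open>T v x - x\<close>
  is \<open>lam\<close> times the integral over \<open>E\<close> of \<open>K2\<close> along \<open>x\<close> applied to \<open>v - u\<close>. Since \<open>v - u\<close> stays bounded in \<open>L\<^sub>q\<close>
  and \<open>K2\<close> along \<open>x\<close> is \<open>p\<close>-integrable, this tends to zero with \<open>E\<close> (\<open>rhs_perturbation_on_set\<close>), and the
  trajectory of \<open>v\<close> found near \<open>x\<close> is as close to \<open>x\<close> as desired.
  
  Closedness of the ball trajectories. Let trajectories \<open>y i\<close> of controls \<open>u i\<close> converge to \<open>x\<close> in \<open>L\<^sub>p\<close>, fast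
  enough that the residuals \<open>x - T (u i) x\<close> tend to zero almost everywhere. The usual argument extracts a
  weakly convergent subsequence of the controls. Here averages take the place of weak limits: \<open>T u x\<close> is affine in \<open>u\<close>, so residuals of convex combinations of the tails of \<open>u\<close> tend to
  zero as well, and suitable combinations converge almost everywhere to some \<open>w\<close> in the ball
  (\<open>midpoint_hull_AE_convergent\<close>). Almost everywhere convergence of a sequence that is bounded in \<open>L\<^sub>q\<close> suffices
  to pass to the limit in the integral against \<open>K2\<close> along \<open>x\<close> (\<open>tendsto_integral_of_AE_bounded\<close>), so that
  \<open>x = T w x\<close>.
\<close>

section \<open>Lebesgue spaces\<close>

text \<open>
  The second derivative yields convexity only on the open half-line; at a zero endpoint it is the inequality
  \<open>c powr p \<le> c\<close> for \<open>c\<close> between \<open>0\<close> and \<open>1\<close>.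
\<close>

lemma convex_on_powr:
  fixes p :: real
  assumes "p \<ge> 1"
  shows "convex_on {0..} (\<lambda>x::real. x powr p)"
proof (rule convex_onI)
  fix t x y :: real
  assume t: "0 < t" "t < 1" and xy: "x \<in> {0..}" "y \<in> {0..}"
  have scale: "(c * z) powr p \<le> c * z powr p" if "0 < c" "c < 1" "0 \<le> z" for c z :: real
  proof -
    have "c powr p \<le> c powr 1"
      using that assms by (intro powr_mono') auto
    then show ?thesis
      using that by (simp add: powr_mult mult_right_mono)
  qed
  show "((1 - t) *\<^sub>R x + t *\<^sub>R y) powr p \<le> (1 - t) * x powr p + t * y powr p"
  proof (cases "x = 0 \<or> y = 0")
    case True
    then show ?thesis
      using scale[of t y] scale[of "1 - t" x] t xy assms by auto
  next
    case False
    then show ?thesis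
      using convex_onD[OF powr_convex[OF assms], of t x y] t xy by simp
  qed
qed simp

lemma powr_add_le:
  fixes a b p :: real
  assumes "p \<ge> 1" "a \<ge> 0" "b \<ge> 0"
  shows "(a + b) powr p \<le> 2 powr (p - 1) * (a powr p + b powr p)"
proof -
  have eq: "(1 - 1/2) *\<^sub>R a + (1/2) *\<^sub>R b = (a + b) / 2"
    by (simp add: field_simps)
  have "((a + b) / 2) powr p \<le> (1 - 1/2) * a powr p + (1/2) * b powr p"
    unfolding eq[symmetric] using assms by (intro convex_onD[OF convex_on_powr]) auto
  moreover have "((a + b) / 2) powr p = (a + b) powr p / (2 * 2 powr (p - 1))"
    using assms by (simp add: powr_divide powr_diff)
  ultimately show ?thesis
    by (simp add: field_simps)
qed

lemma powr_add3_le: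
  fixes a b c p :: real
  assumes "p \<ge> 1" "a \<ge> 0" "b \<ge> 0" "c \<ge> 0"
  shows "(a + b + c) powr p \<le> 3 powr (p - 1) * (a powr p + b powr p + c powr p)"
proof -
  have cvx: "convex_on {0..} (\<lambda>x::real. x powr p)"
    using assms(1) by (rule convex_on_powr)
  have eq2: "(1 - 1/2) *\<^sub>R a + (1/2) *\<^sub>R b = (a + b) / 2"
    and eq3: "(1 - 1/3) *\<^sub>R ((a + b) / 2) + (1/3) *\<^sub>R c = (a + b + c) / 3"
    by (simp_all add: field_simps)
  have "((a + b) / 2) powr p \<le> (1 - 1/2) * a powr p + (1/2) * b powr p"
    unfolding eq2[symmetric] using assms by (intro convex_onD[OF cvx]) auto
  moreover have "((a + b + c) / 3) powr p \<le> (1 - 1/3) * ((a + b) / 2) powr p + (1/3) * c powr p"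
    unfolding eq3[symmetric] using assms by (intro convex_onD[OF cvx]) auto
  ultimately have "((a + b + c) / 3) powr p \<le> (a powr p + b powr p + c powr p) / 3"
    by argo
  then have "3 * 3 powr (p - 1) * ((a + b + c) / 3) powr p \<le> 3 powr (p - 1) * (a powr p + b powr p + c powr p)"
    by simp
  moreover have "3 * 3 powr (p - 1) * ((a + b + c) / 3) powr p = (a + b + c) powr p"
    using assms by (simp add: powr_divide powr_diff)
  ultimately show ?thesis
    by simp
qed

lemma le_one_plus_powr:
  fixes a q :: real
  assumes "a \<ge> 0" "q \<ge> 1"
  shows "a \<le> 1 + a powr q"
proof (cases "a \<le> 1")
  case False
  then have "a powr 1 \<le> a powr q"
    using assms by (intro powr_mono) auto
  then show ?thesis
    using False by simp
qed (simp add: add_increasing2)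

lemma Lp_space_dominated:
  fixes h :: "'a \<Rightarrow> 'b::real_normed_vector"
  assumes h: "h \<in> borel_measurable M"
    and bound: "AE t in M. norm (h t) powr p \<le> \<phi> t"
    and \<phi>: "integrable M \<phi>"
  shows "h \<in> Lp_space M p" "(\<integral>t. norm (h t) powr p \<partial>M) \<le> integral\<^sup>L M \<phi>"
proof -
  have int: "integrable M (\<lambda>t. norm (h t) powr p)"
  proof (rule Bochner_Integration.integrable_bound[OF \<phi>])
    show "(\<lambda>t. norm (h t) powr p) \<in> borel_measurable M"
      using h by measurable
    show "AE t in M. norm (norm (h t) powr p) \<le> norm (\<phi> t)"
      using bound by eventually_elim auto
  qed
  then show "h \<in> Lp_space M p"
    using h by (simp add: Lp_space_def)
  show "(\<integral>t. norm (h t) powr p \<partial>M) \<le> integral\<^sup>L M \<phi>"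
    using int \<phi> bound by (rule integral_mono_AE)
qed

lemma Lp_measurable: "x \<in> Lp_space N e \<Longrightarrow> x \<in> borel_measurable N"
  by (simp add: Lp_space_def)

lemma Lp_space_cong_AE:
  fixes g h :: "'a \<Rightarrow> 'b::real_normed_vector"
  assumes g: "g \<in> borel_measurable M" and h: "h \<in> Lp_space M p" and eq: "AE t in M. g t = h t"
  shows "g \<in> Lp_space M p"
proof (rule Lp_space_dominated(1)[OF g])
  show "AE t in M. norm (g t) powr p \<le> norm (h t) powr p"
    using eq by eventually_elim simp
  show "integrable M (\<lambda>t. norm (h t) powr p)"
    using h by (simp add: Lp_space_def)
qed

text \<open>
  The bound stands in for the Minkowski inequality when one works with \<open>p\<close>-th powers of norms.
\<close>

lemma Lp_space_add:
  fixes g h :: "'a \<Rightarrow> 'b::{real_normed_vector, second_countable_topology}"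
  assumes p: "p \<ge> 1" and g: "g \<in> Lp_space M p" and h: "h \<in> Lp_space M p"
  shows "(\<lambda>t. g t + h t) \<in> Lp_space M p"
    "(\<integral>t. norm (g t + h t) powr p \<partial>M)
      \<le> 2 powr (p - 1) * ((\<integral>t. norm (g t) powr p \<partial>M) + (\<integral>t. norm (h t) powr p \<partial>M))"
proof -
  let ?\<phi> = "\<lambda>t. 2 powr (p - 1) * (norm (g t) powr p + norm (h t) powr p)"
  have m: "(\<lambda>t. g t + h t) \<in> borel_measurable M"
    using g h by (auto simp: Lp_space_def intro: borel_measurable_add)
  have i: "integrable M ?\<phi>"
    using g h by (simp add: Lp_space_def)
  have b: "norm (g t + h t) powr p \<le> ?\<phi> t" for t
  proof -
    have "norm (g t + h t) powr p \<le> (norm (g t) + norm (h t)) powr p"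
      using p by (intro powr_mono2 norm_triangle_ineq) auto
    also have "\<dots> \<le> ?\<phi> t"
      using p by (intro powr_add_le) auto
    finally show ?thesis .
  qed
  show "(\<lambda>t. g t + h t) \<in> Lp_space M p"
    by (rule Lp_space_dominated(1)[OF m _ i]) (simp add: b)
  have "(\<integral>t. norm (g t + h t) powr p \<partial>M) \<le> integral\<^sup>L M ?\<phi>"
    by (rule Lp_space_dominated(2)[OF m _ i]) (simp add: b)
  then show "(\<integral>t. norm (g t + h t) powr p \<partial>M)
      \<le> 2 powr (p - 1) * ((\<integral>t. norm (g t) powr p \<partial>M) + (\<integral>t. norm (h t) powr p \<partial>M))"
    using g h by (simp add: Lp_space_def)
qed

lemma Lp_space_diff:
  fixes g h :: "'a \<Rightarrow> 'b::{real_normed_vector, second_countable_topology}"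
  assumes p: "p \<ge> 1" and g: "g \<in> Lp_space M p" and h: "h \<in> Lp_space M p"
  shows "(\<lambda>t. g t - h t) \<in> Lp_space M p"
    "(\<integral>t. norm (g t - h t) powr p \<partial>M)
      \<le> 2 powr (p - 1) * ((\<integral>t. norm (g t) powr p \<partial>M) + (\<integral>t. norm (h t) powr p \<partial>M))"
proof -
  have "(\<lambda>t. - h t) \<in> Lp_space M p"
    using h by (auto simp: Lp_space_def)
  from Lp_space_add[OF p g this] show "(\<lambda>t. g t - h t) \<in> Lp_space M p"
    "(\<integral>t. norm (g t - h t) powr p \<partial>M)
      \<le> 2 powr (p - 1) * ((\<integral>t. norm (g t) powr p \<partial>M) + (\<integral>t. norm (h t) powr p \<partial>M))"
    by simp_all
qed

text \<open>
  Both factors are scaled to norm one and Young's inequality is integrated; if one norm vanishes, so does the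
  product almost everywhere.
\<close>

lemma Holder_inequality:
  fixes g :: "'a \<Rightarrow> 'b::real_normed_vector" and h :: "'a \<Rightarrow> 'c::real_normed_vector"
  assumes pq: "p > 1" "q > 1" "1 / p + 1 / q = 1"
    and g: "g \<in> Lp_space M p" and h: "h \<in> Lp_space M q"
  shows "integrable M (\<lambda>t. norm (g t) * norm (h t))"
    "(\<integral>t. norm (g t) * norm (h t) \<partial>M)
      \<le> (\<integral>t. norm (g t) powr p \<partial>M) powr (1 / p) * (\<integral>t. norm (h t) powr q \<partial>M) powr (1 / q)"
proof -
  have [measurable]: "g \<in> borel_measurable M" "h \<in> borel_measurable M"
    and ig: "integrable M (\<lambda>t. norm (g t) powr p)" and ih: "integrable M (\<lambda>t. norm (h t) powr q)"
    using g h by (auto simp: Lp_space_def)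
  define a where "a = (\<integral>t. norm (g t) powr p \<partial>M) powr (1 / p)"
  define b where "b = (\<integral>t. norm (h t) powr q \<partial>M) powr (1 / q)"
  have ap: "a powr p = (\<integral>t. norm (g t) powr p \<partial>M)" and bq: "b powr q = (\<integral>t. norm (h t) powr q \<partial>M)"
    using pq by (simp_all add: a_def b_def powr_powr integral_nonneg_AE)
  have a0: "a \<ge> 0" and b0: "b \<ge> 0"
    by (simp_all add: a_def b_def)
  show int: "integrable M (\<lambda>t. norm (g t) * norm (h t))"
  proof (rule Bochner_Integration.integrable_bound)
    show "integrable M (\<lambda>t. norm (g t) powr p / p + norm (h t) powr q / q)"
      using ig ih by simp
    show "AE t in M. norm (norm (g t) * norm (h t))
        \<le> norm (norm (g t) powr p / p + norm (h t) powr q / q)"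
      using Youngs_inequality[OF pq] pq by (auto intro!: AE_I2 simp: abs_of_nonneg)
  qed simp
  show "(\<integral>t. norm (g t) * norm (h t) \<partial>M) \<le> a * b"
  proof (cases "a = 0 \<or> b = 0")
    case True
    then have "AE t in M. norm (g t) * norm (h t) = 0"
    proof
      assume "a = 0"
      then have "(\<integral>t. norm (g t) powr p \<partial>M) = 0"
        using ap pq by simp
      then have "AE t in M. norm (g t) powr p = 0"
        using ig by (subst (asm) integral_nonneg_eq_0_iff_AE) auto
      then show ?thesis
        by eventually_elim auto
    next
      assume "b = 0"
      then have "(\<integral>t. norm (h t) powr q \<partial>M) = 0"
        using bq pq by simp
      then have "AE t in M. norm (h t) powr q = 0"
        using ih by (subst (asm) integral_nonneg_eq_0_iff_AE) auto
      then show ?thesis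
        by eventually_elim auto
    qed
    then have "(\<integral>t. norm (g t) * norm (h t) \<partial>M) = 0"
      by (rule integral_eq_zero_AE)
    then show ?thesis
      using a0 b0 by simp
  next
    case False
    with a0 b0 have ab: "a > 0" "b > 0"
      by auto
    have "norm (g t) * norm (h t)
        \<le> a * b * (norm (g t) powr p / (p * a powr p) + norm (h t) powr q / (q * b powr q))" for t
    proof -
      have "norm (g t) / a * (norm (h t) / b)
          \<le> (norm (g t) / a) powr p / p + (norm (h t) / b) powr q / q"
        using ab by (intro Youngs_inequality[OF pq]) auto
      also have "\<dots> = norm (g t) powr p / (p * a powr p) + norm (h t) powr q / (q * b powr q)"
        using ab by (simp add: powr_divide ac_simps)
      finally show ?thesis
        using ab by (simp add: field_simps)
    qed
    then have "(\<integral>t. norm (g t) * norm (h t) \<partial>M)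
        \<le> (\<integral>t. a * b * (norm (g t) powr p / (p * a powr p) + norm (h t) powr q / (q * b powr q)) \<partial>M)"
      using int ig ih by (intro integral_mono) auto
    also have "\<dots> = a * b * ((\<integral>t. norm (g t) powr p \<partial>M) / (p * a powr p)
        + (\<integral>t. norm (h t) powr q \<partial>M) / (q * b powr q))"
      using ig ih by simp
    also have "\<dots> = a * b * (1 / p + 1 / q)"
      using ab by (simp flip: ap bq)
    finally show ?thesis
      using pq by simp
  qed
qed

lemma integrable_Lp_space:
  fixes g :: "'a \<Rightarrow> 'b::real_normed_vector"
  assumes "finite_measure M" "p \<ge> 1" "g \<in> Lp_space M p"
  shows "integrable M (\<lambda>t. norm (g t))"
proof -
  interpret finite_measure M by fact
  have le: "norm (g t) \<le> 1 + norm (g t) powr p" for t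
    using assms by (intro le_one_plus_powr) auto
  have int: "integrable M (\<lambda>t. 1 + norm (g t) powr p)"
    using assms by (simp add: Lp_space_def)
  show ?thesis
  proof (rule Bochner_Integration.integrable_bound[OF int])
    show "(\<lambda>t. norm (g t)) \<in> borel_measurable M"
      using assms by (auto simp: Lp_space_def intro: borel_measurable_norm)
    show "AE t in M. norm (norm (g t)) \<le> norm (1 + norm (g t) powr p)"
      by (rule AE_I2) (use le in simp)
  qed
qed

text \<open>
  The series of \<open>norm (g i t) powr e\<close>, weighted with a geometric sequence that grows more slowly than
  \<open>1 / \<theta> ^ i\<close>, still has finite integral. So at almost every \<open>t\<close> the values \<open>norm (g i t) powr e\<close> are
  dominated by a geometric sequence, and then so are their roots. Exponents below \<open>1\<close> are included because
  \<open>1/2\<close> occurs in \<open>midpoint_hull_AE_convergent\<close>.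
\<close>

lemma AE_summable_of_geometric:
  fixes g :: "nat \<Rightarrow> 'a \<Rightarrow> 'b::real_normed_vector"
  assumes e: "e > 0" and th: "0 \<le> \<theta>" "\<theta> < 1"
    and g: "\<And>i. g i \<in> Lp_space M e"
    and bound: "\<And>i. (\<integral>t. norm (g i t) powr e \<partial>M) \<le> C * \<theta> ^ i"
  shows "AE t in M. summable (\<lambda>i. norm (g i t))"
proof -
  define \<eta> where "\<eta> = sqrt ((1 + \<theta>) / 2)"
  have \<eta>: "0 < \<eta>" "\<eta> < 1"
    using th by (auto simp: \<eta>_def real_less_lsqrt)
  have \<eta>2: "\<theta> < \<eta>\<^sup>2"
    using th by (simp add: \<eta>_def)
  have [measurable]: "g i \<in> borel_measurable M" for i
    using g by (simp add: Lp_space_def)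
  have C: "0 \<le> C"
    using order_trans[OF _ bound[of 0]] by (simp add: integral_nonneg_AE)
  let ?h = "\<lambda>i t. norm (g i t) powr e / \<eta>\<^sup>2 ^ i"
  have "(\<integral>\<^sup>+t. (\<Sum>i. ennreal (?h i t)) \<partial>M) = (\<Sum>i. \<integral>\<^sup>+t. ennreal (?h i t) \<partial>M)"
    by (rule nn_integral_suminf) measurable
  also have "\<dots> \<le> (\<Sum>i. ennreal (C * (\<theta> / \<eta>\<^sup>2) ^ i))"
  proof (intro suminf_le allI)
    fix i
    have "(\<integral>\<^sup>+t. ennreal (?h i t) \<partial>M) = ennreal (\<integral>t. ?h i t \<partial>M)"
      using g[of i] by (intro nn_integral_eq_integral) (auto simp: Lp_space_def)
    also have "\<dots> \<le> ennreal (C * (\<theta> / \<eta>\<^sup>2) ^ i)"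
      using bound[of i] \<eta> by (intro ennreal_leI) (simp add: power_divide divide_right_mono)
    finally show "(\<integral>\<^sup>+t. ennreal (?h i t) \<partial>M) \<le> ennreal (C * (\<theta> / \<eta>\<^sup>2) ^ i)" .
  qed auto
  also have "\<dots> = ennreal (\<Sum>i. C * (\<theta> / \<eta>\<^sup>2) ^ i)"
    using C th \<eta> \<eta>2 by (intro suminf_ennreal2) (auto intro!: summable_mult summable_geometric)
  also have "\<dots> < \<infinity>"
    by simp
  finally have "AE t in M. (\<Sum>i. ennreal (?h i t)) \<noteq> \<infinity>"
    by (intro nn_integral_PInf_AE) auto
  then show ?thesis
  proof eventually_elim
    fix t assume fin: "(\<Sum>i. ennreal (?h i t)) \<noteq> \<infinity>"
    have "summable (\<lambda>i. ?h i t)"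
      using fin \<eta> by (intro summable_suminf_not_top) simp_all
    then have "Bseq (\<lambda>i. ?h i t)"
      by (rule summable_imp_Bseq)
    then obtain K where "\<forall>i. norm (?h i t) \<le> K"
      by (rule BseqE)
    then have h: "?h i t \<le> K" for i
      using norm_ge_zero by (metis abs_le_D1 real_norm_def)
    then have K: "K \<ge> 0"
      using order_trans[OF _ h[of 0]] by simp
    define \<rho> where "\<rho> = (\<eta>\<^sup>2) powr (1 / e)"
    have le: "norm (g i t) \<le> K powr (1 / e) * \<rho> ^ i" for i
    proof -
      have "norm (g i t) powr e \<le> K * (\<eta>\<^sup>2) ^ i"
        using h[of i] \<eta> by (simp add: field_simps)
      then have "(norm (g i t) powr e) powr (1 / e) \<le> (K * (\<eta>\<^sup>2) ^ i) powr (1 / e)"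
        using e by (intro powr_mono2) auto
      moreover have "((\<eta>\<^sup>2) ^ i) powr (1 / e) = \<rho> ^ i"
        unfolding \<rho>_def by (induction i) (simp_all add: powr_mult)
      moreover have "(norm (g i t) powr e) powr (1 / e) = norm (g i t)"
        using e by (simp add: powr_powr)
      ultimately show ?thesis
        using K by (simp add: powr_mult)
    qed
    have "0 \<le> \<rho>" "\<rho> < 1"
      using \<eta> e powr_less_mono2[of "1 / e" "\<eta>\<^sup>2" 1]
      by (simp_all add: \<rho>_def power_less_one_iff)
    then have "summable (\<lambda>i. K powr (1 / e) * \<rho> ^ i)"
      by (intro summable_mult summable_geometric) simp
    then show "summable (\<lambda>i. norm (g i t))"
      by (rule summable_comparison_test'[where N = 0]) (simp add: le)
  qed
qed

lemma AE_convergent_of_geometric: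
  fixes v :: "nat \<Rightarrow> 'a \<Rightarrow> 'b::banach"
  assumes "e > 0" "0 \<le> \<theta>" "\<theta> < 1"
    and "\<And>i. (\<lambda>t. v (Suc i) t - v i t) \<in> Lp_space M e"
    and "\<And>i. (\<integral>t. norm (v (Suc i) t - v i t) powr e \<partial>M) \<le> C * \<theta> ^ i"
  shows "AE t in M. (\<lambda>i. v i t) \<longlonglongrightarrow> lim (\<lambda>i. v i t)"
  using AE_summable_of_geometric[OF assms]
proof eventually_elim
  fix t assume "summable (\<lambda>i. norm (v (Suc i) t - v i t))"
  then have "summable (\<lambda>i. v (Suc i) t - v i t)"
    by (rule summable_norm_cancel)
  then have "convergent (\<lambda>n. \<Sum>i<n. v (Suc i) t - v i t)"
    by (simp add: summable_iff_convergent)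
  then have "convergent (\<lambda>n. v n t - v 0 t)"
    by (subst (asm) sum_lessThan_telescope)
  then have "convergent (\<lambda>n. (v n t - v 0 t) + v 0 t)"
    by (intro convergent_add convergent_const)
  then show "(\<lambda>i. v i t) \<longlonglongrightarrow> lim (\<lambda>i. v i t)"
    by (simp add: convergent_LIMSEQ_iff)
qed

text \<open>
  This is Fatou's lemma.
\<close>

lemma Lp_space_AE_limit:
  fixes v :: "nat \<Rightarrow> 'a \<Rightarrow> 'b::real_normed_vector"
  assumes q: "q > 0" and v: "\<And>i. v i \<in> Lp_space M q"
    and bound: "\<And>i. (\<integral>t. norm (v i t) powr q \<partial>M) \<le> R"
    and w: "w \<in> borel_measurable M"
    and lim: "AE t in M. (\<lambda>i. v i t) \<longlonglongrightarrow> w t"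
  shows "w \<in> Lp_space M q" "(\<integral>t. norm (w t) powr q \<partial>M) \<le> R"
proof -
  have [measurable]: "v i \<in> borel_measurable M" for i
    using v by (simp add: Lp_space_def)
  note [measurable] = w
  have R: "0 \<le> R"
    using order_trans[OF _ bound[of 0]] by (simp add: integral_nonneg_AE)
  have "(\<integral>\<^sup>+t. ennreal (norm (w t) powr q) \<partial>M)
      \<le> (\<integral>\<^sup>+t. liminf (\<lambda>i. ennreal (norm (v i t) powr q)) \<partial>M)"
  proof (rule nn_integral_mono_AE, use lim in eventually_elim)
    fix t assume l: "(\<lambda>i. v i t) \<longlonglongrightarrow> w t"
    show "ennreal (norm (w t) powr q) \<le> liminf (\<lambda>i. ennreal (norm (v i t) powr q))"
    proof (cases "w t = 0")
      case False
      then have "(\<lambda>i. ennreal (norm (v i t) powr q)) \<longlonglongrightarrow> ennreal (norm (w t) powr q)"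
        using l by (intro tendsto_ennrealI tendsto_powr tendsto_norm tendsto_const) auto
      from lim_imp_Liminf[OF _ this] show ?thesis
        by simp
    qed simp
  qed
  also have "\<dots> \<le> liminf (\<lambda>i. \<integral>\<^sup>+t. ennreal (norm (v i t) powr q) \<partial>M)"
    by (rule nn_integral_liminf) measurable
  also have "\<dots> \<le> ennreal R"
  proof -
    have "(\<integral>\<^sup>+t. ennreal (norm (v i t) powr q) \<partial>M) \<le> ennreal R" for i
      using v[of i] bound[of i]
      by (subst nn_integral_eq_integral) (auto simp: Lp_space_def intro: ennreal_leI)
    then show ?thesis
      by (intro Liminf_le) (auto intro!: always_eventually)
  qed
  finally have le: "(\<integral>\<^sup>+t. ennreal (norm (w t) powr q) \<partial>M) \<le> ennreal R" .
  then have "integrable M (\<lambda>t. norm (w t) powr q)"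
    by (intro integrableI_bounded) (auto intro: le_less_trans)
  then show "w \<in> Lp_space M q" "(\<integral>t. norm (w t) powr q \<partial>M) \<le> R"
    using le R w by (auto simp: Lp_space_def nn_integral_eq_integral ennreal_le_iff)
qed

lemma Lp_norm_powr:
  assumes "p > 0"
  shows "Lp_norm M p g powr p = (\<integral>t. norm (g t) powr p \<partial>M)"
  using assms by (simp add: Lp_norm_def powr_powr integral_nonneg_AE)

lemma Lp_norm_nonneg: "Lp_norm M p g \<ge> 0"
  by (simp add: Lp_norm_def)

lemma Lp_norm_le_iff:
  "p > 0 \<Longrightarrow> c \<ge> 0 \<Longrightarrow> Lp_norm M p g \<le> c \<longleftrightarrow> (\<integral>t. norm (g t) powr p \<partial>M) \<le> c powr p"
  by (metis Lp_norm_nonneg Lp_norm_powr linorder_not_le powr_less_mono2 powr_mono2 less_eq_real_def)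

lemma Lp_norm_less_iff:
  "p > 0 \<Longrightarrow> c \<ge> 0 \<Longrightarrow> Lp_norm M p g < c \<longleftrightarrow> (\<integral>t. norm (g t) powr p \<partial>M) < c powr p"
  by (metis Lp_norm_nonneg Lp_norm_powr linorder_not_le powr_less_mono2 powr_mono2 less_eq_real_def)

lemma Lp_norm_eq_iff:
  assumes "p > 0" "c \<ge> 0"
  shows "Lp_norm M p g = c \<longleftrightarrow> (\<integral>t. norm (g t) powr p \<partial>M) = c powr p"
  using Lp_norm_le_iff[OF assms, of M g] Lp_norm_less_iff[OF assms, of M g] by linarith

text \<open>
  If the essential supremum is minus infinity, its conversion to a real number is the default value \<open>0\<close>, but then
  the whole space is a null set.
\<close>

lemma AE_norm_le_Linf_norm:
  assumes "g \<in> Linf_space M"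
  shows "AE t in M. norm (g t) \<le> Linf_norm M g"
proof -
  have lt: "esssup M (\<lambda>t. ereal (norm (g t))) < \<infinity>"
    using assms by (simp add: Linf_space_def)
  show ?thesis
    using esssup_AE[where M = M and f = "\<lambda>t. ereal (norm (g t))"]
  proof eventually_elim
    fix t assume "ereal (norm (g t)) \<le> esssup M (\<lambda>t. ereal (norm (g t)))"
    then show "norm (g t) \<le> Linf_norm M g"
      using lt unfolding Linf_norm_def by (cases "esssup M (\<lambda>t. ereal (norm (g t)))") auto
  qed
qed

lemma Linf_norm_nonneg: "g \<in> Linf_space M \<Longrightarrow> Linf_norm M g \<ge> 0"
proof (rule ccontr)
  assume g: "g \<in> Linf_space M" and "\<not> Linf_norm M g \<ge> 0"
  then have neg: "Linf_norm M g < 0" by simp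
  have "AE t in M. norm (g t) \<le> Linf_norm M g"
    using g by (rule AE_norm_le_Linf_norm)
  then have "AE t in M. ereal (norm (g t)) \<le> - \<infinity>"
  proof (rule eventually_mono)
    fix t assume "norm (g t) \<le> Linf_norm M g"
    then show "ereal (norm (g t)) \<le> - \<infinity>"
      using neg norm_ge_zero[of "g t"] by linarith
  qed
  moreover have "(\<lambda>t. ereal (norm (g t))) \<in> borel_measurable M"
    using g by (auto simp: Linf_space_def intro: borel_measurable_norm)
  ultimately have "esssup M (\<lambda>t. ereal (norm (g t))) \<le> - \<infinity>"
    by (intro esssup_I)
  with neg show False
    by (simp add: Linf_norm_def)
qed

section \<open>Almost everywhere convergent averages of bounded sequences\<close>

text \<open>
  Quantitative strict convexity of \<open>\<phi> x = sqrt (1 + |x|\<^sup>2)\<close>: a small gap between the mean of the values and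
  the value at the midpoint forces \<open>a\<close> and \<open>b\<close> to be close. Since \<open>\<phi> x\<close> is the Euclidean norm of
  \<open>(1, x)\<close>, the gap \<open>\<delta>\<close> measures the failure of equality in a triangle inequality, and Cauchy-Schwarz leads to
  \<open>|a - b|\<^sup>2 \<le> \<delta> W\<^sup>3\<close> with \<open>W = \<phi> a + \<phi> b\<close>. The stated form follows by distinguishing whether
  \<open>|a - b| powr (1/2)\<close> is below \<open>W / m\<close>; it is linear in \<open>\<delta>\<close> and \<open>W\<close>, hence ready for integration.
\<close>

lemma midpoint_gap_sqrt_one_plus_norm:
  fixes a b :: "'b::real_inner"
  assumes m: "m > 0"
  defines "\<phi> \<equiv> \<lambda>x::'b. sqrt (1 + (norm x)\<^sup>2)"
  shows "norm (a - b) powr (1/2)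
    \<le> m ^ 3 * ((\<phi> a + \<phi> b) / 2 - \<phi> ((1/2) *\<^sub>R (a + b))) + (\<phi> a + \<phi> b) / m"
proof -
  define A where "A = \<phi> a"
  define B where "B = \<phi> b"
  define C where "C = \<phi> ((1/2) *\<^sub>R (a + b))"
  define i where "i = a \<bullet> b"
  define W where "W = A + B"
  define \<delta> where "\<delta> = W / 2 - C"
  have nonneg: "A \<ge> 0" "B \<ge> 0" "C \<ge> 0" "W \<ge> 0"
    by (auto simp: A_def B_def C_def W_def \<phi>_def)
  have A2: "A\<^sup>2 = 1 + a \<bullet> a" and B2: "B\<^sup>2 = 1 + b \<bullet> b"
    by (simp_all add: A_def B_def \<phi>_def power2_norm_eq_inner add_nonneg_nonneg)
  have C2: "4 * C\<^sup>2 = 4 + a \<bullet> a + b \<bullet> b + 2 * i"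
  proof -
    have "C\<^sup>2 = 1 + (norm ((1/2) *\<^sub>R (a + b)))\<^sup>2"
      by (simp add: C_def \<phi>_def)
    then show ?thesis
      unfolding i_def power2_norm_eq_inner
      by (simp add: inner_add_left inner_add_right inner_commute algebra_simps)
  qed
  have cs: "i\<^sup>2 \<le> (a \<bullet> a) * (b \<bullet> b)"
    unfolding i_def by (rule Cauchy_Schwarz_ineq)
  have nab: "(norm (a - b))\<^sup>2 = a \<bullet> a + b \<bullet> b - 2 * i"
    unfolding i_def power2_norm_eq_inner
    by (simp add: inner_diff_left inner_diff_right inner_commute algebra_simps)
  have AB: "(A * B)\<^sup>2 - (1 + i)\<^sup>2 = (norm (a - b))\<^sup>2 + ((a \<bullet> a) * (b \<bullet> b) - i\<^sup>2)"
    unfolding power_mult_distrib A2 B2 nab by (simp add: power2_eq_square algebra_simps)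
  have "(1 + i)\<^sup>2 \<le> (A * B)\<^sup>2"
    using AB cs zero_le_power2[of "norm (a - b)"] by linarith
  then have i_le: "1 + i \<le> A * B"
    using nonneg by (meson mult_nonneg_nonneg power2_le_imp_le)
  have W2: "W\<^sup>2 - (2 * C)\<^sup>2 = 2 * (A * B - (1 + i))"
    using A2 B2 C2 unfolding W_def by (simp add: power2_eq_square algebra_simps)
  then have "W\<^sup>2 - (2 * C)\<^sup>2 \<ge> 0"
    using i_le by simp
  then have "(2 * C)\<^sup>2 \<le> W\<^sup>2"
    by simp
  then have CW: "2 * C \<le> W"
    using nonneg by (meson power2_le_imp_le)
  then have \<delta>: "\<delta> \<ge> 0"
    by (simp add: \<delta>_def)
  have "W\<^sup>2 - (2 * C)\<^sup>2 = 2 * \<delta> * (W + 2 * C)"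
    by (simp add: \<delta>_def power2_eq_square algebra_simps)
  also have "\<dots> \<le> 2 * \<delta> * (2 * W)"
    using CW \<delta> by (intro mult_left_mono) auto
  finally have gap: "A * B - (1 + i) \<le> 2 * \<delta> * W"
    using W2 by simp
  have AB4: "4 * (A * B) \<le> W\<^sup>2"
    using zero_le_power2[of "A - B"] unfolding W_def by (simp add: power2_eq_square algebra_simps)
  have "(norm (a - b))\<^sup>2 \<le> (A * B)\<^sup>2 - (1 + i)\<^sup>2"
    using AB cs by linarith
  also have "\<dots> = (A * B - (1 + i)) * (A * B + (1 + i))"
    by (simp add: power2_eq_square algebra_simps)
  also have "\<dots> \<le> (2 * \<delta> * W) * (2 * (A * B))"
  proof (rule order_trans[OF mult_left_mono mult_right_mono])
    show "A * B + (1 + i) \<le> 2 * (A * B)" "0 \<le> A * B - (1 + i)"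
      using i_le by auto
  qed (use gap nonneg in auto)
  also have "\<dots> \<le> (2 * \<delta> * W) * (W\<^sup>2 / 2)"
    using AB4 \<delta> nonneg by (intro mult_left_mono) auto
  finally have main: "(norm (a - b))\<^sup>2 \<le> \<delta> * W ^ 3"
    by (simp add: power2_eq_square power3_eq_cube)
  define t where "t = norm (a - b) powr (1/2)"
  have t0: "t \<ge> 0" and t2: "t\<^sup>2 = norm (a - b)"
    by (simp_all add: t_def powr_half_sqrt)
  have "t \<le> m ^ 3 * \<delta> + W / m"
  proof (cases "t \<le> W / m")
    case True
    then show ?thesis
      using \<delta> m by (simp add: add_increasing)
  next
    case False
    then have Wt: "W < m * t"
      using m by (simp add: field_simps)
    have tpos: "t > 0"
      using False divide_nonneg_pos[OF nonneg(4) m] by linarith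
    have "t ^ 3 * t = (norm (a - b))\<^sup>2"
      unfolding t2[symmetric] by (simp add: power2_eq_square power3_eq_cube)
    also have "\<dots> \<le> \<delta> * (m * t) ^ 3"
      using main Wt \<delta> nonneg
      by (meson less_imp_le mult_left_mono order_trans power_mono)
    also have "\<dots> = t ^ 3 * (m ^ 3 * \<delta>)"
      by (simp add: power_mult_distrib)
    finally have "t \<le> m ^ 3 * \<delta>"
      using tpos by (simp add: mult_le_cancel_left_pos)
    then show ?thesis
      using m nonneg by (simp add: add_increasing2)
  qed
  then show ?thesis
    unfolding t_def \<delta>_def W_def A_def B_def C_def .
qed

text \<open>
  Convex combinations with dyadic weights are enough for the averaging argument, and closing a set under midpoints
  avoids any bookkeeping of coefficients.
\<close>

inductive_set midpoint_hull :: "('a \<Rightarrow> 'b::real_vector) set \<Rightarrow> ('a \<Rightarrow> 'b) set" for S where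
  base: "u \<in> S \<Longrightarrow> u \<in> midpoint_hull S"
| midpoint: "v \<in> midpoint_hull S \<Longrightarrow> w \<in> midpoint_hull S
    \<Longrightarrow> (\<lambda>t. (1/2) *\<^sub>R (v t + w t)) \<in> midpoint_hull S"

lemma midpoint_hull_mono:
  assumes "S \<subseteq> T"
  shows "midpoint_hull S \<subseteq> midpoint_hull T"
proof
  fix v assume "v \<in> midpoint_hull S"
  then show "v \<in> midpoint_hull T"
    by induction (use assms in \<open>auto intro: midpoint_hull.intros\<close>)
qed

lemma midpoint_hull_Lp_ball:
  fixes S :: "('a \<Rightarrow> 'b::{real_normed_vector, second_countable_topology}) set"
  assumes q: "q \<ge> 1"
    and S: "\<And>u. u \<in> S \<Longrightarrow> u \<in> Lp_space M q \<and> (\<integral>t. norm (u t) powr q \<partial>M) \<le> R"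
    and v: "v \<in> midpoint_hull S"
  shows "v \<in> Lp_space M q \<and> (\<integral>t. norm (v t) powr q \<partial>M) \<le> R"
  using v
proof induction
  case (midpoint v w)
  let ?s = "\<lambda>t. v t + w t"
  have s: "?s \<in> Lp_space M q"
    "(\<integral>t. norm (?s t) powr q \<partial>M) \<le> 2 powr (q - 1) * (R + R)"
  proof -
    show "?s \<in> Lp_space M q"
      using midpoint.IH q by (intro Lp_space_add) auto
    have "(\<integral>t. norm (?s t) powr q \<partial>M)
        \<le> 2 powr (q - 1) * ((\<integral>t. norm (v t) powr q \<partial>M) + (\<integral>t. norm (w t) powr q \<partial>M))"
      using midpoint.IH q by (intro Lp_space_add) auto
    also have "\<dots> \<le> 2 powr (q - 1) * (R + R)"
      using midpoint.IH by (intro mult_left_mono add_mono) auto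
    finally show "(\<integral>t. norm (?s t) powr q \<partial>M) \<le> 2 powr (q - 1) * (R + R)" .
  qed
  have e: "norm ((1/2) *\<^sub>R ?s t) powr q = norm (?s t) powr q / 2 powr q" for t
    by (simp add: powr_divide)
  have "(\<lambda>t. (1/2) *\<^sub>R ?s t) \<in> borel_measurable M"
    using s(1) by (auto simp: Lp_space_def intro: borel_measurable_scaleR)
  then have "(\<lambda>t. (1/2) *\<^sub>R ?s t) \<in> Lp_space M q"
    using s(1) unfolding Lp_space_def by (auto simp: e simp del: norm_scaleR)
  moreover have "(\<integral>t. norm ((1/2) *\<^sub>R ?s t) powr q \<partial>M) \<le> 2 powr (q - 1) * (R + R) / 2 powr q"
    unfolding e using s(2) by (simp add: divide_right_mono)
  moreover have "2 powr (q - 1) * (R + R) / 2 powr q = R"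
    by (simp add: powr_diff)
  ultimately show ?case
    by simp
qed (use S in auto)

text \<open>
  A substitute for weak sequential compactness, in the spirit of Komlos. Minimise the strictly convex functional
  \<open>\<Phi> v\<close>, the integral of \<open>sqrt (1 + |v|\<^sup>2)\<close>, over the midpoint hulls of the tails. The infima \<open>d j\<close>
  increase to a finite limit \<open>D\<close>. Near-minimisers \<open>v j\<close> and \<open>v (Suc j)\<close> lie in a common hull, which also
  contains their midpoint, whence the integrated midpoint gap is of the order \<open>16\<^sup>-\<^sup>j\<close>. By \<open>midpoint_gap_sqrt_one_plus_norm\<close>
  the integral of \<open>|v (Suc j) - v j| powr (1/2)\<close> is of the order \<open>2\<^sup>-\<^sup>j\<close>, and \<open>AE_convergent_of_geometric\<close>
  applies.
\<close>

lemma midpoint_hull_AE_convergent: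
  fixes u :: "nat \<Rightarrow> 'a \<Rightarrow> 'b::euclidean_space"
  assumes fin: "finite_measure M" and q: "q \<ge> 1"
    and u: "\<And>i. u i \<in> Lp_space M q" and R: "\<And>i. (\<integral>t. norm (u i t) powr q \<partial>M) \<le> R"
  obtains v w where "\<forall>j. v j \<in> midpoint_hull (u ` {j..})"
    and "w \<in> borel_measurable M" and "AE t in M. (\<lambda>j. v j t) \<longlonglongrightarrow> w t"
proof -
  interpret finite_measure M by fact
  define C where "C j = midpoint_hull (u ` {j..})" for j
  define \<phi> where "\<phi> x = sqrt (1 + (norm x)\<^sup>2)" for x :: 'b
  define \<Phi> where "\<Phi> v = (\<integral>t. \<phi> (v t) \<partial>M)" for v
  have C_Lp: "v \<in> Lp_space M q" and C_R: "(\<integral>t. norm (v t) powr q \<partial>M) \<le> R" if "v \<in> C j" for v j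
    using midpoint_hull_Lp_ball[OF q, where S = "u ` {j..}" and v = v and M = M and R = R] that u R
    by (auto simp: C_def)
  have C_mono: "C j \<subseteq> C i" if "i \<le> j" for i j
    unfolding C_def using that by (intro midpoint_hull_mono image_mono) auto
  have uC: "u j \<in> C j" for j
    unfolding C_def by (rule midpoint_hull.base) simp
  have \<phi>0: "\<phi> x \<ge> 0" for x
    by (simp add: \<phi>_def)
  have \<phi>_le: "\<phi> x \<le> 1 + norm x" for x
    unfolding \<phi>_def by (rule real_le_lsqrt) (auto simp: power2_eq_square algebra_simps)
  have int_norm: "integrable M (\<lambda>t. norm (v t))" if "v \<in> C j" for v j
    using fin q C_Lp[OF that] by (rule integrable_Lp_space)
  have int_\<phi>: "integrable M (\<lambda>t. \<phi> (v t))" if "v \<in> C j" for v j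
  proof (rule Bochner_Integration.integrable_bound)
    show "integrable M (\<lambda>t. 1 + norm (v t))"
      using int_norm[OF that] by simp
    show "(\<lambda>t. \<phi> (v t)) \<in> borel_measurable M"
    proof -
      have [measurable]: "v \<in> borel_measurable M"
        using C_Lp[OF that] by (simp add: Lp_space_def)
      show ?thesis
        unfolding \<phi>_def by measurable
    qed
    show "AE t in M. norm (\<phi> (v t)) \<le> norm (1 + norm (v t))"
      by (rule AE_I2) (use \<phi>_le \<phi>0 in simp)
  qed
  have \<Phi>0: "\<Phi> v \<ge> 0" for v
    unfolding \<Phi>_def by (intro integral_nonneg_AE AE_I2 \<phi>0)
  define K where "K = 2 * measure M (space M) + R"
  have \<Phi>_K: "\<Phi> v \<le> K" if "v \<in> C j" for v j
  proof -
    have "\<Phi> v \<le> (\<integral>t. 2 + norm (v t) powr q \<partial>M)"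
      unfolding \<Phi>_def
    proof (rule integral_mono)
      show "integrable M (\<lambda>t. \<phi> (v t))"
        by (rule int_\<phi>[OF that])
      show "integrable M (\<lambda>t. 2 + norm (v t) powr q)"
        using C_Lp[OF that] by (simp add: Lp_space_def)
      fix t
      have "norm (v t) \<le> 1 + norm (v t) powr q"
        using q by (intro le_one_plus_powr) auto
      then show "\<phi> (v t) \<le> 2 + norm (v t) powr q"
        using \<phi>_le[of "v t"] by linarith
    qed
    also have "\<dots> = 2 * measure M (space M) + (\<integral>t. norm (v t) powr q \<partial>M)"
      using C_Lp[OF that] by (simp add: Lp_space_def)
    finally show ?thesis
      using C_R[OF that] by (simp add: K_def)
  qed
  define d where "d j = Inf (\<Phi> ` C j)" for j
  have bdd: "bdd_below (\<Phi> ` C j)" for j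
    using \<Phi>0 by (intro bdd_belowI[of _ 0]) auto
  have d_le: "d j \<le> \<Phi> v" if "v \<in> C j" for v j
    unfolding d_def using that bdd by (intro cInf_lower) auto
  have d_mono: "d i \<le> d j" if "i \<le> j" for i j
    unfolding d_def using C_mono[OF that] uC[of j] bdd by (intro cInf_superset_mono) auto
  have d_K: "d j \<le> K" for j
    using d_le[OF uC] \<Phi>_K[OF uC] by (rule order_trans)
  define D where "D = Sup (range d)"
  have d_D: "d j \<le> D" for j
    unfolding D_def using d_K by (intro cSup_upper bdd_aboveI[of _ K]) auto
  have "\<exists>N. D - 1 / 16 ^ j < d N" for j :: nat
  proof -
    have "D - 1 / 16 ^ j < D"
      by simp
    then show ?thesis
      unfolding D_def using d_K by (subst (asm) less_cSup_iff) (auto intro: bdd_aboveI[of _ K])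
  qed
  then obtain N where N: "\<And>j::nat. D - 1 / 16 ^ j < d (N j)"
    by metis
  \<comment> \<open>Any nondecreasing index sequence with \<open>n j \<ge> j\<close> and \<open>n j \<ge> N j\<close> serves here.\<close>
  define n where "n j = j + (\<Sum>i\<le>j. N i)" for j
  have n_ge: "j \<le> n j" "N j \<le> n j" for j
    unfolding n_def by (auto intro: trans_le_add2 member_le_sum)
  have n_Suc: "n j \<le> n (Suc j)" for j
    unfolding n_def by simp
  have d_n: "D - 1 / 16 ^ j < d (n j)" for j
    using N[of j] d_mono[OF n_ge(2)[of j]] by linarith
  have "\<exists>v\<in>C (n j). \<Phi> v < d (n j) + 1 / 16 ^ j" for j
  proof -
    have "Inf (\<Phi> ` C (n j)) < d (n j) + 1 / 16 ^ j"
      by (simp add: d_def)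
    then show ?thesis
      using uC[of "n j"] bdd by (subst (asm) cInf_less_iff) auto
  qed
  then obtain v where v: "\<And>j. v j \<in> C (n j)" and \<Phi>_v: "\<And>j. \<Phi> (v j) < d (n j) + 1 / 16 ^ j"
    by metis
  have [measurable]: "v j \<in> borel_measurable M" for j
    using C_Lp[OF v] by (simp add: Lp_space_def)
  \<comment> \<open>The gap estimate with \<open>m = 2 ^ j\<close>: the gap is multiplied by \<open>8 ^ j\<close>, which its order \<open>16\<^sup>-\<^sup>j\<close> absorbs,
    and the remaining term is bounded by a constant times \<open>2\<^sup>-\<^sup>j\<close>.\<close>
  have gap: "(\<lambda>t. v (Suc j) t - v j t) \<in> Lp_space M (1/2)
      \<and> (\<integral>t. norm (v (Suc j) t - v j t) powr (1/2) \<partial>M) \<le> (2 * K + 2) * (1/2) ^ j" for j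
  proof -
    let ?a = "v (Suc j)" and ?b = "v j"
    let ?c = "\<lambda>t. (1/2) *\<^sub>R (?a t + ?b t)"
    let ?f = "\<lambda>t. (2 ^ j) ^ 3 * ((\<phi> (?a t) + \<phi> (?b t)) / 2 - \<phi> (?c t)) + (\<phi> (?a t) + \<phi> (?b t)) / 2 ^ j"
    have a: "?a \<in> C (n j)"
      using v[of "Suc j"] C_mono[OF n_Suc] by auto
    have c: "?c \<in> C (n j)"
      using a v[of j] unfolding C_def by (rule midpoint_hull.midpoint)
    have ints: "integrable M (\<lambda>t. \<phi> (?a t))" "integrable M (\<lambda>t. \<phi> (?b t))" "integrable M (\<lambda>t. \<phi> (?c t))"
      using int_\<phi>[OF a] int_\<phi>[OF v] int_\<phi>[OF c] .
    have intf: "integrable M ?f"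
      using ints by simp
    have m: "(\<lambda>t. ?a t - ?b t) \<in> borel_measurable M"
      by measurable
    have ae: "AE t in M. norm (?a t - ?b t) powr (1/2) \<le> ?f t"
      unfolding \<phi>_def by (intro AE_I2 midpoint_gap_sqrt_one_plus_norm) simp
    have "integral\<^sup>L M ?f = (2 ^ j) ^ 3 * ((\<Phi> ?a + \<Phi> ?b) / 2 - \<Phi> ?c) + (\<Phi> ?a + \<Phi> ?b) / 2 ^ j"
      using ints by (simp add: \<Phi>_def)
    also have "\<dots> \<le> (2 ^ j) ^ 3 * (2 / 16 ^ j) + 2 * K / 2 ^ j"
    proof (intro add_mono mult_left_mono divide_right_mono)
      have "1 / 16 ^ Suc j \<le> (1 / 16 ^ j :: real)"
        by (simp add: field_simps)
      then show "(\<Phi> ?a + \<Phi> ?b) / 2 - \<Phi> ?c \<le> 2 / 16 ^ j"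
        using \<Phi>_v[of j] \<Phi>_v[of "Suc j"] d_D[of "n j"] d_D[of "n (Suc j)"] d_n[of j] d_le[OF c]
        by argo
      show "\<Phi> ?a + \<Phi> ?b \<le> 2 * K"
        using \<Phi>_K[OF a] \<Phi>_K[OF v[of j]] by simp
    qed auto
    also have "\<dots> = (2 * K + 2) * (1/2) ^ j"
    proof -
      have "(2 ^ j :: real) ^ 3 / 16 ^ j = (1/2) ^ j"
        by (simp add: power_mult[symmetric] mult.commute[of j] flip: power_divide)
          (simp add: power_mult flip: power_divide)
      then show ?thesis
        by (simp add: field_simps)
    qed
    finally have "integral\<^sup>L M ?f \<le> (2 * K + 2) * (1/2) ^ j" .
    then show ?thesis
      using Lp_space_dominated[OF m ae intf] by (auto intro: order_trans)
  qed
  have "AE t in M. (\<lambda>j. v j t) \<longlonglongrightarrow> lim (\<lambda>j. v j t)"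
    by (rule AE_convergent_of_geometric[where e = "1/2" and \<theta> = "1/2"]) (use gap in auto)
  moreover have "v j \<in> midpoint_hull (u ` {j..})" for j
    using v[of j] C_mono[OF n_ge(1)] unfolding C_def by auto
  moreover have "(\<lambda>t. lim (\<lambda>j. v j t)) \<in> borel_measurable M"
    by measurable
  ultimately show thesis
    using that by blast
qed

text \<open>
  Write \<open>h j = |v j - w|\<close>. Where \<open>|g| h j \<le> N |g|\<^sup>p\<close> the integrand is dominated by an integrable function.
  Elsewhere \<open>|g|\<close> is less than a small multiple \<open>c\<close> of \<open>(h j)\<^sup>q\<^sup>-\<^sup>1\<close>, because \<open>(p - 1) (q - 1) = 1\<close>, and the
  integrand is at most \<open>c (h j)\<^sup>q\<close>, whose integral is bounded by a multiple of \<open>c\<close>.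
\<close>

lemma tendsto_integral_of_AE_bounded:
  fixes v :: "nat \<Rightarrow> 'a \<Rightarrow> 'b::{real_normed_vector, second_countable_topology}"
    and g :: "'a \<Rightarrow> 'c::real_normed_vector"
  assumes pq: "p > 1" "q > 1" "1 / p + 1 / q = 1"
    and g: "g \<in> Lp_space M p"
    and v: "\<And>j. v j \<in> Lp_space M q" and w: "w \<in> Lp_space M q"
    and R: "\<And>j. (\<integral>t. norm (v j t) powr q \<partial>M) \<le> R"
    and lim: "AE t in M. (\<lambda>j. v j t) \<longlonglongrightarrow> w t"
  shows "(\<lambda>j. \<integral>t. norm (g t) * norm (v j t - w t) \<partial>M) \<longlonglongrightarrow> 0"
proof (rule LIMSEQ_I)
  fix e :: real assume e: "e > 0"
  define h where "h j t = norm (v j t - w t)" for j t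
  have h0: "h j t \<ge> 0" for j t
    by (simp add: h_def)
  have [measurable]: "v j \<in> borel_measurable M" "w \<in> borel_measurable M" "g \<in> borel_measurable M" for j
    using v w g by (auto simp: Lp_space_def)
  have [measurable]: "h j \<in> borel_measurable M" for j
    unfolding h_def by measurable
  have ig: "integrable M (\<lambda>t. norm (g t) powr p)"
    using g by (simp add: Lp_space_def)
  define R' where "R' = 2 powr (q - 1) * (R + (\<integral>t. norm (w t) powr q \<partial>M))"
  have hq: "(\<lambda>t. v j t - w t) \<in> Lp_space M q" "(\<integral>t. h j t powr q \<partial>M) \<le> R'" for j
  proof -
    show "(\<lambda>t. v j t - w t) \<in> Lp_space M q"
      using pq v w by (intro Lp_space_diff) auto
    have "(\<integral>t. h j t powr q \<partial>M)
        \<le> 2 powr (q - 1) * ((\<integral>t. norm (v j t) powr q \<partial>M) + (\<integral>t. norm (w t) powr q \<partial>M))"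
      unfolding h_def using pq v w by (intro Lp_space_diff) auto
    also have "\<dots> \<le> R'"
      unfolding R'_def using R by (intro mult_left_mono add_right_mono) auto
    finally show "(\<integral>t. h j t powr q \<partial>M) \<le> R'" .
  qed
  have ihq: "integrable M (\<lambda>t. h j t powr q)" for j
    using hq(1)[of j] by (simp add: Lp_space_def h_def)
  have R'0: "R' \<ge> 0"
    using order_trans[OF _ hq(2)[of 0]] by (simp add: integral_nonneg_AE)
  \<comment> \<open>\<open>c\<close> makes the bounded part smaller than \<open>e / 2\<close>; \<open>N\<close> is the truncation level that belongs to it.\<close>
  define c where "c = e / (4 * (R' + 1))"
  have c: "c > 0" "c * R' < e / 2"
  proof -
    show "c > 0"
      using e R'0 by (simp add: c_def)
    moreover have "c * (R' + 1) = e / 4"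
      unfolding c_def times_divide_eq_left using R'0 by (intro mult_divide_mult_cancel_right) simp
    ultimately show "c * R' < e / 2"
      using e by (simp add: algebra_simps)
  qed
  define N where "N = c powr (- (p / q))"
  have N: "N > 0"
    using c by (simp add: N_def)
  have pq': "p / q = p - 1" "q / p = q - 1"
    using pq by (auto simp: field_simps)
  let ?m = "\<lambda>j t. min (norm (g t) * h j t) (N * norm (g t) powr p)"
  have bound: "norm (g t) * h j t \<le> ?m j t + c * h j t powr q" for j t
  proof (cases "norm (g t) * h j t \<le> N * norm (g t) powr p")
    case True
    then show ?thesis
      using c by simp
  next
    case False
    then have gpos: "norm (g t) > 0"
      by auto
    have "norm (g t) powr p = norm (g t) * norm (g t) powr (p - 1)"
      using gpos by (simp add: powr_diff)
    with False gpos have "N * norm (g t) powr (p - 1) < h j t"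
      by (simp add: algebra_simps)
    then have "(N * norm (g t) powr (p - 1)) powr (q / p) \<le> h j t powr (q / p)"
      using pq N by (intro powr_mono2) auto
    moreover have "(N * norm (g t) powr (p - 1)) powr (q / p) = norm (g t) / c"
    proof -
      have "N powr (q / p) = 1 / c"
      proof -
        have "- (p / q) * (q / p) = - 1"
          using pq by simp
        then show ?thesis
          unfolding N_def powr_powr using c by (simp only: powr_minus_divide powr_one)
      qed
      moreover have "(norm (g t) powr (p - 1)) powr (q / p) = norm (g t)"
        using pq gpos unfolding pq'(1)[symmetric] by (simp add: powr_powr)
      ultimately show ?thesis
        using N by (simp add: powr_mult)
    qed
    ultimately have "norm (g t) / c \<le> h j t powr (q - 1)"
      by (simp only: pq'(2))
    then have "norm (g t) \<le> c * h j t powr (q - 1)"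
      using c by (simp add: pos_divide_le_eq mult.commute)
    then have "norm (g t) * h j t \<le> c * h j t powr (q - 1) * h j t"
      using h0 by (rule mult_right_mono)
    also have "\<dots> = c * h j t powr q"
      using h0[of j t] by (cases "h j t = 0") (auto simp: powr_diff)
    finally show ?thesis
      using N h0[of j t] by (simp add: add_increasing)
  qed
  have m_le: "norm (?m j t) \<le> N * norm (g t) powr p" for j t
  proof -
    have "?m j t \<ge> 0"
      using N h0[of j t] by simp
    then show ?thesis
      by simp
  qed
  have "(\<lambda>j. \<integral>t. ?m j t \<partial>M) \<longlonglongrightarrow> (\<integral>t. 0 \<partial>M)"
  proof (rule integral_dominated_convergence)
    show "integrable M (\<lambda>t. N * norm (g t) powr p)"
      using ig by simp
    show "AE t in M. norm (?m j t) \<le> N * norm (g t) powr p" for j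
      by (intro AE_I2 m_le)
    show "AE t in M. (\<lambda>j. ?m j t) \<longlonglongrightarrow> 0"
      using lim
    proof eventually_elim
      fix t assume "(\<lambda>j. v j t) \<longlonglongrightarrow> w t"
      then have "(\<lambda>j. h j t) \<longlonglongrightarrow> 0"
        unfolding h_def by (simp add: LIM_zero tendsto_norm_zero)
      then have "(\<lambda>j. ?m j t) \<longlonglongrightarrow> min (norm (g t) * 0) (N * norm (g t) powr p)"
        by (intro tendsto_intros)
      then show "(\<lambda>j. ?m j t) \<longlonglongrightarrow> 0"
        using N by (simp add: min_def)
    qed
  qed measurable
  then obtain j0 where j0: "\<And>j. j \<ge> j0 \<Longrightarrow> norm ((\<integral>t. ?m j t \<partial>M) - 0) < e / 2"
    using e LIMSEQ_D[of "\<lambda>j. \<integral>t. ?m j t \<partial>M" 0 "e / 2"] by auto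
  have int_m: "integrable M (?m j)" for j
  proof (rule Bochner_Integration.integrable_bound)
    show "integrable M (\<lambda>t. N * norm (g t) powr p)"
      using ig by simp
    show "AE t in M. norm (?m j t) \<le> norm (N * norm (g t) powr p)"
      using order_trans[OF m_le abs_ge_self] by (intro AE_I2) simp
  qed measurable
  show "\<exists>j0. \<forall>j\<ge>j0. norm ((\<integral>t. norm (g t) * norm (v j t - w t) \<partial>M) - 0) < e"
  proof (intro exI allI impI)
    fix j assume j: "j \<ge> j0"
    have int: "integrable M (\<lambda>t. norm (g t) * h j t)"
      unfolding h_def using pq g hq(1) by (rule Holder_inequality(1))
    have "(\<integral>t. norm (g t) * h j t \<partial>M) \<le> (\<integral>t. ?m j t + c * h j t powr q \<partial>M)"
      using int int_m ihq bound by (intro integral_mono) auto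
    also have "\<dots> = (\<integral>t. ?m j t \<partial>M) + c * (\<integral>t. h j t powr q \<partial>M)"
      using int_m ihq by simp
    also have "\<dots> < e / 2 + e / 2"
    proof (rule add_strict_mono)
      show "(\<integral>t. ?m j t \<partial>M) < e / 2"
        using j0[OF j] by simp
      show "c * (\<integral>t. h j t powr q \<partial>M) < e / 2"
        using c mult_left_mono[OF hq(2)[of j], of c] by linarith
    qed
    finally have "(\<integral>t. norm (g t) * h j t \<partial>M) < e"
      by simp
    moreover have "(\<integral>t. norm (g t) * h j t \<partial>M) \<ge> 0"
      using h0 by (intro integral_nonneg_AE) auto
    ultimately show "norm ((\<integral>t. norm (g t) * norm (v j t - w t) \<partial>M) - 0) < e"
      by (simp add: h_def)
  qed
qed

section \<open>Lebesgue measure on products\<close>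

lemma AE_lebesgue_on_iff:
  "S \<in> sets lebesgue \<Longrightarrow> (AE x in lebesgue_on S. P x) \<longleftrightarrow> (AE x in lebesgue. x \<in> S \<longrightarrow> P x)"
  by (rule AE_restrict_space_iff) simp

lemma borel_measurable_lebesgue_on_cong_AE:
  fixes f g :: "'a::euclidean_space \<Rightarrow> 'b::euclidean_space"
  assumes S: "S \<in> sets lebesgue" and f: "f \<in> borel_measurable (lebesgue_on S)"
    and ae: "AE x in lebesgue_on S. f x = g x"
  shows "g \<in> borel_measurable (lebesgue_on S)"
proof -
  have "(\<lambda>x. indicator S x *\<^sub>R f x) \<in> borel_measurable lebesgue"
    using f S by (subst (asm) borel_measurable_restrict_space_iff) auto
  moreover have "AE x in lebesgue. indicator S x *\<^sub>R f x = indicator S x *\<^sub>R g x"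
    using ae unfolding AE_lebesgue_on_iff[OF S] by eventually_elim (auto simp: indicator_def)
  ultimately have "(\<lambda>x. indicator S x *\<^sub>R g x) \<in> borel_measurable lebesgue"
    by (rule borel_measurable_AE)
  then show ?thesis
    using S by (subst borel_measurable_restrict_space_iff) auto
qed

text \<open>
  Along a simple function the superposition is a countable case distinction between measurable functions; along a
  general \<open>y\<close> it is an almost everywhere limit of such, and completeness of Lebesgue measure absorbs the null set.
\<close>

lemma Caratheodory_superposition_measurable:
  fixes f :: "'a::euclidean_space \<Rightarrow> 'c::{metric_space, second_countable_topology} \<Rightarrow> 'b::euclidean_space"
  assumes S: "S \<in> sets lebesgue"
    and meas: "\<And>c. (\<lambda>z. f z c) \<in> borel_measurable (lebesgue_on S)"
    and cont: "AE z in lebesgue_on S. continuous_on UNIV (f z)"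
    and y: "y \<in> borel_measurable (lebesgue_on S)"
  shows "(\<lambda>z. f z (y z)) \<in> borel_measurable (lebesgue_on S)"
proof -
  obtain F where F: "\<And>i. simple_function (lebesgue_on S) (F i)"
    and lim: "\<And>z. z \<in> S \<Longrightarrow> (\<lambda>i. F i z) \<longlonglongrightarrow> y z"
    using borel_measurable_implies_sequence_metric[OF y, of undefined] by auto
  have m: "(\<lambda>z. f z (F i z)) \<in> borel_measurable (lebesgue_on S)" for i
  proof (rule measurable_compose_countable'[where f = "\<lambda>c z. f z c"])
    show "countable (F i ` space (lebesgue_on S))"
      using simple_functionD(1)[OF F[of i]] by (rule countable_finite)
    show "F i \<in> measurable (lebesgue_on S) (count_space (F i ` space (lebesgue_on S)))"
    proof (rule measurableI)
      fix A assume A: "A \<in> sets (count_space (F i ` space (lebesgue_on S)))"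
      show "F i -` A \<inter> space (lebesgue_on S) \<in> sets (lebesgue_on S)"
        using simple_functionD(2)[OF F] .
    qed auto
  qed (use meas in auto)
  have "AE z in lebesgue_on S. z \<in> S"
    by (rule AE_I2) simp
  then have "AE z in lebesgue_on S. lim (\<lambda>i. f z (F i z)) = f z (y z)"
    using cont
  proof eventually_elim
    fix z assume z: "z \<in> S" and c: "continuous_on UNIV (f z)"
    show "lim (\<lambda>i. f z (F i z)) = f z (y z)"
      using continuous_on_tendsto_compose[OF c lim[OF z]] by (intro limI) auto
  qed
  then show ?thesis
    by (rule borel_measurable_lebesgue_on_cong_AE[OF S borel_measurable_lim_metric[OF m]])
qed

lemma null_sets_vimage_fst:
  assumes "N \<in> null_sets (lborel :: 'a::euclidean_space measure)"
  shows "fst -` N \<in> null_sets (lebesgue :: ('a \<times> 'b::euclidean_space) measure)"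
proof -
  have "fst -` N = N \<times> (UNIV :: 'b set)" by auto
  moreover have "N \<times> (UNIV :: 'b set) \<in> null_sets (lborel \<Otimes>\<^sub>M lborel)"
    using assms by (intro null_setsI) (auto simp: lborel.emeasure_pair_measure_Times null_sets_def)
  ultimately show ?thesis
    by (simp add: lborel_prod null_sets_completionI)
qed

lemma null_sets_vimage_snd:
  assumes "N \<in> null_sets (lborel :: 'b::euclidean_space measure)"
  shows "snd -` N \<in> null_sets (lebesgue :: ('a::euclidean_space \<times> 'b) measure)"
proof -
  have "snd -` N = (UNIV :: 'a set) \<times> N" by auto
  moreover have "(UNIV :: 'a set) \<times> N \<in> null_sets (lborel \<Otimes>\<^sub>M lborel)"
    using assms by (intro null_setsI) (auto simp: lborel.emeasure_pair_measure_Times null_sets_def)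
  ultimately show ?thesis
    by (simp add: lborel_prod null_sets_completionI)
qed

text \<open>
  Lebesgue measure on the product space is the completion of the product of the Borel measures, not the product of the
  completions. Preimages of null sets under the projections are null sets, so the projections are still measurable.
\<close>

lemma measurable_lebesgue_fst:
  "(fst :: 'a::euclidean_space \<times> 'b::euclidean_space \<Rightarrow> 'a) \<in> measurable lebesgue lebesgue"
  and measurable_lebesgue_snd:
  "(snd :: 'a::euclidean_space \<times> 'b::euclidean_space \<Rightarrow> 'b) \<in> measurable lebesgue lebesgue"
proof -
  have f: "(fst :: 'a \<times> 'b \<Rightarrow> 'a) \<in> measurable lebesgue lborel"
    and s: "(snd :: 'a \<times> 'b \<Rightarrow> 'b) \<in> measurable lebesgue lborel"
    by (auto intro!: measurable_completion simp: borel_prod[symmetric])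
  show "(fst :: 'a \<times> 'b \<Rightarrow> 'a) \<in> measurable lebesgue lebesgue"
  proof (intro completion.measurable_completion2[OF f] subsetI null_setsI)
    fix N :: "'a set" assume N: "N \<in> null_sets lborel"
    show "emeasure (distr lebesgue lborel (fst :: 'a \<times> 'b \<Rightarrow> 'a)) N = 0"
      using null_sets_vimage_fst[OF N, where 'b = 'b] unfolding emeasure_distr[OF f null_setsD2[OF N]] by (simp only: null_setsD1 space_completion space_lborel space_borel Int_UNIV_right)
  qed (auto dest: null_setsD2)
  show "(snd :: 'a \<times> 'b \<Rightarrow> 'b) \<in> measurable lebesgue lebesgue"
  proof (intro completion.measurable_completion2[OF s] subsetI null_setsI)
    fix N :: "'b set" assume N: "N \<in> null_sets lborel"
    show "emeasure (distr lebesgue lborel (snd :: 'a \<times> 'b \<Rightarrow> 'b)) N = 0"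
      using null_sets_vimage_snd[OF N, where 'a = 'a] unfolding emeasure_distr[OF s null_setsD2[OF N]] by (simp only: null_setsD1 space_completion space_lborel space_borel Int_UNIV_right)
  qed (auto dest: null_setsD2)
qed

lemma sets_lebesgue_Times:
  assumes "S \<in> sets lebesgue" "T \<in> sets lebesgue"
  shows "S \<times> T \<in> sets lebesgue"
proof -
  have "fst -` S \<inter> snd -` T \<in> sets lebesgue"
    using measurable_sets[OF measurable_lebesgue_fst assms(1)]
      measurable_sets[OF measurable_lebesgue_snd assms(2)] by auto
  moreover have "fst -` S \<inter> snd -` T = S \<times> T"
    by auto
  ultimately show ?thesis
    by simp
qed

lemma measurable_lebesgue_on_snd:
  fixes h :: "'b::euclidean_space \<Rightarrow> 'c::real_normed_vector"
  assumes "T \<in> sets lebesgue" "h \<in> borel_measurable (lebesgue_on T)"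
  shows "(\<lambda>z. h (snd z)) \<in> borel_measurable (lebesgue_on (S \<times> T))"
proof (rule measurable_compose[OF _ assms(2)])
  show "snd \<in> measurable (lebesgue_on (S \<times> T)) (lebesgue_on T)"
    using measurable_lebesgue_snd by (intro measurable_restrict_space3) auto
qed

lemma AE_lebesgue_on_snd:
  fixes S :: "'a::euclidean_space set" and T :: "'b::euclidean_space set"
  assumes S: "S \<in> sets lebesgue" and T: "T \<in> sets lebesgue"
    and ae: "AE y in lebesgue_on T. Q y"
  shows "AE z in lebesgue_on (S \<times> T). Q (snd z)"
proof -
  have "AE y in lborel. y \<in> T \<longrightarrow> Q y"
    using ae unfolding AE_lebesgue_on_iff[OF T] AE_completion_iff .
  then have "\<exists>N\<in>null_sets lborel. \<forall>y. y \<notin> N \<longrightarrow> y \<in> T \<longrightarrow> Q y"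
    by (rule AE_E3) auto
  then obtain N where N: "\<forall>y. y \<notin> N \<longrightarrow> y \<in> T \<longrightarrow> Q y" "N \<in> null_sets lborel"
    by blast
  have "snd -` N \<in> null_sets (lebesgue :: ('a \<times> 'b) measure)"
    using N(2) by (rule null_sets_vimage_snd)
  then have "AE z in lebesgue. z \<in> S \<times> T \<longrightarrow> Q (snd z)"
    by (rule AE_I') (use N in auto)
  then show ?thesis
    unfolding AE_lebesgue_on_iff[OF sets_lebesgue_Times[OF S T]] .
qed

lemma AE_lebesgue_on_Times:
  fixes S :: "'a::euclidean_space set" and T :: "'b::euclidean_space set"
  assumes S: "S \<in> sets lebesgue" and T: "T \<in> sets lebesgue"
    and ae: "AE z in lebesgue_on (S \<times> T). Q z"
  shows "AE x in lebesgue_on S. AE y in lebesgue_on T. Q (x, y)"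
proof -
  have "AE z in lebesgue. z \<in> S \<times> T \<longrightarrow> Q z"
    using ae sets_lebesgue_Times[OF S T] by (simp add: AE_lebesgue_on_iff)
  then have "AE z in lborel \<Otimes>\<^sub>M lborel. z \<in> S \<times> T \<longrightarrow> Q z"
    unfolding AE_completion_iff lborel_prod .
  then have "AE x in lborel. AE y in lborel. (x, y) \<in> S \<times> T \<longrightarrow> Q (x, y)"
    by (rule lborel_pair.AE_pair)
  then have "AE x in lebesgue. AE y in lebesgue. (x, y) \<in> S \<times> T \<longrightarrow> Q (x, y)"
    by (simp add: AE_completion_iff)
  then show ?thesis
    unfolding AE_lebesgue_on_iff[OF S] AE_lebesgue_on_iff[OF T] by eventually_elim auto
qed

lemma lebesgue_measurable_AE_eq_borel:
  fixes F :: "'a::euclidean_space \<Rightarrow> 'c::euclidean_space"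
  assumes "F \<in> borel_measurable lebesgue"
  obtains G where "G \<in> borel_measurable lborel" "AE z in lborel. F z = G z"
proof -
  have "\<exists>g\<in>borel_measurable lborel. AE z in lborel. F z \<bullet> b = g z" for b
    using assms by (intro completion_ex_borel_measurable_real) (auto intro: borel_measurable_inner)
  then obtain g where g: "\<And>b. g b \<in> borel_measurable lborel" "\<And>b. AE z in lborel. F z \<bullet> b = g b z"
    by metis
  show thesis
  proof
    show "(\<lambda>z. \<Sum>b\<in>Basis. g b z *\<^sub>R b) \<in> borel_measurable lborel"
      using g(1) by (intro borel_measurable_sum borel_measurable_scaleR) auto
    have "AE z in lborel. \<forall>b\<in>Basis. F z \<bullet> b = g b z"
      using g(2) by (intro AE_finite_allI) auto
    then show "AE z in lborel. F z = (\<Sum>b\<in>Basis. g b z *\<^sub>R b)"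
    proof eventually_elim
      fix z assume z: "\<forall>b\<in>Basis. F z \<bullet> b = g b z"
      have "F z = (\<Sum>b\<in>Basis. (F z \<bullet> b) *\<^sub>R b)"
        by (simp add: euclidean_representation)
      also have "\<dots> = (\<Sum>b\<in>Basis. g b z *\<^sub>R b)"
        using z by (intro sum.cong) auto
      finally show "F z = (\<Sum>b\<in>Basis. g b z *\<^sub>R b)" .
    qed
  qed
qed

text \<open>
  A Lebesgue measurable function is almost everywhere equal to a Borel function on the product, to which the
  theory of product measures applies; sections and integrals are compared through this representative.
\<close>

lemma lebesgue_on_Times_borel_representative:
  fixes F :: "'a::euclidean_space \<times> 'b::euclidean_space \<Rightarrow> 'c::euclidean_space"
  assumes S: "S \<in> sets lebesgue" and T: "T \<in> sets lebesgue"
    and F: "F \<in> borel_measurable (lebesgue_on (S \<times> T))"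
  obtains G where "G \<in> borel_measurable (lborel \<Otimes>\<^sub>M lborel)"
    "AE z in lborel \<Otimes>\<^sub>M lborel. indicator (S \<times> T) z *\<^sub>R F z = G z"
    "AE x in lebesgue. x \<in> S \<longrightarrow> (AE y in lebesgue. indicator T y *\<^sub>R F (x, y) = G (x, y))"
proof -
  have "(\<lambda>z. indicator (S \<times> T) z *\<^sub>R F z) \<in> borel_measurable lebesgue"
    using F sets_lebesgue_Times[OF S T] by (subst (asm) borel_measurable_restrict_space_iff) auto
  then obtain G where G: "G \<in> borel_measurable lborel"
    "AE z in lborel. indicator (S \<times> T) z *\<^sub>R F z = G z"
    by (rule lebesgue_measurable_AE_eq_borel)
  have ae: "AE z in lborel \<Otimes>\<^sub>M lborel. indicator (S \<times> T) z *\<^sub>R F z = G z"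
    using G(2) unfolding lborel_prod .
  then have "AE x in lborel. AE y in lborel. indicator (S \<times> T) (x, y) *\<^sub>R F (x, y) = G (x, y)"
    by (rule lborel_pair.AE_pair)
  then have "AE x in lebesgue. AE y in lebesgue. indicator (S \<times> T) (x, y) *\<^sub>R F (x, y) = G (x, y)"
    by (simp add: AE_completion_iff)
  then have "AE x in lebesgue. x \<in> S \<longrightarrow> (AE y in lebesgue. indicator T y *\<^sub>R F (x, y) = G (x, y))"
    by eventually_elim (auto simp: indicator_times)
  with ae G(1) show thesis
    using that by (simp add: lborel_prod)
qed

lemma AE_measurable_section_lebesgue_on:
  fixes F :: "'a::euclidean_space \<times> 'b::euclidean_space \<Rightarrow> 'c::euclidean_space"
  assumes S: "S \<in> sets lebesgue" and T: "T \<in> sets lebesgue"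
    and F: "F \<in> borel_measurable (lebesgue_on (S \<times> T))"
  shows "AE x in lebesgue_on S. (\<lambda>y. F (x, y)) \<in> borel_measurable (lebesgue_on T)"
proof -
  obtain G where G: "G \<in> borel_measurable (lborel \<Otimes>\<^sub>M lborel)"
    and "AE z in lborel \<Otimes>\<^sub>M lborel. indicator (S \<times> T) z *\<^sub>R F z = G z"
    and ae: "AE x in lebesgue. x \<in> S \<longrightarrow> (AE y in lebesgue. indicator T y *\<^sub>R F (x, y) = G (x, y))"
    by (rule lebesgue_on_Times_borel_representative[OF S T F])
  show ?thesis
    unfolding AE_lebesgue_on_iff[OF S] using ae
  proof (eventually_elim, intro impI)
    fix x assume "x \<in> S \<longrightarrow> (AE y in lebesgue. indicator T y *\<^sub>R F (x, y) = G (x, y))" "x \<in> S"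
    then have eq: "AE y in lebesgue. G (x, y) = indicator T y *\<^sub>R F (x, y)"
      by (auto elim: eventually_mono)
    have "(\<lambda>y. G (x, y)) \<in> borel_measurable lborel"
      using G by (rule measurable_Pair2) simp
    then have "(\<lambda>y. G (x, y)) \<in> borel_measurable lebesgue"
      by (rule measurable_completion)
    then have "(\<lambda>y. indicator T y *\<^sub>R F (x, y)) \<in> borel_measurable lebesgue"
      using eq by (rule borel_measurable_AE)
    then show "(\<lambda>y. F (x, y)) \<in> borel_measurable (lebesgue_on T)"
      using T by (subst borel_measurable_restrict_space_iff) auto
  qed
qed

lemma integral_section_borel_representative:
  fixes G :: "'a::euclidean_space \<times> 'b::euclidean_space \<Rightarrow> 'c::euclidean_space"
  assumes T: "T \<in> sets lebesgue" and G: "G \<in> borel_measurable (lborel \<Otimes>\<^sub>M lborel)"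
    and ae: "AE y in lebesgue. indicator T y *\<^sub>R F (x, y) = G (x, y)"
  shows "(\<integral>y. F (x, y) \<partial>lebesgue_on T) = (\<integral>y. G (x, y) \<partial>lborel)"
    "integrable (lebesgue_on T) (\<lambda>y. F (x, y)) \<longleftrightarrow> integrable lborel (\<lambda>y. G (x, y))"
proof -
  have m: "(\<lambda>y. G (x, y)) \<in> borel_measurable lborel"
    using G by (rule measurable_Pair2) simp
  then have m': "(\<lambda>y. G (x, y)) \<in> borel_measurable lebesgue"
    by (rule measurable_completion)
  then have mF: "(\<lambda>y. indicator T y *\<^sub>R F (x, y)) \<in> borel_measurable lebesgue"
    using ae by (intro borel_measurable_AE[OF m']) (auto elim: eventually_mono)
  have "(\<integral>y. F (x, y) \<partial>lebesgue_on T) = (\<integral>y. indicator T y *\<^sub>R F (x, y) \<partial>lebesgue)"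
    using T by (intro integral_restrict_space) simp
  also have "\<dots> = (\<integral>y. G (x, y) \<partial>lebesgue)"
    using mF m' ae by (rule integral_cong_AE)
  also have "\<dots> = (\<integral>y. G (x, y) \<partial>lborel)"
    using m by (rule integral_completion)
  finally show "(\<integral>y. F (x, y) \<partial>lebesgue_on T) = (\<integral>y. G (x, y) \<partial>lborel)" .
  have "integrable (lebesgue_on T) (\<lambda>y. F (x, y)) \<longleftrightarrow> integrable lebesgue (\<lambda>y. indicator T y *\<^sub>R F (x, y))"
    using T by (intro integrable_restrict_space) simp
  also have "\<dots> \<longleftrightarrow> integrable lebesgue (\<lambda>y. G (x, y))"
    using mF m' ae by (rule integrable_cong_AE)
  also have "\<dots> \<longleftrightarrow> integrable lborel (\<lambda>y. G (x, y))"
    using m by (rule integrable_completion)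
  finally show "integrable (lebesgue_on T) (\<lambda>y. F (x, y)) \<longleftrightarrow> integrable lborel (\<lambda>y. G (x, y))" .
qed

lemma borel_measurable_integral_section_lebesgue_on:
  fixes F :: "'a::euclidean_space \<times> 'b::euclidean_space \<Rightarrow> 'c::euclidean_space"
  assumes S: "S \<in> sets lebesgue" and T: "T \<in> sets lebesgue"
    and F: "F \<in> borel_measurable (lebesgue_on (S \<times> T))"
  shows "(\<lambda>x. \<integral>y. F (x, y) \<partial>lebesgue_on T) \<in> borel_measurable (lebesgue_on S)"
proof -
  obtain G where G: "G \<in> borel_measurable (lborel \<Otimes>\<^sub>M lborel)"
    and "AE z in lborel \<Otimes>\<^sub>M lborel. indicator (S \<times> T) z *\<^sub>R F z = G z"
    and ae: "AE x in lebesgue. x \<in> S \<longrightarrow> (AE y in lebesgue. indicator T y *\<^sub>R F (x, y) = G (x, y))"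
    by (rule lebesgue_on_Times_borel_representative[OF S T F])
  have "(\<lambda>x. \<integral>y. G (x, y) \<partial>lborel) \<in> borel_measurable lborel"
    using G by measurable
  then have "(\<lambda>x. \<integral>y. G (x, y) \<partial>lborel) \<in> borel_measurable (lebesgue_on S)"
    by (intro measurable_restrict_space1 measurable_completion)
  moreover have "AE x in lebesgue_on S. (\<integral>y. G (x, y) \<partial>lborel) = (\<integral>y. F (x, y) \<partial>lebesgue_on T)"
    unfolding AE_lebesgue_on_iff[OF S] using ae
    by eventually_elim (auto simp: integral_section_borel_representative(1)[OF T G])
  ultimately show ?thesis
    by (rule borel_measurable_lebesgue_on_cong_AE[OF S])
qed

text \<open>
  Fubini's theorem for the completed measure, transferred from a Borel representative.
\<close>

lemma Fubini_lebesgue_on_Times: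
  fixes F :: "'a::euclidean_space \<times> 'b::euclidean_space \<Rightarrow> 'c::euclidean_space"
  assumes S: "S \<in> sets lebesgue" and T: "T \<in> sets lebesgue"
    and F: "integrable (lebesgue_on (S \<times> T)) F"
  shows "AE x in lebesgue_on S. integrable (lebesgue_on T) (\<lambda>y. F (x, y))"
    "integrable (lebesgue_on S) (\<lambda>x. \<integral>y. F (x, y) \<partial>lebesgue_on T)"
    "(\<integral>x. (\<integral>y. F (x, y) \<partial>lebesgue_on T) \<partial>lebesgue_on S) = integral\<^sup>L (lebesgue_on (S \<times> T)) F"
proof -
  note ST = sets_lebesgue_Times[OF S T]
  have mF: "F \<in> borel_measurable (lebesgue_on (S \<times> T))"
    using F by (rule borel_measurable_integrable)
  obtain G where G: "G \<in> borel_measurable (lborel \<Otimes>\<^sub>M lborel)"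
    and eqG: "AE z in lborel \<Otimes>\<^sub>M lborel. indicator (S \<times> T) z *\<^sub>R F z = G z"
    and ae: "AE x in lebesgue. x \<in> S \<longrightarrow> (AE y in lebesgue. indicator T y *\<^sub>R F (x, y) = G (x, y))"
    by (rule lebesgue_on_Times_borel_representative[OF S T mF])
  have G': "G \<in> borel_measurable lborel" and eqG': "AE z in lebesgue. indicator (S \<times> T) z *\<^sub>R F z = G z"
    using G eqG unfolding lborel_prod AE_completion_iff by blast+
  have mG: "G \<in> borel_measurable lebesgue"
    using G' by (rule measurable_completion)
  have mF0: "(\<lambda>z. indicator (S \<times> T) z *\<^sub>R F z) \<in> borel_measurable lebesgue"
    using mF ST by (subst (asm) borel_measurable_restrict_space_iff) auto
  have "integrable lebesgue (\<lambda>z. indicator (S \<times> T) z *\<^sub>R F z)"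
    using F ST by (subst (asm) integrable_restrict_space) auto
  then have "integrable lebesgue G"
    using integrable_cong_AE[OF mF0 mG eqG'] by simp
  then have intG: "integrable (lborel \<Otimes>\<^sub>M lborel) G"
    using integrable_completion[OF G'] by (simp add: lborel_prod)
  have ae': "AE x in lebesgue_on S. AE y in lebesgue. indicator T y *\<^sub>R F (x, y) = G (x, y)"
    using ae unfolding AE_lebesgue_on_iff[OF S] .
  have "AE x in lebesgue. integrable lborel (\<lambda>y. G (x, y))"
    using lborel_pair.AE_integrable_fst'[OF intG] by (simp add: AE_completion_iff)
  then have "AE x in lebesgue_on S. integrable lborel (\<lambda>y. G (x, y))"
    unfolding AE_lebesgue_on_iff[OF S] by eventually_elim simp
  then show "AE x in lebesgue_on S. integrable (lebesgue_on T) (\<lambda>y. F (x, y))"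
    using ae' by eventually_elim (simp add: integral_section_borel_representative(2)[OF T G])
  have mFx: "(\<lambda>x. \<integral>y. F (x, y) \<partial>lebesgue_on T) \<in> borel_measurable (lebesgue_on S)"
    using borel_measurable_integral_section_lebesgue_on[OF S T mF] .
  have mGx0: "(\<lambda>x. \<integral>y. G (x, y) \<partial>lborel) \<in> borel_measurable lborel"
    using G by measurable
  then have mGx1: "(\<lambda>x. \<integral>y. G (x, y) \<partial>lborel) \<in> borel_measurable lebesgue"
    by (rule measurable_completion)
  have "AE z in lborel \<Otimes>\<^sub>M lborel. fst z \<notin> S \<longrightarrow> G z = 0"
    using eqG by eventually_elim (auto simp: indicator_def)
  then have "AE x in lborel. AE y in lborel. fst (x, y) \<notin> S \<longrightarrow> G (x, y) = 0"
    by (rule lborel_pair.AE_pair)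
  then have "AE x in lborel. x \<notin> S \<longrightarrow> (\<integral>y. G (x, y) \<partial>lborel) = 0"
    by eventually_elim (auto intro: integral_eq_zero_AE)
  then have zero: "AE x in lebesgue. x \<notin> S \<longrightarrow> (\<integral>y. G (x, y) \<partial>lborel) = 0"
    by (simp add: AE_completion_iff)
  have eqx: "AE x in lebesgue. indicator S x *\<^sub>R (\<integral>y. F (x, y) \<partial>lebesgue_on T) = (\<integral>y. G (x, y) \<partial>lborel)"
    using zero ae
    by eventually_elim (auto simp: indicator_def integral_section_borel_representative(1)[OF T G])
  have mFx0: "(\<lambda>x. indicator S x *\<^sub>R (\<integral>y. F (x, y) \<partial>lebesgue_on T)) \<in> borel_measurable lebesgue"
    using mFx S by (subst (asm) borel_measurable_restrict_space_iff) auto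
  have iG: "integrable lebesgue (\<lambda>x. \<integral>y. G (x, y) \<partial>lborel)"
    using lborel_pair.integrable_fst'[OF intG] integrable_completion[OF mGx0] by simp
  show "integrable (lebesgue_on S) (\<lambda>x. \<integral>y. F (x, y) \<partial>lebesgue_on T)"
    using S iG integrable_cong_AE[OF mFx0 mGx1 eqx] by (subst integrable_restrict_space) auto
  have "(\<integral>x. (\<integral>y. F (x, y) \<partial>lebesgue_on T) \<partial>lebesgue_on S)
      = (\<integral>x. indicator S x *\<^sub>R (\<integral>y. F (x, y) \<partial>lebesgue_on T) \<partial>lebesgue)"
    using S by (intro integral_restrict_space) simp
  also have "\<dots> = (\<integral>x. (\<integral>y. G (x, y) \<partial>lborel) \<partial>lebesgue)"
    using mFx0 mGx1 eqx by (rule integral_cong_AE)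
  also have "\<dots> = (\<integral>x. (\<integral>y. G (x, y) \<partial>lborel) \<partial>lborel)"
    using mGx0 by (rule integral_completion)
  also have "\<dots> = integral\<^sup>L (lborel \<Otimes>\<^sub>M lborel) G"
    using intG by (rule lborel_pair.integral_fst')
  also have "\<dots> = integral\<^sup>L lebesgue G"
    using integral_completion[OF G'] by (simp add: lborel_prod)
  also have "\<dots> = (\<integral>z. indicator (S \<times> T) z *\<^sub>R F z \<partial>lebesgue)"
    using mG mF0 eqG' by (intro integral_cong_AE) (auto elim: eventually_mono)
  also have "\<dots> = integral\<^sup>L (lebesgue_on (S \<times> T)) F"
    using ST by (intro integral_restrict_space[symmetric]) simp
  finally show "(\<integral>x. (\<integral>y. F (x, y) \<partial>lebesgue_on T) \<partial>lebesgue_on S)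
      = integral\<^sup>L (lebesgue_on (S \<times> T)) F" .
qed

text \<open>
  The sets are the traces on \<open>\<Omega>\<close> of balls around a point all of whose neighbourhoods meet \<open>\<Omega>\<close> in positive
  measure; such a point exists because negligibility is a local property.
\<close>

lemma shrinking_nonnegligible_subsets:
  fixes \<Omega> :: "'a::euclidean_space set"
  assumes \<Omega>: "\<Omega> \<in> lmeasurable" and pos: "measure lebesgue \<Omega> > 0"
  obtains E :: "nat \<Rightarrow> 'a set" where "\<And>j. E j \<in> lmeasurable" "\<And>j. E j \<subseteq> \<Omega>"
    "\<And>j. measure lebesgue (E j) > 0"
    "AE s in lebesgue_on \<Omega>. (\<lambda>j. indicator (E j) s :: real) \<longlonglongrightarrow> 0"
proof -
  have "\<not> negligible \<Omega>"
    using pos by (auto simp: negligible_iff_measure)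
  then obtain a where "a \<in> \<Omega>"
    and a: "\<And>U. openin (top_of_set \<Omega>) U \<Longrightarrow> a \<in> U \<Longrightarrow> \<not> negligible U"
    using locally_negligible_alt by metis
  define E where "E j = \<Omega> \<inter> ball a (1 / real (Suc j))" for j
  have E: "E j \<in> lmeasurable" for j
    unfolding E_def using \<Omega> by (intro fmeasurable_Int_fmeasurable) auto
  have "\<not> negligible (E j)" for j
    by (rule a) (use \<open>a \<in> \<Omega>\<close> in \<open>auto simp: E_def openin_open\<close>)
  then have Epos: "measure lebesgue (E j) > 0" for j
    using E[of j] by (simp add: negligible_iff_measure less_le)
  have sets: "\<Omega> \<in> sets lebesgue"
    using \<Omega> by (rule fmeasurableD)
  have "AE s in lebesgue. s \<noteq> a"
    using negligible_sing[of a] by (intro AE_I'[of "{a}"]) (auto simp: negligible_iff_null_sets)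
  then have "AE s in lebesgue_on \<Omega>. (\<lambda>j. indicator (E j) s :: real) \<longlonglongrightarrow> 0"
    unfolding AE_lebesgue_on_iff[OF sets]
  proof (eventually_elim, intro impI)
    fix s assume "s \<noteq> a"
    then have "dist a s > 0" by simp
    have "(\<lambda>j. 1 / real (Suc j)) \<longlonglongrightarrow> 0"
      using LIMSEQ_inverse_real_of_nat by (simp add: inverse_eq_divide)
    then have "eventually (\<lambda>j. 1 / real (Suc j) < dist a s) sequentially"
      using \<open>dist a s > 0\<close> by (rule order_tendstoD)
    then have "eventually (\<lambda>j. indicator (E j) s = (0::real)) sequentially"
      by eventually_elim (simp add: E_def)
    then show "(\<lambda>j. indicator (E j) s :: real) \<longlonglongrightarrow> 0"
      by (rule tendsto_eventually)
  qed
  with E Epos show thesis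
    using that[of E] by (auto simp: E_def)
qed

section \<open>The integral operator of the Urysohn equation\<close>

lemma continuous_on_of_lipschitz_bound:
  fixes h :: "'a::real_normed_vector \<Rightarrow> 'b::real_normed_vector"
  assumes "\<forall>x1 x2. norm (h x1 - h x2) \<le> c * norm (x1 - x2)"
  shows "continuous_on UNIV h"
proof (rule lipschitz_on_continuous_on)
  show "\<bar>c\<bar>-lipschitz_on UNIV h"
  proof (rule lipschitz_onI)
    fix x y :: 'a
    have "c * norm (x - y) \<le> \<bar>c\<bar> * norm (x - y)"
      by (intro mult_right_mono) auto
    then show "dist (h x) (h y) \<le> \<bar>c\<bar> * dist x y"
      using assms[rule_format, of x y] by (simp add: dist_norm)
  qed simp
qed

lemma norm_matrix_vector_mult_le:
  fixes A :: "real ^ 'm ^ 'n" and w :: "real ^ 'm"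
  shows "norm (A *v w) \<le> norm A * norm w"
proof -
  have "norm (A *v w) = L2_set (\<lambda>i. norm (A $ i \<bullet> w)) UNIV"
    unfolding norm_vec_def[of "A *v w"] by (simp add: matrix_vector_mul_component)
  also have "\<dots> \<le> L2_set (\<lambda>i. norm (A $ i) * norm w) UNIV"
    by (intro L2_set_mono) (auto simp: Cauchy_Schwarz_ineq2)
  also have "\<dots> = norm A * norm w"
    unfolding norm_vec_def[of A] by (rule L2_set_left_distrib[symmetric]) simp
  finally show ?thesis .
qed

lemma bounded_bilinear_matrix_vector_mult:
  "bounded_bilinear ((*v) :: real ^ 'm ^ 'n \<Rightarrow> real ^ 'm \<Rightarrow> real ^ 'n)"
proof (rule bounded_bilinear.intro)
  show "\<exists>K. \<forall>(A :: real ^ 'm ^ 'n) w. norm (A *v w) \<le> norm A * norm w * K"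
    by (auto intro!: exI[of _ 1] norm_matrix_vector_mult_le)
qed (auto simp: matrix_vector_mult_add_rdistrib matrix_vector_right_distrib
    scaleR_matrix_vector_assoc matrix_vector_mult_scaleR)

lemma borel_measurable_matrix_vector_mult:
  fixes A :: "'a \<Rightarrow> real ^ 'm ^ 'n" and w :: "'a \<Rightarrow> real ^ 'm"
  assumes "A \<in> borel_measurable M" "w \<in> borel_measurable M"
  shows "(\<lambda>t. A t *v w t) \<in> borel_measurable M"
  using assms
  by (rule borel_measurable_continuous_Pair)
    (intro bounded_bilinear.continuous_on[OF bounded_bilinear_matrix_vector_mult] continuous_intros)

text \<open>
  The essential bounds of \<open>\<gamma>0\<close> and \<open>\<gamma>2\<close> are already replaced by the Lipschitz constants \<open>\<kappa>0\<close> and \<open>\<kappa>2\<close>.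
\<close>

locale urysohn_system =
  fixes \<Omega> :: "(real ^ 'k) set"
    and p q r lam \<kappa>0 \<kappa>1 \<kappa>2 :: real
    and f :: "real ^ 'k \<Rightarrow> real ^ 'n \<Rightarrow> real ^ 'n"
    and K1 :: "real ^ 'k \<Rightarrow> real ^ 'k \<Rightarrow> real ^ 'n \<Rightarrow> real ^ 'n"
    and K2 :: "real ^ 'k \<Rightarrow> real ^ 'k \<Rightarrow> real ^ 'n \<Rightarrow> real ^ 'm ^ 'n"
    and \<gamma>1 :: "real ^ 'k \<Rightarrow> real ^ 'k \<Rightarrow> real"
  assumes \<Omega>: "\<Omega> \<in> lmeasurable"
    and lam: "lam \<ge> 0" and r: "r > 0"
    and q: "q > 1" and p: "p > 1" and pq: "1 / p + 1 / q = 1"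
    and f_meas: "\<And>x. (\<lambda>\<xi>. f \<xi> x) \<in> borel_measurable (lebesgue_on \<Omega>)"
    and \<kappa>0: "\<kappa>0 \<ge> 0"
    and f_lipschitz: "AE \<xi> in lebesgue_on \<Omega>. \<forall>x1 x2. norm (f \<xi> x1 - f \<xi> x2) \<le> \<kappa>0 * norm (x1 - x2)"
    and K1_meas: "\<And>x. (\<lambda>(\<xi>, s). K1 \<xi> s x) \<in> borel_measurable (lebesgue_on (\<Omega> \<times> \<Omega>))"
    and K1_zero: "(\<lambda>(\<xi>, s). K1 \<xi> s 0) \<in> Lp_space (lebesgue_on (\<Omega> \<times> \<Omega>)) p"
    and \<gamma>1_nonneg: "\<And>\<xi> s. \<xi> \<in> \<Omega> \<Longrightarrow> s \<in> \<Omega> \<Longrightarrow> \<gamma>1 \<xi> s \<ge> 0"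
    and \<gamma>1_inner: "AE \<xi> in lebesgue_on \<Omega>. integrable (lebesgue_on \<Omega>) (\<lambda>s. \<gamma>1 \<xi> s powr q)"
    and \<gamma>1_outer: "integrable (lebesgue_on \<Omega>)
      (\<lambda>\<xi>. (\<integral>s. \<gamma>1 \<xi> s powr q \<partial>(lebesgue_on \<Omega>)) powr (p / q))"
    and K1_lipschitz: "AE (\<xi>, s) in lebesgue_on (\<Omega> \<times> \<Omega>).
      \<forall>x1 x2. norm (K1 \<xi> s x1 - K1 \<xi> s x2) \<le> \<gamma>1 \<xi> s * norm (x1 - x2)"
    and K2_meas: "\<And>x. (\<lambda>(\<xi>, s). K2 \<xi> s x) \<in> borel_measurable (lebesgue_on (\<Omega> \<times> \<Omega>))"
    and K2_zero: "(\<lambda>(\<xi>, s). K2 \<xi> s 0) \<in> Lp_space (lebesgue_on (\<Omega> \<times> \<Omega>)) p"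
    and \<kappa>2: "\<kappa>2 \<ge> 0"
    and K2_lipschitz: "AE (\<xi>, s) in lebesgue_on (\<Omega> \<times> \<Omega>).
      \<forall>x1 x2. norm (K2 \<xi> s x1 - K2 \<xi> s x2) \<le> \<kappa>2 * norm (x1 - x2)"
    and \<kappa>1: "\<kappa>1 = (\<integral>\<xi>. (\<integral>s. \<gamma>1 \<xi> s powr q \<partial>(lebesgue_on \<Omega>)) powr (p / q)
                    \<partial>(lebesgue_on \<Omega>)) powr (1 / p)"
    and contractive: "6 powr (p - 1) * (\<kappa>0 powr p + lam powr p * \<kappa>1 powr p
              + lam powr p * r powr p * \<kappa>2 powr p * measure lebesgue \<Omega>) < 1"
begin

abbreviation M where "M \<equiv> lebesgue_on \<Omega>"

text \<open>
  The \<open>p\<close>-th power of the norm of \<open>L\<^sub>p\<close>, in which the smallness hypothesis is phrased.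
\<close>

abbreviation pnorm :: "(real ^ 'k \<Rightarrow> 'c::real_normed_vector) \<Rightarrow> real" where
  "pnorm g \<equiv> \<integral>t. norm (g t) powr p \<partial>M"

definition admissible :: "(real ^ 'k \<Rightarrow> real ^ 'm) \<Rightarrow> bool" where
  "admissible u \<longleftrightarrow> u \<in> Lp_space M q \<and> (\<integral>t. norm (u t) powr q \<partial>M) \<le> r powr q"

definition rhs :: "(real ^ 'k \<Rightarrow> real ^ 'm) \<Rightarrow> (real ^ 'k \<Rightarrow> real ^ 'n) \<Rightarrow> real ^ 'k \<Rightarrow> real ^ 'n" where
  "rhs u x \<xi> = f \<xi> (x \<xi>) + lam *\<^sub>R (\<integral>s. K1 \<xi> s (x s) + K2 \<xi> s (x s) *v u s \<partial>M)"

definition \<Lambda> :: real where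
  "\<Lambda> = \<kappa>0 powr p + lam powr p * \<kappa>1 powr p + lam powr p * r powr p * \<kappa>2 powr p * measure lebesgue \<Omega>"

lemma \<Omega>_sets: "\<Omega> \<in> sets lebesgue"
  using \<Omega> by (rule fmeasurableD)

lemma finite_M: "finite_measure M"
  using \<Omega> by (rule finite_measure_lebesgue_on)

lemma pq': "1 / q + 1 / p = 1"
  using pq by simp

lemma AE_in_\<Omega>: "AE \<xi> in M. \<xi> \<in> \<Omega>"
  by (rule AE_I2) simp

lemma admissibleD:
  assumes "admissible u"
  shows "u \<in> Lp_space M q" "(\<integral>t. norm (u t) powr q \<partial>M) powr (1 / q) \<le> r"
proof -
  show "u \<in> Lp_space M q"
    using assms by (simp add: admissible_def)
  have "(\<integral>t. norm (u t) powr q \<partial>M) powr (1 / q) \<le> (r powr q) powr (1 / q)"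
    using assms q by (intro powr_mono2) (auto simp: admissible_def intro: integral_nonneg_AE)
  then show "(\<integral>t. norm (u t) powr q \<partial>M) powr (1 / q) \<le> r"
    using q r by (simp add: powr_powr)
qed

lemma AE_K1_lipschitz:
  "AE \<xi> in M. AE s in M. \<forall>x1 x2. norm (K1 \<xi> s x1 - K1 \<xi> s x2) \<le> \<gamma>1 \<xi> s * norm (x1 - x2)"
  using AE_lebesgue_on_Times[OF \<Omega>_sets \<Omega>_sets K1_lipschitz] by simp

lemma AE_K2_lipschitz:
  "AE \<xi> in M. AE s in M. \<forall>x1 x2. norm (K2 \<xi> s x1 - K2 \<xi> s x2) \<le> \<kappa>2 * norm (x1 - x2)"
  using AE_lebesgue_on_Times[OF \<Omega>_sets \<Omega>_sets K2_lipschitz] by simp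

text \<open>
  A section of \<open>\<gamma>1\<close> is measurable as the \<open>q\<close>-th root of its integrable \<open>q\<close>-th power.
\<close>

lemma AE_\<gamma>1_Lq: "AE \<xi> in M. \<gamma>1 \<xi> \<in> Lp_space M q
    \<and> (\<integral>s. norm (\<gamma>1 \<xi> s) powr q \<partial>M) = (\<integral>s. \<gamma>1 \<xi> s powr q \<partial>M)"
  using \<gamma>1_inner AE_in_\<Omega>
proof eventually_elim
  fix \<xi> assume int: "integrable M (\<lambda>s. \<gamma>1 \<xi> s powr q)" and \<xi>: "\<xi> \<in> \<Omega>"
  have "(\<lambda>s. (\<gamma>1 \<xi> s powr q) powr (1 / q)) \<in> borel_measurable M"
    using borel_measurable_integrable[OF int] by measurable
  moreover have "(\<gamma>1 \<xi> s powr q) powr (1 / q) = \<gamma>1 \<xi> s" if "s \<in> space M" for s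
    using \<gamma>1_nonneg[OF \<xi>, of s] that q by (simp add: powr_powr)
  ultimately have m: "\<gamma>1 \<xi> \<in> borel_measurable M"
    by (subst measurable_cong[where g = "\<lambda>s. (\<gamma>1 \<xi> s powr q) powr (1 / q)"]) auto
  have eq: "norm (\<gamma>1 \<xi> s) powr q = \<gamma>1 \<xi> s powr q" if "s \<in> space M" for s
    using \<gamma>1_nonneg[OF \<xi>, of s] that by simp
  have "integrable M (\<lambda>s. norm (\<gamma>1 \<xi> s) powr q)"
    using int eq by (subst Bochner_Integration.integrable_cong[OF refl]) auto
  moreover have "(\<integral>s. norm (\<gamma>1 \<xi> s) powr q \<partial>M) = (\<integral>s. \<gamma>1 \<xi> s powr q \<partial>M)"
    using eq by (intro Bochner_Integration.integral_cong refl) auto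
  ultimately show "\<gamma>1 \<xi> \<in> Lp_space M q \<and> (\<integral>s. norm (\<gamma>1 \<xi> s) powr q \<partial>M) = (\<integral>s. \<gamma>1 \<xi> s powr q \<partial>M)"
    using m by (simp add: Lp_space_def)
qed

lemma AE_section_Lp:
  fixes K :: "real ^ 'k \<Rightarrow> real ^ 'k \<Rightarrow> real ^ 'n \<Rightarrow> 'c::euclidean_space"
  assumes "(\<lambda>(\<xi>, s). K \<xi> s 0) \<in> Lp_space (lebesgue_on (\<Omega> \<times> \<Omega>)) p"
  shows "AE \<xi> in M. (\<lambda>s. K \<xi> s 0) \<in> Lp_space M p"
proof -
  have m: "(\<lambda>z. K (fst z) (snd z) 0) \<in> borel_measurable (lebesgue_on (\<Omega> \<times> \<Omega>))"
    and i: "integrable (lebesgue_on (\<Omega> \<times> \<Omega>)) (\<lambda>z. norm (K (fst z) (snd z) 0) powr p)"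
    using assms by (simp_all add: Lp_space_def case_prod_beta')
  show ?thesis
    using AE_measurable_section_lebesgue_on[OF \<Omega>_sets \<Omega>_sets m]
      Fubini_lebesgue_on_Times(1)[OF \<Omega>_sets \<Omega>_sets i]
    by eventually_elim (simp add: Lp_space_def)
qed

lemma superposition_measurable:
  fixes K :: "real ^ 'k \<Rightarrow> real ^ 'k \<Rightarrow> real ^ 'n \<Rightarrow> 'c::euclidean_space"
  assumes K: "\<And>c. (\<lambda>(\<xi>, s). K \<xi> s c) \<in> borel_measurable (lebesgue_on (\<Omega> \<times> \<Omega>))"
    and lip: "AE (\<xi>, s) in lebesgue_on (\<Omega> \<times> \<Omega>).
      \<forall>x1 x2. norm (K \<xi> s x1 - K \<xi> s x2) \<le> g \<xi> s * norm (x1 - x2)"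
    and x: "x \<in> borel_measurable M"
  shows "(\<lambda>z. K (fst z) (snd z) (x (snd z))) \<in> borel_measurable (lebesgue_on (\<Omega> \<times> \<Omega>))"
proof (rule Caratheodory_superposition_measurable
    [where f = "\<lambda>z. K (fst z) (snd z)" and y = "\<lambda>z. x (snd z)"])
  show "\<Omega> \<times> \<Omega> \<in> sets lebesgue"
    using \<Omega>_sets by (intro sets_lebesgue_Times)
  show "(\<lambda>z. K (fst z) (snd z) c) \<in> borel_measurable (lebesgue_on (\<Omega> \<times> \<Omega>))" for c
    using K[of c] by (simp add: case_prod_beta')
  show "AE z in lebesgue_on (\<Omega> \<times> \<Omega>). continuous_on UNIV (K (fst z) (snd z))"
    using lip
  proof (rule eventually_mono)
    fix z assume "case z of (\<xi>, s) \<Rightarrow> \<forall>x1 x2. norm (K \<xi> s x1 - K \<xi> s x2) \<le> g \<xi> s * norm (x1 - x2)"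
    then show "continuous_on UNIV (K (fst z) (snd z))"
      by (intro continuous_on_of_lipschitz_bound[of _ "g (fst z) (snd z)"]) (simp add: case_prod_beta)
  qed
  show "(\<lambda>z. x (snd z)) \<in> borel_measurable (lebesgue_on (\<Omega> \<times> \<Omega>))"
    using \<Omega>_sets x by (rule measurable_lebesgue_on_snd)
qed

lemma K1_superposition_measurable:
  "x \<in> Lp_space M p \<Longrightarrow>
    (\<lambda>z. K1 (fst z) (snd z) (x (snd z))) \<in> borel_measurable (lebesgue_on (\<Omega> \<times> \<Omega>))"
  by (rule superposition_measurable[OF K1_meas K1_lipschitz Lp_measurable])

lemma K2_superposition_measurable:
  "x \<in> Lp_space M p \<Longrightarrow>
    (\<lambda>z. K2 (fst z) (snd z) (x (snd z))) \<in> borel_measurable (lebesgue_on (\<Omega> \<times> \<Omega>))"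
  by (rule superposition_measurable[OF K2_meas K2_lipschitz Lp_measurable])

lemma AE_K1_section_integrable:
  assumes x: "x \<in> Lp_space M p"
  shows "AE \<xi> in M. integrable M (\<lambda>s. K1 \<xi> s (x s))"
  using AE_measurable_section_lebesgue_on[OF \<Omega>_sets \<Omega>_sets K1_superposition_measurable[OF x]]
    AE_section_Lp[where K = K1, OF K1_zero] AE_\<gamma>1_Lq AE_K1_lipschitz
proof eventually_elim
  fix \<xi>
  assume m: "(\<lambda>s. K1 (fst (\<xi>, s)) (snd (\<xi>, s)) (x (snd (\<xi>, s)))) \<in> borel_measurable M"
    and z: "(\<lambda>s. K1 \<xi> s 0) \<in> Lp_space M p"
    and g: "\<gamma>1 \<xi> \<in> Lp_space M q \<and> (\<integral>s. norm (\<gamma>1 \<xi> s) powr q \<partial>M) = (\<integral>s. \<gamma>1 \<xi> s powr q \<partial>M)"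
    and l: "AE s in M. \<forall>x1 x2. norm (K1 \<xi> s x1 - K1 \<xi> s x2) \<le> \<gamma>1 \<xi> s * norm (x1 - x2)"
  have i1: "integrable M (\<lambda>s. norm (K1 \<xi> s 0))"
    using p by (intro integrable_Lp_space[OF finite_M _ z]) simp
  have i2: "integrable M (\<lambda>s. norm (\<gamma>1 \<xi> s) * norm (x s))"
    using q p pq' g x by (intro Holder_inequality(1)) auto
  show "integrable M (\<lambda>s. K1 \<xi> s (x s))"
  proof (rule Bochner_Integration.integrable_bound)
    show "integrable M (\<lambda>s. norm (K1 \<xi> s 0) + norm (\<gamma>1 \<xi> s) * norm (x s))"
      using i1 i2 by simp
    show "(\<lambda>s. K1 \<xi> s (x s)) \<in> borel_measurable M"
      using m by simp
    show "AE s in M. norm (K1 \<xi> s (x s)) \<le> norm (norm (K1 \<xi> s 0) + norm (\<gamma>1 \<xi> s) * norm (x s))"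
      using l
    proof eventually_elim
      fix s assume "\<forall>x1 x2. norm (K1 \<xi> s x1 - K1 \<xi> s x2) \<le> \<gamma>1 \<xi> s * norm (x1 - x2)"
      then have "norm (K1 \<xi> s (x s) - K1 \<xi> s 0) \<le> \<gamma>1 \<xi> s * norm (x s)"
        by (metis diff_zero)
      also have "\<dots> \<le> norm (\<gamma>1 \<xi> s) * norm (x s)"
        by (intro mult_right_mono) auto
      finally show "norm (K1 \<xi> s (x s)) \<le> norm (norm (K1 \<xi> s 0) + norm (\<gamma>1 \<xi> s) * norm (x s))"
        using norm_triangle_sub[of "K1 \<xi> s (x s)" "K1 \<xi> s 0"] by simp
    qed
  qed
qed

text \<open>
  The pointwise bound keeps the contribution of \<open>K2\<close> at the zero state separate from that of \<open>x\<close>, so that small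
  sets of integration can later be treated by dominated convergence on the product and on \<open>\<Omega>\<close> respectively.
\<close>

lemma AE_K2_section_Lp:
  assumes x: "x \<in> Lp_space M p"
  shows "AE \<xi> in M. (\<lambda>s. K2 \<xi> s (x s)) \<in> Lp_space M p \<and> (AE s in M. norm (K2 \<xi> s (x s)) powr p
      \<le> 2 powr (p - 1) * (norm (K2 \<xi> s 0) powr p + \<kappa>2 powr p * norm (x s) powr p))"
  using AE_measurable_section_lebesgue_on[OF \<Omega>_sets \<Omega>_sets K2_superposition_measurable[OF x]]
    AE_section_Lp[where K = K2, OF K2_zero] AE_K2_lipschitz
proof eventually_elim
  fix \<xi>
  assume m: "(\<lambda>s. K2 (fst (\<xi>, s)) (snd (\<xi>, s)) (x (snd (\<xi>, s)))) \<in> borel_measurable M"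
    and z: "(\<lambda>s. K2 \<xi> s 0) \<in> Lp_space M p"
    and l: "AE s in M. \<forall>x1 x2. norm (K2 \<xi> s x1 - K2 \<xi> s x2) \<le> \<kappa>2 * norm (x1 - x2)"
  have b: "AE s in M. norm (K2 \<xi> s (x s)) powr p
      \<le> 2 powr (p - 1) * (norm (K2 \<xi> s 0) powr p + \<kappa>2 powr p * norm (x s) powr p)"
    using l
  proof eventually_elim
    fix s assume "\<forall>x1 x2. norm (K2 \<xi> s x1 - K2 \<xi> s x2) \<le> \<kappa>2 * norm (x1 - x2)"
    then have "norm (K2 \<xi> s (x s) - K2 \<xi> s 0) \<le> \<kappa>2 * norm (x s)"
      by (metis diff_zero)
    then have "norm (K2 \<xi> s (x s)) powr p \<le> (norm (K2 \<xi> s 0) + \<kappa>2 * norm (x s)) powr p"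
      using norm_triangle_sub[of "K2 \<xi> s (x s)" "K2 \<xi> s 0"] p by (intro powr_mono2) auto
    also have "\<dots> \<le> 2 powr (p - 1) * (norm (K2 \<xi> s 0) powr p + (\<kappa>2 * norm (x s)) powr p)"
      using p \<kappa>2 by (intro powr_add_le) auto
    finally show "norm (K2 \<xi> s (x s)) powr p
        \<le> 2 powr (p - 1) * (norm (K2 \<xi> s 0) powr p + \<kappa>2 powr p * norm (x s) powr p)"
      using \<kappa>2 by (simp add: powr_mult)
  qed
  have i: "integrable M (\<lambda>s. 2 powr (p - 1) * (norm (K2 \<xi> s 0) powr p + \<kappa>2 powr p * norm (x s) powr p))"
    using z x by (simp add: Lp_space_def)
  have "(\<lambda>s. K2 \<xi> s (x s)) \<in> borel_measurable M"
    using m by simp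
  from Lp_space_dominated(1)[OF this b i] b show "(\<lambda>s. K2 \<xi> s (x s)) \<in> Lp_space M p \<and> (AE s in M. norm (K2 \<xi> s (x s)) powr p
      \<le> 2 powr (p - 1) * (norm (K2 \<xi> s 0) powr p + \<kappa>2 powr p * norm (x s) powr p))"
    by (rule conjI)
qed

lemma integrable_matrix_control:
  fixes A :: "real ^ 'k \<Rightarrow> real ^ 'm ^ 'n"
  assumes A: "A \<in> Lp_space M p" and u: "u \<in> Lp_space M q"
  shows "integrable M (\<lambda>s. A s *v u s)"
    "norm (\<integral>s. A s *v u s \<partial>M) \<le> (\<integral>s. norm (A s) * norm (u s) \<partial>M)"
proof -
  have i: "integrable M (\<lambda>s. norm (A s) * norm (u s))"
    using p q pq A u by (rule Holder_inequality(1))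
  show i': "integrable M (\<lambda>s. A s *v u s)"
  proof (rule Bochner_Integration.integrable_bound[OF i])
    show "(\<lambda>s. A s *v u s) \<in> borel_measurable M"
      using A u by (intro borel_measurable_matrix_vector_mult) (auto simp: Lp_space_def)
    show "AE s in M. norm (A s *v u s) \<le> norm (norm (A s) * norm (u s))"
      by (rule AE_I2) (simp add: norm_matrix_vector_mult_le)
  qed
  have "norm (\<integral>s. A s *v u s \<partial>M) \<le> (\<integral>s. norm (A s *v u s) \<partial>M)"
    by (rule integral_norm_bound)
  also have "\<dots> \<le> (\<integral>s. norm (A s) * norm (u s) \<partial>M)"
    using i i' by (intro integral_mono) (auto simp: norm_matrix_vector_mult_le)
  finally show "norm (\<integral>s. A s *v u s \<partial>M) \<le> (\<integral>s. norm (A s) * norm (u s) \<partial>M)" .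
qed

lemma AE_integrand_integrable:
  assumes x: "x \<in> Lp_space M p" and u: "u \<in> Lp_space M q"
  shows "AE \<xi> in M. integrable M (\<lambda>s. K1 \<xi> s (x s) + K2 \<xi> s (x s) *v u s)"
  using AE_K1_section_integrable[OF x] AE_K2_section_Lp[OF x]
  by eventually_elim (use integrable_matrix_control(1)[OF _ u] in auto)

text \<open>
  The integrability demanded of a trajectory is automatic for states in \<open>L\<^sub>p\<close> and controls in \<open>L\<^sub>q\<close>.
\<close>

lemma trajectory_iff:
  assumes "u \<in> Lp_space M q"
  shows "trajectory \<Omega> p lam f K1 K2 u x \<longleftrightarrow> x \<in> Lp_space M p \<and> (AE \<xi> in M. x \<xi> = rhs u x \<xi>)"
  using AE_integrand_integrable[OF _ assms, of x] unfolding trajectory_def rhs_def by auto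

lemma rhs_measurable:
  assumes x: "x \<in> Lp_space M p" and u: "u \<in> Lp_space M q"
  shows "rhs u x \<in> borel_measurable M"
proof -
  have "(\<lambda>\<xi>. f \<xi> (x \<xi>)) \<in> borel_measurable M"
  proof (rule Caratheodory_superposition_measurable[OF \<Omega>_sets f_meas])
    show "AE \<xi> in M. continuous_on UNIV (f \<xi>)"
      using f_lipschitz by eventually_elim (rule continuous_on_of_lipschitz_bound)
  qed (use x in \<open>simp add: Lp_space_def\<close>)
  moreover have "(\<lambda>z. K1 (fst z) (snd z) (x (snd z)) + K2 (fst z) (snd z) (x (snd z)) *v u (snd z))
      \<in> borel_measurable (lebesgue_on (\<Omega> \<times> \<Omega>))"
    using x u \<Omega>_sets
    by (intro borel_measurable_add borel_measurable_matrix_vector_mult K1_superposition_measurable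
        K2_superposition_measurable measurable_lebesgue_on_snd) (auto simp: Lp_space_def)
  from borel_measurable_integral_section_lebesgue_on[OF \<Omega>_sets \<Omega>_sets this]
  have "(\<lambda>\<xi>. \<integral>s. K1 \<xi> s (x s) + K2 \<xi> s (x s) *v u s \<partial>M) \<in> borel_measurable M"
    by simp
  ultimately show ?thesis
    unfolding rhs_def[abs_def] by (intro borel_measurable_add borel_measurable_scaleR) auto
qed

text \<open>
  The Lipschitz bounds and two applications of the Hoelder inequality: \<open>\<gamma>1 \<xi>\<close> against \<open>x - y\<close>, and \<open>x - y\<close> against
  the control.
\<close>

lemma AE_rhs_diff_state:
  assumes x: "x \<in> Lp_space M p" and y: "y \<in> Lp_space M p" and u: "admissible u"
  defines "D \<equiv> pnorm (\<lambda>t. x t - y t) powr (1 / p)"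
  shows "AE \<xi> in M. norm (rhs u x \<xi> - rhs u y \<xi>) \<le> \<kappa>0 * norm (x \<xi> - y \<xi>)
    + lam * ((\<integral>s. \<gamma>1 \<xi> s powr q \<partial>M) powr (1 / q) * D) + lam * (\<kappa>2 * (D * r))"
  using AE_K1_section_integrable[OF x] AE_K2_section_Lp[OF x] AE_K1_section_integrable[OF y]
    AE_K2_section_Lp[OF y] f_lipschitz AE_\<gamma>1_Lq AE_K1_lipschitz AE_K2_lipschitz
proof eventually_elim
  fix \<xi>
  assume K1x: "integrable M (\<lambda>s. K1 \<xi> s (x s))" and K1y: "integrable M (\<lambda>s. K1 \<xi> s (y s))"
    and K2x: "(\<lambda>s. K2 \<xi> s (x s)) \<in> Lp_space M p \<and> (AE s in M. norm (K2 \<xi> s (x s)) powr p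
      \<le> 2 powr (p - 1) * (norm (K2 \<xi> s 0) powr p + \<kappa>2 powr p * norm (x s) powr p))"
    and K2y: "(\<lambda>s. K2 \<xi> s (y s)) \<in> Lp_space M p \<and> (AE s in M. norm (K2 \<xi> s (y s)) powr p
      \<le> 2 powr (p - 1) * (norm (K2 \<xi> s 0) powr p + \<kappa>2 powr p * norm (y s) powr p))"
    and fl: "\<forall>x1 x2. norm (f \<xi> x1 - f \<xi> x2) \<le> \<kappa>0 * norm (x1 - x2)"
    and g: "\<gamma>1 \<xi> \<in> Lp_space M q \<and> (\<integral>s. norm (\<gamma>1 \<xi> s) powr q \<partial>M) = (\<integral>s. \<gamma>1 \<xi> s powr q \<partial>M)"
    and l1: "AE s in M. \<forall>x1 x2. norm (K1 \<xi> s x1 - K1 \<xi> s x2) \<le> \<gamma>1 \<xi> s * norm (x1 - x2)"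
    and l2: "AE s in M. \<forall>x1 x2. norm (K2 \<xi> s x1 - K2 \<xi> s x2) \<le> \<kappa>2 * norm (x1 - x2)"
  have uq: "u \<in> Lp_space M q"
    using u by (rule admissibleD)
  have xy: "(\<lambda>t. x t - y t) \<in> Lp_space M p"
    using p x y by (intro Lp_space_diff) auto
  let ?Fx = "\<lambda>s. K1 \<xi> s (x s) + K2 \<xi> s (x s) *v u s"
  let ?Fy = "\<lambda>s. K1 \<xi> s (y s) + K2 \<xi> s (y s) *v u s"
  have iFx: "integrable M ?Fx" and iFy: "integrable M ?Fy"
    using K1x K1y integrable_matrix_control(1)[OF _ uq] K2x K2y by auto
  have i1: "integrable M (\<lambda>s. norm (\<gamma>1 \<xi> s) * norm (x s - y s))"
    and h1: "(\<integral>s. norm (\<gamma>1 \<xi> s) * norm (x s - y s) \<partial>M) \<le> (\<integral>s. \<gamma>1 \<xi> s powr q \<partial>M) powr (1 / q) * D"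
    using Holder_inequality[OF q p pq' _ xy, of "\<gamma>1 \<xi>"] g by (auto simp: D_def)
  have i2: "integrable M (\<lambda>s. norm (x s - y s) * norm (u s))"
    and h2: "(\<integral>s. norm (x s - y s) * norm (u s) \<partial>M) \<le> D * r"
  proof -
    show "integrable M (\<lambda>s. norm (x s - y s) * norm (u s))"
      using p q pq xy uq by (rule Holder_inequality(1))
    have "(\<integral>s. norm (x s - y s) * norm (u s) \<partial>M) \<le> D * (\<integral>t. norm (u t) powr q \<partial>M) powr (1 / q)"
      unfolding D_def using p q pq xy uq by (rule Holder_inequality(2))
    also have "\<dots> \<le> D * r"
      using admissibleD(2)[OF u] by (intro mult_left_mono) (auto simp: D_def)
    finally show "(\<integral>s. norm (x s - y s) * norm (u s) \<partial>M) \<le> D * r" .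
  qed
  have "norm ((\<integral>s. ?Fx s \<partial>M) - (\<integral>s. ?Fy s \<partial>M)) = norm (\<integral>s. ?Fx s - ?Fy s \<partial>M)"
    using iFx iFy by simp
  also have "\<dots> \<le> (\<integral>s. norm (?Fx s - ?Fy s) \<partial>M)"
    by (rule integral_norm_bound)
  also have "\<dots> \<le> (\<integral>s. norm (\<gamma>1 \<xi> s) * norm (x s - y s) + \<kappa>2 * (norm (x s - y s) * norm (u s)) \<partial>M)"
  proof (rule integral_mono_AE)
    show "integrable M (\<lambda>s. norm (?Fx s - ?Fy s))"
      using iFx iFy by (intro integrable_norm Bochner_Integration.integrable_diff)
    show "integrable M (\<lambda>s. norm (\<gamma>1 \<xi> s) * norm (x s - y s) + \<kappa>2 * (norm (x s - y s) * norm (u s)))"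
      using i1 i2 by simp
    show "AE s in M. norm (?Fx s - ?Fy s)
        \<le> norm (\<gamma>1 \<xi> s) * norm (x s - y s) + \<kappa>2 * (norm (x s - y s) * norm (u s))"
      using l1 l2
    proof eventually_elim
      fix s
      assume a1: "\<forall>x1 x2. norm (K1 \<xi> s x1 - K1 \<xi> s x2) \<le> \<gamma>1 \<xi> s * norm (x1 - x2)"
        and a2: "\<forall>x1 x2. norm (K2 \<xi> s x1 - K2 \<xi> s x2) \<le> \<kappa>2 * norm (x1 - x2)"
      have "?Fx s - ?Fy s = (K1 \<xi> s (x s) - K1 \<xi> s (y s)) + (K2 \<xi> s (x s) - K2 \<xi> s (y s)) *v u s"
        by (simp add: matrix_vector_mult_diff_rdistrib)
      also have "norm \<dots> \<le> norm (K1 \<xi> s (x s) - K1 \<xi> s (y s))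
          + norm (K2 \<xi> s (x s) - K2 \<xi> s (y s)) * norm (u s)"
        by (intro norm_triangle_le add_mono norm_matrix_vector_mult_le order_refl)
      also have "\<dots> \<le> norm (\<gamma>1 \<xi> s) * norm (x s - y s) + \<kappa>2 * norm (x s - y s) * norm (u s)"
      proof (intro add_mono mult_right_mono)
        have "\<gamma>1 \<xi> s * norm (x s - y s) \<le> norm (\<gamma>1 \<xi> s) * norm (x s - y s)"
          by (intro mult_right_mono) auto
        then show "norm (K1 \<xi> s (x s) - K1 \<xi> s (y s)) \<le> norm (\<gamma>1 \<xi> s) * norm (x s - y s)"
          using a1[rule_format, of "x s" "y s"] by linarith
      qed (use a2 in auto)
      finally show "norm (?Fx s - ?Fy s)
          \<le> norm (\<gamma>1 \<xi> s) * norm (x s - y s) + \<kappa>2 * (norm (x s - y s) * norm (u s))"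
        by (simp add: mult.assoc)
    qed
  qed
  also have "\<dots> = (\<integral>s. norm (\<gamma>1 \<xi> s) * norm (x s - y s) \<partial>M)
      + \<kappa>2 * (\<integral>s. norm (x s - y s) * norm (u s) \<partial>M)"
    using i1 i2 by simp
  also have "\<dots> \<le> (\<integral>s. \<gamma>1 \<xi> s powr q \<partial>M) powr (1 / q) * D + \<kappa>2 * (D * r)"
    using h1 h2 \<kappa>2 by (intro add_mono mult_left_mono)
  finally have I: "norm ((\<integral>s. ?Fx s \<partial>M) - (\<integral>s. ?Fy s \<partial>M))
      \<le> (\<integral>s. \<gamma>1 \<xi> s powr q \<partial>M) powr (1 / q) * D + \<kappa>2 * (D * r)" .
  have "rhs u x \<xi> - rhs u y \<xi> = (f \<xi> (x \<xi>) - f \<xi> (y \<xi>)) + lam *\<^sub>R ((\<integral>s. ?Fx s \<partial>M) - (\<integral>s. ?Fy s \<partial>M))"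
    by (simp add: rhs_def scaleR_diff_right)
  then have "norm (rhs u x \<xi> - rhs u y \<xi>) \<le> norm (f \<xi> (x \<xi>) - f \<xi> (y \<xi>)) + lam * norm ((\<integral>s. ?Fx s \<partial>M) - (\<integral>s. ?Fy s \<partial>M))"
    using lam by (simp only:) (intro norm_triangle_le, simp)
  also have "\<dots> \<le> \<kappa>0 * norm (x \<xi> - y \<xi>)
      + lam * ((\<integral>s. \<gamma>1 \<xi> s powr q \<partial>M) powr (1 / q) * D + \<kappa>2 * (D * r))"
    using fl I lam by (intro add_mono mult_left_mono) auto
  finally show "norm (rhs u x \<xi> - rhs u y \<xi>) \<le> \<kappa>0 * norm (x \<xi> - y \<xi>)
      + lam * ((\<integral>s. \<gamma>1 \<xi> s powr q \<partial>M) powr (1 / q) * D) + lam * (\<kappa>2 * (D * r))"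
    by (simp add: distrib_left)
qed

text \<open>
  The three terms of \<open>AE_rhs_diff_state\<close>, raised to the power \<open>p\<close> by \<open>powr_add3_le\<close> and integrated, produce the
  three terms of \<open>\<Lambda>\<close>.
\<close>

lemma rhs_contraction:
  assumes x: "x \<in> Lp_space M p" and y: "y \<in> Lp_space M p" and u: "admissible u"
  shows "(\<lambda>t. rhs u x t - rhs u y t) \<in> Lp_space M p"
    "pnorm (\<lambda>t. rhs u x t - rhs u y t) \<le> 3 powr (p - 1) * \<Lambda> * pnorm (\<lambda>t. x t - y t)"
proof -
  define N where "N = pnorm (\<lambda>t. x t - y t)"
  define D where "D = N powr (1 / p)"
  define G where "G \<xi> = (\<integral>s. \<gamma>1 \<xi> s powr q \<partial>M)" for \<xi>
  have N0: "N \<ge> 0"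
    unfolding N_def by (simp add: integral_nonneg_AE)
  have Dp: "D powr p = N"
    using N0 p by (simp add: D_def powr_powr)
  have G0: "G \<xi> \<ge> 0" for \<xi>
    unfolding G_def by (simp add: integral_nonneg_AE)
  have uq: "u \<in> Lp_space M q"
    using u by (rule admissibleD)
  have xy: "integrable M (\<lambda>t. norm (x t - y t) powr p)"
    using p x y Lp_space_diff(1)[of p x M y] by (simp add: Lp_space_def)
  have iG: "integrable M (\<lambda>\<xi>. G \<xi> powr (p / q))"
    using \<gamma>1_outer by (simp add: G_def)
  have \<kappa>1p: "\<kappa>1 powr p = (\<integral>\<xi>. G \<xi> powr (p / q) \<partial>M)"
    using p by (simp add: \<kappa>1 G_def powr_powr integral_nonneg_AE)
  let ?\<phi> = "\<lambda>\<xi>. 3 powr (p - 1) * (\<kappa>0 powr p * norm (x \<xi> - y \<xi>) powr p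
      + lam powr p * N * G \<xi> powr (p / q) + lam powr p * r powr p * \<kappa>2 powr p * N)"
  have const: "integrable M (\<lambda>_. c :: real)" for c
    using finite_M by (rule finite_measure.integrable_const)
  have vol: "measure M (space M) = measure lebesgue \<Omega>"
    using \<Omega>_sets by (simp add: measure_restrict_space)
  have i: "integrable M ?\<phi>"
    using xy iG const by (intro integrable_mult_right Bochner_Integration.integrable_add)
  have m: "(\<lambda>t. rhs u x t - rhs u y t) \<in> borel_measurable M"
    using rhs_measurable[OF x uq] rhs_measurable[OF y uq] by (rule borel_measurable_diff)
  have b: "AE \<xi> in M. norm (rhs u x \<xi> - rhs u y \<xi>) powr p \<le> ?\<phi> \<xi>"
    using AE_rhs_diff_state[OF x y u]
  proof eventually_elim
    fix \<xi>
    assume "norm (rhs u x \<xi> - rhs u y \<xi>) \<le> \<kappa>0 * norm (x \<xi> - y \<xi>)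
        + lam * ((\<integral>s. \<gamma>1 \<xi> s powr q \<partial>M) powr (1 / q) * pnorm (\<lambda>t. x t - y t) powr (1 / p))
        + lam * (\<kappa>2 * (pnorm (\<lambda>t. x t - y t) powr (1 / p) * r))"
    then have "norm (rhs u x \<xi> - rhs u y \<xi>)
        \<le> \<kappa>0 * norm (x \<xi> - y \<xi>) + lam * (G \<xi> powr (1 / q) * D) + lam * (\<kappa>2 * (D * r))"
      unfolding G_def D_def N_def .
    then have "norm (rhs u x \<xi> - rhs u y \<xi>) powr p
        \<le> (\<kappa>0 * norm (x \<xi> - y \<xi>) + lam * (G \<xi> powr (1 / q) * D) + lam * (\<kappa>2 * (D * r))) powr p"
      using p by (intro powr_mono2) auto
    also have "\<dots> \<le> 3 powr (p - 1) * ((\<kappa>0 * norm (x \<xi> - y \<xi>)) powr p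
        + (lam * (G \<xi> powr (1 / q) * D)) powr p + (lam * (\<kappa>2 * (D * r))) powr p)"
      using p lam \<kappa>0 \<kappa>2 r by (intro powr_add3_le) (auto simp: D_def)
    also have "\<dots> = ?\<phi> \<xi>"
    proof -
      have D0: "D \<ge> 0"
        by (simp add: D_def)
      have "(lam * (G \<xi> powr (1 / q) * D)) powr p = lam powr p * N * G \<xi> powr (p / q)"
        using lam D0 p q Dp by (simp add: powr_mult powr_powr)
      moreover have "(lam * (\<kappa>2 * (D * r))) powr p = lam powr p * r powr p * \<kappa>2 powr p * N"
        using lam D0 \<kappa>2 r Dp by (simp add: powr_mult)
      moreover have "(\<kappa>0 * norm (x \<xi> - y \<xi>)) powr p = \<kappa>0 powr p * norm (x \<xi> - y \<xi>) powr p"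
        using \<kappa>0 by (simp add: powr_mult)
      ultimately show ?thesis
        by (simp only:)
    qed
    finally show "norm (rhs u x \<xi> - rhs u y \<xi>) powr p \<le> ?\<phi> \<xi>" .
  qed
  show "(\<lambda>t. rhs u x t - rhs u y t) \<in> Lp_space M p"
    using m b i by (rule Lp_space_dominated(1))
  have "pnorm (\<lambda>t. rhs u x t - rhs u y t) \<le> integral\<^sup>L M ?\<phi>"
    using m b i by (rule Lp_space_dominated(2))
  also have "\<dots> = 3 powr (p - 1) * (\<kappa>0 powr p * N + lam powr p * N * \<kappa>1 powr p
      + measure lebesgue \<Omega> * (lam powr p * r powr p * \<kappa>2 powr p * N))"
    using xy iG const vol by (simp add: N_def \<kappa>1p)
  also have "\<dots> = 3 powr (p - 1) * \<Lambda> * N"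
    by (simp add: \<Lambda>_def algebra_simps)
  finally show "pnorm (\<lambda>t. rhs u x t - rhs u y t) \<le> 3 powr (p - 1) * \<Lambda> * pnorm (\<lambda>t. x t - y t)"
    unfolding N_def .
qed

lemma AE_rhs_diff_control:
  assumes x: "x \<in> Lp_space M p" and u: "u \<in> Lp_space M q" and v: "v \<in> Lp_space M q"
  shows "AE \<xi> in M. norm (rhs u x \<xi> - rhs v x \<xi>)
    \<le> lam * (\<integral>s. norm (K2 \<xi> s (x s)) * norm (u s - v s) \<partial>M)"
  using AE_K1_section_integrable[OF x] AE_K2_section_Lp[OF x]
proof eventually_elim
  fix \<xi>
  assume K1x: "integrable M (\<lambda>s. K1 \<xi> s (x s))"
    and K2x: "(\<lambda>s. K2 \<xi> s (x s)) \<in> Lp_space M p \<and> (AE s in M. norm (K2 \<xi> s (x s)) powr p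
      \<le> 2 powr (p - 1) * (norm (K2 \<xi> s 0) powr p + \<kappa>2 powr p * norm (x s) powr p))"
  have uv: "(\<lambda>s. u s - v s) \<in> Lp_space M q"
    using q u v by (intro Lp_space_diff) auto
  note int = integrable_matrix_control(1)[OF conjunct1[OF K2x]]
  have "rhs u x \<xi> - rhs v x \<xi> = lam *\<^sub>R (\<integral>s. K2 \<xi> s (x s) *v (u s - v s) \<partial>M)"
    using K1x int[OF u] int[OF v]
    by (simp add: rhs_def matrix_vector_mult_diff_distrib flip: scaleR_diff_right)
  also have "norm \<dots> \<le> lam * (\<integral>s. norm (K2 \<xi> s (x s)) * norm (u s - v s) \<partial>M)"
    using lam integrable_matrix_control(2)[OF conjunct1[OF K2x] uv]
    by (simp add: mult_left_mono)
  finally show "norm (rhs u x \<xi> - rhs v x \<xi>)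
      \<le> lam * (\<integral>s. norm (K2 \<xi> s (x s)) * norm (u s - v s) \<partial>M)" .
qed

section \<open>Trajectories near approximate solutions\<close>

text \<open>
  The constant \<open>6 = 2 * 3\<close> at work: \<open>3 powr (p - 1) * \<Lambda>\<close> is the contraction factor of \<open>rhs u\<close>, and one more
  factor \<open>2 powr (p - 1)\<close> is lost in each use of \<open>pnorm_triangle\<close>.
\<close>

lemma \<Lambda>_bounds: "0 \<le> \<Lambda>" "3 powr (p - 1) * \<Lambda> < 1" "2 powr (p - 1) * (3 powr (p - 1) * \<Lambda>) < 1"
proof -
  show 0: "0 \<le> \<Lambda>"
    unfolding \<Lambda>_def using r by simp
  have eq: "2 powr (p - 1) * (3 powr (p - 1) * \<Lambda>) = 6 powr (p - 1) * \<Lambda>"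
    using powr_mult[of 2 3 "p - 1"] by simp
  show lt: "2 powr (p - 1) * (3 powr (p - 1) * \<Lambda>) < 1"
    unfolding eq using contractive unfolding \<Lambda>_def .
  have "1 * (3 powr (p - 1) * \<Lambda>) \<le> 2 powr (p - 1) * (3 powr (p - 1) * \<Lambda>)"
    using 0 p by (intro mult_right_mono ge_one_powr_ge_zero) auto
  then show "3 powr (p - 1) * \<Lambda> < 1"
    using lt by linarith
qed

lemma pnorm_diff_commute: "pnorm (\<lambda>t. x t - y t) = pnorm (\<lambda>t. y t - x t)"
  by (simp add: norm_minus_commute)

lemma pnorm_triangle:
  fixes x y z :: "real ^ 'k \<Rightarrow> 'c::{real_normed_vector, second_countable_topology}"
  assumes "x \<in> Lp_space M p" "y \<in> Lp_space M p" "z \<in> Lp_space M p"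
  shows "pnorm (\<lambda>t. x t - z t)
    \<le> 2 powr (p - 1) * (pnorm (\<lambda>t. x t - y t) + pnorm (\<lambda>t. y t - z t))"
  using Lp_space_add(2)[of p "\<lambda>t. x t - y t" M "\<lambda>t. y t - z t"] p
    Lp_space_diff(1)[of p x M y] Lp_space_diff(1)[of p y M z] assms by simp

text \<open>
  Picard iteration from \<open>x0\<close>. One step of the recursion for \<open>pnorm (X k - x0)\<close> costs a factor
  \<open>2 powr (p - 1)\<close> on top of the contraction factor \<open>c\<close>, and \<open>B\<close> is the fixed point of that recursion, so that
  the iterates stay within \<open>B\<close> of \<open>x0\<close>. Contraction turns this into \<open>c ^ i * B\<close> for the tails, the iterates
  converge almost everywhere, and Fatou's lemma passes the bounds on to the limit.
\<close>

lemma trajectory_near_approximate_solution: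
  assumes u: "admissible u" and x0: "x0 \<in> Lp_space M p" and Tx0: "rhs u x0 \<in> Lp_space M p"
  obtains x where "trajectory \<Omega> p lam f K1 K2 u x"
    and "pnorm (\<lambda>t. x t - x0 t) \<le> 2 powr (p - 1) * pnorm (\<lambda>t. rhs u x0 t - x0 t)
      / (1 - 2 powr (p - 1) * (3 powr (p - 1) * \<Lambda>))"
proof -
  define c where "c = 3 powr (p - 1) * \<Lambda>"
  define E where "E = pnorm (\<lambda>t. rhs u x0 t - x0 t)"
  define B where "B = 2 powr (p - 1) * E / (1 - 2 powr (p - 1) * c)"
  have c: "0 \<le> c" "c < 1" "2 powr (p - 1) * c < 1"
    using \<Lambda>_bounds by (auto simp: c_def)
  have E0: "E \<ge> 0"
    unfolding E_def by (simp add: integral_nonneg_AE)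
  have B: "2 powr (p - 1) * (c * B + E) = B"
    using c(3) by (simp add: B_def field_simps)
  have uq: "u \<in> Lp_space M q"
    using u by (rule admissibleD)
  have p1: "p \<ge> 1" "p > 0"
    using p by auto
  have step: "pnorm (\<lambda>t. rhs u x t - rhs u y t) \<le> c * pnorm (\<lambda>t. x t - y t)"
    if "x \<in> Lp_space M p" "y \<in> Lp_space M p" for x y
    unfolding c_def using that u by (rule rhs_contraction)
  have T_Lp: "rhs u x \<in> Lp_space M p" if "x \<in> Lp_space M p" for x
    using Lp_space_add(1)[OF p1(1) rhs_contraction(1)[OF that x0 u] Tx0] by simp
  define X where "X i = (rhs u ^^ i) x0" for i :: nat
  have X_Suc: "X (Suc i) = rhs u (X i)" and X_0: "X 0 = x0" for i
    by (simp_all add: X_def)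
  have X: "X i \<in> Lp_space M p" for i
    by (induction i) (simp_all add: X_0 X_Suc x0 T_Lp)
  have Xdiff: "(\<lambda>t. X i t - X j t) \<in> Lp_space M p" for i j
    using p1(1) X X by (rule Lp_space_diff)
  have steps: "pnorm (\<lambda>t. X (Suc i) t - X i t) \<le> E * c ^ i" for i
  proof (induction i)
    case 0
    then show ?case by (simp add: X_Suc X_0 E_def)
  next
    case (Suc i)
    have "pnorm (\<lambda>t. X (Suc (Suc i)) t - X (Suc i) t) \<le> c * pnorm (\<lambda>t. X (Suc i) t - X i t)"
      using step[OF X X, of "Suc i" i] by (simp add: X_Suc)
    also have "\<dots> \<le> c * (E * c ^ i)"
      using Suc c by (intro mult_left_mono) auto
    finally show ?case by (simp add: ac_simps)
  qed
  have from_start: "pnorm (\<lambda>t. X k t - X 0 t) \<le> B" for k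
  proof (induction k)
    case 0
    then show ?case using E0 c p by (simp add: B_def)
  next
    case (Suc k)
    have "pnorm (\<lambda>t. X (Suc k) t - X 0 t)
        \<le> 2 powr (p - 1) * (pnorm (\<lambda>t. X (Suc k) t - X 1 t) + pnorm (\<lambda>t. X 1 t - X 0 t))"
      by (intro pnorm_triangle X)
    also have "\<dots> \<le> 2 powr (p - 1) * (c * B + E)"
    proof (intro mult_left_mono add_mono)
      have "pnorm (\<lambda>t. X (Suc k) t - X 1 t) \<le> c * pnorm (\<lambda>t. X k t - X 0 t)"
        using step[OF X X, of k 0] by (simp add: X_Suc)
      also have "\<dots> \<le> c * B"
        using Suc c by (intro mult_left_mono) auto
      finally show "pnorm (\<lambda>t. X (Suc k) t - X 1 t) \<le> c * B" .
      show "pnorm (\<lambda>t. X 1 t - X 0 t) \<le> E"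
        using steps[of 0] by simp
    qed simp
    finally show ?case by (simp add: B)
  qed
  have tail: "pnorm (\<lambda>t. X (k + i) t - X i t) \<le> c ^ i * B" for k i
  proof (induction i)
    case 0
    then show ?case using from_start by simp
  next
    case (Suc i)
    have "pnorm (\<lambda>t. X (k + Suc i) t - X (Suc i) t) \<le> c * pnorm (\<lambda>t. X (k + i) t - X i t)"
      using step[OF X X, of "k + i" i] by (simp add: X_Suc)
    also have "\<dots> \<le> c * (c ^ i * B)"
      using Suc c by (intro mult_left_mono) auto
    finally show ?case by (simp add: ac_simps)
  qed
  define x where "x t = lim (\<lambda>i. X i t)" for t
  have lim: "AE t in M. (\<lambda>i. X i t) \<longlonglongrightarrow> x t"
    unfolding x_def using p1(2) c(1,2) Xdiff steps by (rule AE_convergent_of_geometric)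
  have mX: "X i \<in> borel_measurable M" for i
    using X by (rule Lp_measurable)
  have mx: "x \<in> borel_measurable M"
    unfolding x_def using mX by (rule borel_measurable_lim_metric)
  have x_X: "(\<lambda>t. x t - X i t) \<in> Lp_space M p" "pnorm (\<lambda>t. x t - X i t) \<le> c ^ i * B" for i
  proof -
    have l: "AE t in M. (\<lambda>k. X (k + i) t - X i t) \<longlonglongrightarrow> x t - X i t"
      using lim by eventually_elim (rule tendsto_diff[OF LIMSEQ_ignore_initial_segment tendsto_const])
    have m: "(\<lambda>t. x t - X i t) \<in> borel_measurable M"
      using mx mX by (rule borel_measurable_diff)
    show "(\<lambda>t. x t - X i t) \<in> Lp_space M p" "pnorm (\<lambda>t. x t - X i t) \<le> c ^ i * B"
      using Lp_space_AE_limit[OF p1(2) Xdiff tail m l] .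
  qed
  have x: "x \<in> Lp_space M p"
    using Lp_space_add(1)[OF p1(1) x_X(1)[of 0] X[of 0]] by simp
  have bound: "pnorm (\<lambda>t. rhs u x t - x t) \<le> 2 powr (p - 1) * (2 * (c ^ Suc i * B))" for i
  proof -
    have "pnorm (\<lambda>t. rhs u x t - x t)
        \<le> 2 powr (p - 1) * (pnorm (\<lambda>t. rhs u x t - X (Suc i) t) + pnorm (\<lambda>t. X (Suc i) t - x t))"
      by (intro pnorm_triangle T_Lp X x)
    also have "\<dots> \<le> 2 powr (p - 1) * (c ^ Suc i * B + c ^ Suc i * B)"
    proof (intro mult_left_mono add_mono)
      have "pnorm (\<lambda>t. rhs u x t - X (Suc i) t) \<le> c * pnorm (\<lambda>t. x t - X i t)"
        using step[OF x X, of i] by (simp add: X_Suc)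
      also have "\<dots> \<le> c * (c ^ i * B)"
        using x_X(2) c by (intro mult_left_mono) auto
      finally show "pnorm (\<lambda>t. rhs u x t - X (Suc i) t) \<le> c ^ Suc i * B"
        by (simp add: ac_simps)
      show "pnorm (\<lambda>t. X (Suc i) t - x t) \<le> c ^ Suc i * B"
        using x_X(2)[of "Suc i"] by (simp only: pnorm_diff_commute)
    qed simp
    finally show ?thesis by (simp only: mult_2)
  qed
  have "(\<lambda>i. 2 powr (p - 1) * (2 * (c ^ Suc i * B))) \<longlonglongrightarrow> 2 powr (p - 1) * (2 * (0 * B))"
    using c by (intro tendsto_intros LIMSEQ_Suc[OF LIMSEQ_realpow_zero])
  then have "pnorm (\<lambda>t. rhs u x t - x t) \<le> 2 powr (p - 1) * (2 * (0 * B))"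
    by (rule LIMSEQ_le_const) (intro exI allI impI bound)
  then have "pnorm (\<lambda>t. rhs u x t - x t) = 0"
    by (intro antisym) (auto intro: integral_nonneg_AE)
  moreover have "integrable M (\<lambda>t. norm (rhs u x t - x t) powr p)"
    using Lp_space_diff(1)[OF p1(1) T_Lp[OF x] x] by (simp add: Lp_space_def)
  ultimately have "AE t in M. norm (rhs u x t - x t) powr p = 0"
    by (subst (asm) integral_nonneg_eq_0_iff_AE) auto
  then have "AE t in M. x t = rhs u x t"
    by eventually_elim auto
  then have "trajectory \<Omega> p lam f K1 K2 u x"
    using x trajectory_iff[OF uq] by blast
  moreover have "pnorm (\<lambda>t. x t - x0 t) \<le> B"
    using x_X(2)[of 0] by (simp add: X_0)
  ultimately show thesis
    using that by (simp add: B_def c_def E_def)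
qed

section \<open>Trajectories of controls of full norm\<close>

lemma trajectoryD:
  assumes "trajectory \<Omega> p lam f K1 K2 u x" and u: "u \<in> Lp_space M q"
  shows "x \<in> Lp_space M p" "AE t in M. x t = rhs u x t" "rhs u x \<in> Lp_space M p"
proof -
  show x: "x \<in> Lp_space M p" and eq: "AE t in M. x t = rhs u x t"
    using assms by (auto simp: trajectory_iff)
  have "AE t in M. rhs u x t = x t"
    using eq by eventually_elim simp
  then show "rhs u x \<in> Lp_space M p"
    by (rule Lp_space_cong_AE[OF rhs_measurable[OF x u] x])
qed

text \<open>
  On \<open>E\<close> the control is replaced by a constant vector whose length fills up the missing part
  \<open>r powr q - I\<close> of the integral, where \<open>I\<close> is the contribution of the complement of \<open>E\<close>.
\<close>

lemma control_of_full_norm: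
  assumes u: "admissible u" and E: "E \<in> lmeasurable" "E \<subseteq> \<Omega>" "measure lebesgue E > 0"
  obtains v where "v \<in> Lp_space M q" "(\<integral>t. norm (v t) powr q \<partial>M) = r powr q"
    "\<And>s. s \<notin> E \<Longrightarrow> v s = u s"
proof -
  obtain b :: "real ^ 'm" where b: "norm b = 1"
    using norm_Basis nonempty_Basis by blast
  have um: "u \<in> borel_measurable M" and ui: "integrable M (\<lambda>t. norm (u t) powr q)"
    and ur: "(\<integral>t. norm (u t) powr q \<partial>M) \<le> r powr q"
    using u by (auto simp: admissible_def Lp_space_def)
  have EM: "E \<in> sets M"
    using E \<Omega>_sets by (auto simp: sets_restrict_space_iff)
  have mE: "measure M E = measure lebesgue E"
    using E \<Omega>_sets by (simp add: measure_restrict_space)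
  let ?g = "\<lambda>t. indicator (\<Omega> - E) t * norm (u t) powr q"
  have DM: "\<Omega> - E \<in> sets M"
    using sets.compl_sets[OF EM] by simp
  have gi: "integrable M ?g"
    using integrable_mult_indicator[OF DM ui] by simp
  define I where "I = integral\<^sup>L M ?g"
  have "I \<le> (\<integral>t. norm (u t) powr q \<partial>M)"
    unfolding I_def using gi ui by (intro integral_mono) (auto simp: indicator_def)
  then have I: "I \<le> r powr q"
    using ur by simp
  define c where "c = ((r powr q - I) / measure lebesgue E) powr (1 / q)"
  have c0: "c \<ge> 0"
    by (simp add: c_def)
  have cq: "c powr q = (r powr q - I) / measure lebesgue E"
    using I E(3) q by (simp add: c_def powr_powr)
  define v where "v s = (if s \<in> E then c *\<^sub>R b else u s)" for s
  have vm: "v \<in> borel_measurable M"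
    unfolding v_def[abs_def] using um EM by (intro measurable_If_set) auto
  have v_eq: "norm (v t) powr q = ?g t + c powr q * indicator E t" if "t \<in> space M" for t
    using that b c0 by (auto simp: v_def indicator_def)
  have ind: "integrable M (\<lambda>t. c powr q * indicator E t)"
    using EM finite_measure.emeasure_finite[OF finite_M, of E]
    by (intro integrable_mult_right integrable_real_indicator) (auto simp: top.not_eq_extremum)
  have vi: "integrable M (\<lambda>t. norm (v t) powr q)"
    using gi ind by (subst Bochner_Integration.integrable_cong[OF refl v_eq]) auto
  have "(\<integral>t. norm (v t) powr q \<partial>M) = (\<integral>t. ?g t + c powr q * indicator E t \<partial>M)"
    by (rule Bochner_Integration.integral_cong[OF refl v_eq])
  also have "\<dots> = I + (\<integral>t. c powr q * indicator E t \<partial>M)"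
    unfolding I_def using gi ind by (rule Bochner_Integration.integral_add)
  also have "(\<integral>t. c powr q * indicator E t \<partial>M) = c powr q * measure lebesgue E"
    using EM mE E(2) by (simp add: Int_absorb2)
  also have "I + c powr q * measure lebesgue E = r powr q"
    using E(3) by (simp add: cq)
  finally have "(\<integral>t. norm (v t) powr q \<partial>M) = r powr q" .
  moreover have "v \<in> Lp_space M q"
    using vm vi by (simp add: Lp_space_def)
  ultimately show thesis
    using that[of v] by (auto simp: v_def)
qed

text \<open>
  The difference of the two controls vanishes off \<open>E\<close> and has norm at most \<open>2 * r\<close>, so by the Hoelder inequality
  only the \<open>p\<close>-th power of \<open>K2\<close> along \<open>x\<close>, integrated over \<open>E\<close>, matters. Both integrals in the bound tend to zero
  when \<open>E\<close> shrinks to a null set.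
\<close>

lemma rhs_perturbation_on_set:
  assumes x: "x \<in> Lp_space M p" and u: "admissible u" and v: "admissible v"
    and E: "E \<in> sets lebesgue" and uv: "\<And>s. s \<notin> E \<Longrightarrow> v s = u s"
  shows "(\<lambda>t. rhs v x t - rhs u x t) \<in> Lp_space M p"
    "pnorm (\<lambda>t. rhs v x t - rhs u x t) \<le> lam powr p * (2 * r) powr p * 2 powr (p - 1) *
      ((\<integral>z. indicator E (snd z) * norm (K2 (fst z) (snd z) 0) powr p \<partial>lebesgue_on (\<Omega> \<times> \<Omega>))
        + \<kappa>2 powr p * measure lebesgue \<Omega> * (\<integral>s. indicator E s * norm (x s) powr p \<partial>M))"
proof -
  have uq: "u \<in> Lp_space M q" and vq: "v \<in> Lp_space M q"
    using u v by (auto dest: admissibleD)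
  have ind_m: "(\<lambda>s. indicator E s :: real) \<in> borel_measurable M"
    using E by (intro measurable_restrict_space1 borel_measurable_indicator)
  define w where "w s = v s - u s" for s
  have w: "w \<in> Lp_space M q"
    unfolding w_def using q vq uq by (intro Lp_space_diff) auto
  have w0: "w s = 0" if "s \<notin> E" for s
    using uv[OF that] by (simp add: w_def)
  have wn: "(\<integral>s. norm (w s) powr q \<partial>M) powr (1 / q) \<le> 2 * r"
  proof -
    have "(\<integral>s. norm (w s) powr q \<partial>M)
        \<le> 2 powr (q - 1) * ((\<integral>s. norm (v s) powr q \<partial>M) + (\<integral>s. norm (u s) powr q \<partial>M))"
      unfolding w_def using q vq uq by (intro Lp_space_diff) auto
    also have "\<dots> \<le> 2 powr (q - 1) * (r powr q + r powr q)"
      using u v by (intro mult_left_mono add_mono) (auto simp: admissible_def)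
    also have "\<dots> = (2 * r) powr q"
      using r by (simp add: powr_diff powr_mult)
    finally have "(\<integral>s. norm (w s) powr q \<partial>M) powr (1 / q) \<le> ((2 * r) powr q) powr (1 / q)"
      using q by (intro powr_mono2) (auto intro: integral_nonneg_AE)
    then show ?thesis
      using q r by (simp add: powr_powr)
  qed
  let ?H = "\<lambda>z. indicator E (snd z) * norm (K2 (fst z) (snd z) 0) powr p"
  have ix: "integrable M (\<lambda>s. indicator E s * norm (x s) powr p)"
  proof (rule Bochner_Integration.integrable_bound)
    show "integrable M (\<lambda>s. norm (x s) powr p)"
      using x by (simp add: Lp_space_def)
    show "(\<lambda>s. indicator E s * norm (x s) powr p) \<in> borel_measurable M"
      using ind_m Lp_measurable[OF x] by measurable
  qed (auto simp: indicator_def)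
  have iH: "integrable (lebesgue_on (\<Omega> \<times> \<Omega>)) ?H"
  proof (rule Bochner_Integration.integrable_bound)
    show K: "integrable (lebesgue_on (\<Omega> \<times> \<Omega>)) (\<lambda>z. norm (K2 (fst z) (snd z) 0) powr p)"
      using K2_zero by (simp add: Lp_space_def case_prod_beta')
    show "?H \<in> borel_measurable (lebesgue_on (\<Omega> \<times> \<Omega>))"
      using measurable_lebesgue_on_snd[OF \<Omega>_sets ind_m] borel_measurable_integrable[OF K]
      by (rule borel_measurable_times)
  qed (auto simp: indicator_def)
  note FubH = Fubini_lebesgue_on_Times[OF \<Omega>_sets \<Omega>_sets iH]
  let ?c = "lam powr p * (2 * r) powr p * 2 powr (p - 1)"
  let ?X = "\<integral>s. indicator E s * norm (x s) powr p \<partial>M"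
  let ?\<phi> = "\<lambda>\<xi>. ?c * ((\<integral>s. ?H (\<xi>, s) \<partial>M) + \<kappa>2 powr p * ?X)"
  have const: "integrable M (\<lambda>_. c :: real)" for c
    using finite_M by (rule finite_measure.integrable_const)
  have i: "integrable M ?\<phi>"
    using FubH(2) const by (intro integrable_mult_right Bochner_Integration.integrable_add)
  have m: "(\<lambda>t. rhs v x t - rhs u x t) \<in> borel_measurable M"
    using rhs_measurable[OF x vq] rhs_measurable[OF x uq] by (rule borel_measurable_diff)
  have b: "AE \<xi> in M. norm (rhs v x \<xi> - rhs u x \<xi>) powr p \<le> ?\<phi> \<xi>"
    using AE_rhs_diff_control[OF x vq uq] AE_K2_section_Lp[OF x] FubH(1)
  proof eventually_elim
    fix \<xi>
    assume d: "norm (rhs v x \<xi> - rhs u x \<xi>) \<le> lam * (\<integral>s. norm (K2 \<xi> s (x s)) * norm (v s - u s) \<partial>M)"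
      and K: "(\<lambda>s. K2 \<xi> s (x s)) \<in> Lp_space M p \<and> (AE s in M. norm (K2 \<xi> s (x s)) powr p
        \<le> 2 powr (p - 1) * (norm (K2 \<xi> s 0) powr p + \<kappa>2 powr p * norm (x s) powr p))"
      and H: "integrable M (\<lambda>s. ?H (\<xi>, s))"
    let ?K = "\<lambda>s. indicator E s *\<^sub>R K2 \<xi> s (x s)"
    let ?\<psi> = "\<lambda>s. 2 powr (p - 1) * (?H (\<xi>, s) + \<kappa>2 powr p * (indicator E s * norm (x s) powr p))"
    have Km: "?K \<in> borel_measurable M"
      using ind_m Lp_measurable[OF conjunct1[OF K]] by (rule borel_measurable_scaleR)
    have \<psi>: "integrable M ?\<psi>"
      using H ix by simp
    have Kb: "AE s in M. norm (?K s) powr p \<le> ?\<psi> s"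
      using conjunct2[OF K] by eventually_elim (auto simp: indicator_def)
    have K_Lp: "?K \<in> Lp_space M p" and K_int: "(\<integral>s. norm (?K s) powr p \<partial>M) \<le> integral\<^sup>L M ?\<psi>"
      using Lp_space_dominated[OF Km Kb \<psi>] by auto
    have "(\<integral>s. norm (K2 \<xi> s (x s)) * norm (v s - u s) \<partial>M) = (\<integral>s. norm (?K s) * norm (w s) \<partial>M)"
      by (intro Bochner_Integration.integral_cong refl) (auto simp: indicator_def w0 simp flip: w_def)
    also have "\<dots> \<le> (\<integral>s. norm (?K s) powr p \<partial>M) powr (1 / p) * (\<integral>s. norm (w s) powr q \<partial>M) powr (1 / q)"
      using p q pq K_Lp w by (rule Holder_inequality(2))
    also have "\<dots> \<le> (\<integral>s. norm (?K s) powr p \<partial>M) powr (1 / p) * (2 * r)"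
      using wn by (intro mult_left_mono) auto
    finally have "norm (rhs v x \<xi> - rhs u x \<xi>)
        \<le> lam * ((\<integral>s. norm (?K s) powr p \<partial>M) powr (1 / p) * (2 * r))"
      using d lam by (meson mult_left_mono order_trans)
    then have "norm (rhs v x \<xi> - rhs u x \<xi>) powr p
        \<le> (lam * ((\<integral>s. norm (?K s) powr p \<partial>M) powr (1 / p) * (2 * r))) powr p"
      using p by (intro powr_mono2) auto
    also have "\<dots> = lam powr p * (2 * r) powr p * (\<integral>s. norm (?K s) powr p \<partial>M)"
    proof -
      have "((\<integral>s. norm (?K s) powr p \<partial>M) powr (1 / p)) powr p = (\<integral>s. norm (?K s) powr p \<partial>M)"
        using p by (simp add: powr_powr integral_nonneg_AE)
      then show ?thesis
        using lam r by (simp only: powr_mult mult.assoc mult.left_commute mult.commute)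
    qed
    also have "\<dots> \<le> lam powr p * (2 * r) powr p * integral\<^sup>L M ?\<psi>"
      using K_int by (intro mult_left_mono) auto
    also have "integral\<^sup>L M ?\<psi> = 2 powr (p - 1) * ((\<integral>s. ?H (\<xi>, s) \<partial>M) + \<kappa>2 powr p * ?X)"
      using H ix by simp
    finally show "norm (rhs v x \<xi> - rhs u x \<xi>) powr p \<le> ?\<phi> \<xi>"
      by (simp only: mult.assoc)
  qed
  show "(\<lambda>t. rhs v x t - rhs u x t) \<in> Lp_space M p"
    using m b i by (rule Lp_space_dominated(1))
  have "pnorm (\<lambda>t. rhs v x t - rhs u x t) \<le> integral\<^sup>L M ?\<phi>"
    using m b i by (rule Lp_space_dominated(2))
  also have "\<dots> = ?c * ((\<integral>\<xi>. (\<integral>s. ?H (\<xi>, s) \<partial>M) \<partial>M) + (\<integral>\<xi>. \<kappa>2 powr p * ?X \<partial>M))"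
    using FubH(2) const by (simp only: integral_mult_right_zero Bochner_Integration.integral_add)
  also have "(\<integral>\<xi>. \<kappa>2 powr p * ?X \<partial>M) = \<kappa>2 powr p * measure lebesgue \<Omega> * ?X"
    using \<Omega>_sets by (simp add: measure_restrict_space)
  also have "(\<integral>\<xi>. (\<integral>s. ?H (\<xi>, s) \<partial>M) \<partial>M) = integral\<^sup>L (lebesgue_on (\<Omega> \<times> \<Omega>)) ?H"
    by (rule FubH(3))
  finally show "pnorm (\<lambda>t. rhs v x t - rhs u x t) \<le> lam powr p * (2 * r) powr p * 2 powr (p - 1) *
      ((\<integral>z. indicator E (snd z) * norm (K2 (fst z) (snd z) 0) powr p \<partial>lebesgue_on (\<Omega> \<times> \<Omega>))
        + \<kappa>2 powr p * measure lebesgue \<Omega> * (\<integral>s. indicator E s * norm (x s) powr p \<partial>M))" .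
qed

lemma ball_subset_closure_sphere:
  assumes pos: "measure lebesgue \<Omega> > 0"
  shows "trajectories_ball \<Omega> p q r lam f K1 K2
    \<subseteq> Lp_closure M p (trajectories_sphere \<Omega> p q r lam f K1 K2)"
proof
  fix x assume "x \<in> trajectories_ball \<Omega> p q r lam f K1 K2"
  then obtain u where uq: "u \<in> Lp_space M q" and "Lp_norm M q u \<le> r"
    and traj: "trajectory \<Omega> p lam f K1 K2 u x"
    by (auto simp: trajectories_ball_def)
  then have u: "admissible u"
    using q r by (simp add: admissible_def Lp_norm_le_iff)
  note x = trajectoryD(1)[OF traj uq] and x_eq = trajectoryD(2)[OF traj uq]
    and Tx = trajectoryD(3)[OF traj uq]
  have p1: "p \<ge> 1" "p > 0"
    using p by auto
  obtain E where E: "\<And>j. E j \<in> lmeasurable" "\<And>j. E j \<subseteq> \<Omega>" "\<And>j. measure lebesgue (E j) > 0"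
    and E0: "AE s in M. (\<lambda>j. indicator (E j) s :: real) \<longlonglongrightarrow> 0"
    using shrinking_nonnegligible_subsets[OF \<Omega> pos] by blast
  define \<beta> where "\<beta> j = lam powr p * (2 * r) powr p * 2 powr (p - 1) *
      ((\<integral>z. indicator (E j) (snd z) * norm (K2 (fst z) (snd z) 0) powr p \<partial>lebesgue_on (\<Omega> \<times> \<Omega>))
        + \<kappa>2 powr p * measure lebesgue \<Omega> * (\<integral>s. indicator (E j) s * norm (x s) powr p \<partial>M))" for j
  have ind_m: "(\<lambda>s. indicator (E j) s :: real) \<in> borel_measurable M" for j
    using E(1) by (intro measurable_restrict_space1 borel_measurable_indicator fmeasurableD)
  have lim_x: "(\<lambda>j. \<integral>s. indicator (E j) s * norm (x s) powr p \<partial>M) \<longlonglongrightarrow> (\<integral>s. 0 \<partial>M)"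
  proof (rule integral_dominated_convergence)
    show int: "integrable M (\<lambda>s. norm (x s) powr p)"
      using x by (simp add: Lp_space_def)
    show "(\<lambda>s. indicator (E j) s * norm (x s) powr p) \<in> borel_measurable M" for j
      using ind_m borel_measurable_integrable[OF int] by (rule borel_measurable_times)
    show "AE s in M. (\<lambda>j. indicator (E j) s * norm (x s) powr p) \<longlonglongrightarrow> 0"
      using E0 by eventually_elim (auto intro: tendsto_mult_left_zero)
  qed (auto simp: indicator_def)
  have lim_K: "(\<lambda>j. \<integral>z. indicator (E j) (snd z) * norm (K2 (fst z) (snd z) 0) powr p \<partial>lebesgue_on (\<Omega> \<times> \<Omega>))
      \<longlonglongrightarrow> (\<integral>z. 0 \<partial>lebesgue_on (\<Omega> \<times> \<Omega>))"
  proof (rule integral_dominated_convergence)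
    show int: "integrable (lebesgue_on (\<Omega> \<times> \<Omega>)) (\<lambda>z. norm (K2 (fst z) (snd z) 0) powr p)"
      using K2_zero by (simp add: Lp_space_def case_prod_beta')
    show "(\<lambda>z. indicator (E j) (snd z) * norm (K2 (fst z) (snd z) 0) powr p)
        \<in> borel_measurable (lebesgue_on (\<Omega> \<times> \<Omega>))" for j
      using measurable_lebesgue_on_snd[OF \<Omega>_sets ind_m] borel_measurable_integrable[OF int]
      by (rule borel_measurable_times)
    have "AE z in lebesgue_on (\<Omega> \<times> \<Omega>). (\<lambda>j. indicator (E j) (snd z) :: real) \<longlonglongrightarrow> 0"
      using \<Omega>_sets \<Omega>_sets E0 by (rule AE_lebesgue_on_snd)
    then show "AE z in lebesgue_on (\<Omega> \<times> \<Omega>).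
        (\<lambda>j. indicator (E j) (snd z) * norm (K2 (fst z) (snd z) 0) powr p) \<longlonglongrightarrow> 0"
      by eventually_elim (auto intro: tendsto_mult_left_zero)
  qed (auto simp: indicator_def)
  have "\<beta> \<longlonglongrightarrow> lam powr p * (2 * r) powr p * 2 powr (p - 1) *
      ((\<integral>z. 0 \<partial>lebesgue_on (\<Omega> \<times> \<Omega>)) + \<kappa>2 powr p * measure lebesgue \<Omega> * (\<integral>s. 0 \<partial>M))"
    unfolding \<beta>_def[abs_def] by (intro tendsto_intros lim_x lim_K)
  then have \<beta>: "\<beta> \<longlonglongrightarrow> 0"
    by simp
  define C where "C = 2 powr (p - 1) / (1 - 2 powr (p - 1) * (3 powr (p - 1) * \<Lambda>))"
  have C: "C \<ge> 0"
    using \<Lambda>_bounds by (simp add: C_def)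
  have "\<exists>y\<in>trajectories_sphere \<Omega> p q r lam f K1 K2. Lp_norm M p (\<lambda>t. x t - y t) < e" if e: "e > 0" for e
  proof -
    have "(\<lambda>j. C * \<beta> j) \<longlonglongrightarrow> C * 0"
      using \<beta> by (intro tendsto_intros)
    then have "eventually (\<lambda>j. C * \<beta> j < e powr p) sequentially"
      using e by (intro order_tendstoD) auto
    then obtain j where j: "C * \<beta> j < e powr p"
      by (auto simp: eventually_sequentially)
    obtain v where vq: "v \<in> Lp_space M q" and vr: "(\<integral>t. norm (v t) powr q \<partial>M) = r powr q"
      and vu: "\<And>s. s \<notin> E j \<Longrightarrow> v s = u s"
      using control_of_full_norm[OF u E(1) E(2) E(3)] by blast
    have v: "admissible v"
      using vq vr by (simp add: admissible_def)
    have pert: "(\<lambda>t. rhs v x t - rhs u x t) \<in> Lp_space M p" "pnorm (\<lambda>t. rhs v x t - rhs u x t) \<le> \<beta> j"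
      using rhs_perturbation_on_set[OF x u v fmeasurableD[OF E(1)[of j]] vu] by (auto simp: \<beta>_def)
    have Tv: "rhs v x \<in> Lp_space M p"
      using Lp_space_add(1)[OF p1(1) pert(1) Tx] by simp
    have "pnorm (\<lambda>t. rhs v x t - x t) = pnorm (\<lambda>t. rhs v x t - rhs u x t)"
    proof (rule integral_cong_AE)
      show "(\<lambda>t. norm (rhs v x t - x t) powr p) \<in> borel_measurable M"
        using Lp_space_diff(1)[OF p1(1) Tv x] by (simp add: Lp_space_def borel_measurable_integrable)
      show "(\<lambda>t. norm (rhs v x t - rhs u x t) powr p) \<in> borel_measurable M"
        using pert(1) by (simp add: Lp_space_def borel_measurable_integrable)
      show "AE t in M. norm (rhs v x t - x t) powr p = norm (rhs v x t - rhs u x t) powr p"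
        using x_eq by eventually_elim simp
    qed
    then have le: "pnorm (\<lambda>t. rhs v x t - x t) \<le> \<beta> j"
      using pert(2) by simp
    obtain y where y: "trajectory \<Omega> p lam f K1 K2 v y"
      and yx: "pnorm (\<lambda>t. y t - x t) \<le> 2 powr (p - 1) * pnorm (\<lambda>t. rhs v x t - x t)
        / (1 - 2 powr (p - 1) * (3 powr (p - 1) * \<Lambda>))"
      using trajectory_near_approximate_solution[OF v x Tv] by blast
    have "pnorm (\<lambda>t. y t - x t) \<le> C * pnorm (\<lambda>t. rhs v x t - x t)"
      using yx by (simp add: C_def)
    also have "\<dots> \<le> C * \<beta> j"
      using le C by (rule mult_left_mono)
    also note j
    finally have "pnorm (\<lambda>t. x t - y t) < e powr p"
      by (subst pnorm_diff_commute)
    then have "Lp_norm M p (\<lambda>t. x t - y t) < e"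
      using p1 e by (simp add: Lp_norm_less_iff)
    moreover have "y \<in> trajectories_sphere \<Omega> p q r lam f K1 K2"
      using y vq vr q r by (auto simp: trajectories_sphere_def Lp_norm_eq_iff)
    ultimately show ?thesis
      by blast
  qed
  then show "x \<in> Lp_closure M p (trajectories_sphere \<Omega> p q r lam f K1 K2)"
    using x by (simp add: Lp_closure_def)
qed

section \<open>Closedness of the set of trajectories\<close>

text \<open>
  At a fixed \<open>\<xi>\<close> the right-hand side is affine in the control, hence the residual of the equation at a midpoint
  is the mean of the two residuals.
\<close>

lemma midpoint_hull_residual_le:
  assumes K1: "integrable M (\<lambda>s. K1 \<xi> s (x s))" and K2: "(\<lambda>s. K2 \<xi> s (x s)) \<in> Lp_space M p"
    and S: "\<And>u. u \<in> S \<Longrightarrow> u \<in> Lp_space M q \<and> norm (x \<xi> - rhs u x \<xi>) \<le> e"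
    and v: "v \<in> midpoint_hull S"
  shows "v \<in> Lp_space M q \<and> norm (x \<xi> - rhs v x \<xi>) \<le> e"
  using v
proof induction
  case (midpoint a b)
  let ?m = "\<lambda>t. (1/2) *\<^sub>R (a t + b t)"
  have ab: "a \<in> Lp_space M q" "b \<in> Lp_space M q"
    using midpoint.IH by auto
  have m: "?m \<in> Lp_space M q"
  proof -
    have "?m \<in> midpoint_hull {a, b}"
      by (intro midpoint_hull.midpoint midpoint_hull.base) auto
    moreover have "u \<in> Lp_space M q \<and> (\<integral>t. norm (u t) powr q \<partial>M)
        \<le> max (\<integral>t. norm (a t) powr q \<partial>M) (\<integral>t. norm (b t) powr q \<partial>M)" if "u \<in> {a, b}" for u
      using that ab by auto
    ultimately show ?thesis
      using midpoint_hull_Lp_ball[where S = "{a, b}" and M = M and q = q] q less_imp_le by blast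
  qed
  note int = integrable_matrix_control(1)[OF K2]
  have split: "(\<integral>s. K1 \<xi> s (x s) + K2 \<xi> s (x s) *v u s \<partial>M)
      = (\<integral>s. K1 \<xi> s (x s) \<partial>M) + (\<integral>s. K2 \<xi> s (x s) *v u s \<partial>M)" if "u \<in> Lp_space M q" for u
    using K1 int[OF that] by (rule Bochner_Integration.integral_add)
  have "(\<integral>s. K2 \<xi> s (x s) *v ?m s \<partial>M)
      = (\<integral>s. (1/2) *\<^sub>R (K2 \<xi> s (x s) *v a s + K2 \<xi> s (x s) *v b s) \<partial>M)"
    by (intro Bochner_Integration.integral_cong refl)
      (simp add: matrix_vector_mult_scaleR matrix_vector_right_distrib)
  also have "\<dots> = (1/2) *\<^sub>R ((\<integral>s. K2 \<xi> s (x s) *v a s \<partial>M) + (\<integral>s. K2 \<xi> s (x s) *v b s \<partial>M))"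
    using int[OF ab(1)] int[OF ab(2)] by simp
  finally have avg: "(\<integral>s. K2 \<xi> s (x s) *v ?m s \<partial>M)
      = (1/2) *\<^sub>R ((\<integral>s. K2 \<xi> s (x s) *v a s \<partial>M) + (\<integral>s. K2 \<xi> s (x s) *v b s \<partial>M))" .
  have affine: "X - (F + lam *\<^sub>R (K + (1/2) *\<^sub>R (A + B)))
      = (1/2) *\<^sub>R ((X - (F + lam *\<^sub>R (K + A))) + (X - (F + lam *\<^sub>R (K + B))))"
    for X F K A B :: "real ^ 'n"
    by (simp add: vec_eq_iff field_simps)
  have "x \<xi> - rhs ?m x \<xi> = (1/2) *\<^sub>R ((x \<xi> - rhs a x \<xi>) + (x \<xi> - rhs b x \<xi>))"
    unfolding rhs_def split[OF ab(1)] split[OF ab(2)] split[OF m] avg by (rule affine)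
  then have "norm (x \<xi> - rhs ?m x \<xi>) \<le> (1/2) * (norm (x \<xi> - rhs a x \<xi>) + norm (x \<xi> - rhs b x \<xi>))"
    using norm_triangle_ineq[of "x \<xi> - rhs a x \<xi>" "x \<xi> - rhs b x \<xi>"] by (simp only: norm_scaleR) simp
  then show ?case
    using m midpoint.IH by simp
qed (use S in auto)

lemma closure_sphere_subset_ball:
  "Lp_closure M p (trajectories_sphere \<Omega> p q r lam f K1 K2)
    \<subseteq> trajectories_ball \<Omega> p q r lam f K1 K2"
proof
  fix x assume cl: "x \<in> Lp_closure M p (trajectories_sphere \<Omega> p q r lam f K1 K2)"
  then have x: "x \<in> Lp_space M p"
    by (simp add: Lp_closure_def)
  have p1: "p \<ge> 1" "p > 0" and q1: "q \<ge> 1" "q > 0"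
    using p q by auto
  have "\<exists>y u. admissible u \<and> trajectory \<Omega> p lam f K1 K2 u y \<and> pnorm (\<lambda>t. x t - y t) < (1/2) ^ i" for i :: nat
  proof -
    \<comment> \<open>The geometric rate of approximation makes the residuals converge almost everywhere.\<close>
    have "((1/2) ^ i :: real) powr (1 / p) > 0"
      by simp
    then obtain y where "y \<in> trajectories_sphere \<Omega> p q r lam f K1 K2"
      and y: "Lp_norm M p (\<lambda>t. x t - y t) < ((1/2) ^ i) powr (1 / p)"
      using cl unfolding Lp_closure_def by blast
    then obtain u where u: "u \<in> Lp_space M q" "Lp_norm M q u = r" "trajectory \<Omega> p lam f K1 K2 u y"
      by (auto simp: trajectories_sphere_def)
    have "(\<integral>t. norm (u t) powr q \<partial>M) = r powr q"
      using u(2) q1(2) r Lp_norm_eq_iff[of q r M u] by simp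
    then have "admissible u"
      using u(1) by (simp add: admissible_def)
    moreover have "pnorm (\<lambda>t. x t - y t) < (1/2) ^ i"
      using y p1 by (simp add: Lp_norm_less_iff powr_powr)
    ultimately show ?thesis
      using u(3) by blast
  qed
  then have "\<forall>i. \<exists>y u. admissible u \<and> trajectory \<Omega> p lam f K1 K2 u y \<and> pnorm (\<lambda>t. x t - y t) < (1/2) ^ i"
    by (rule allI)
  from choice[OF this] obtain y where "\<forall>i. \<exists>u. admissible u \<and> trajectory \<Omega> p lam f K1 K2 u (y i)
      \<and> pnorm (\<lambda>t. x t - y i t) < (1/2) ^ i" ..
  from choice[OF this] obtain u where "\<forall>i. admissible (u i) \<and> trajectory \<Omega> p lam f K1 K2 (u i) (y i)
      \<and> pnorm (\<lambda>t. x t - y i t) < (1/2) ^ i" ..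
  then have u: "\<And>i. admissible (u i)"
    and traj: "\<And>i. trajectory \<Omega> p lam f K1 K2 (u i) (y i)"
    and xy: "\<And>i. pnorm (\<lambda>t. x t - y i t) < (1/2) ^ i"
    by auto
  have uq: "u i \<in> Lp_space M q" and uR: "(\<integral>t. norm (u i t) powr q \<partial>M) \<le> r powr q" for i
    using u[of i] by (auto simp: admissible_def)
  note y = trajectoryD(1)[OF traj uq] and y_eq = trajectoryD(2)[OF traj uq]
    and Ty = trajectoryD(3)[OF traj uq]
  have Tx: "rhs (u i) x \<in> Lp_space M p" for i
    using Lp_space_add(1)[OF p1(1) rhs_contraction(1)[OF x y[of i] u[of i]] Ty[of i]] by simp
  have res_Lp: "(\<lambda>t. x t - rhs (u i) x t) \<in> Lp_space M p" for i
    using p1(1) x Tx by (rule Lp_space_diff)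
  have res: "pnorm (\<lambda>t. x t - rhs (u i) x t) \<le> 2 powr p * (1/2) ^ i" for i
  proof -
    have "pnorm (\<lambda>t. y i t - rhs (u i) x t) = pnorm (\<lambda>t. rhs (u i) (y i) t - rhs (u i) x t)"
    proof (rule integral_cong_AE)
      show "(\<lambda>t. norm (y i t - rhs (u i) x t) powr p) \<in> borel_measurable M"
        using Lp_space_diff(1)[OF p1(1) y[of i] Tx[of i]]
        by (simp add: Lp_space_def borel_measurable_integrable)
      show "(\<lambda>t. norm (rhs (u i) (y i) t - rhs (u i) x t) powr p) \<in> borel_measurable M"
        using Lp_space_diff(1)[OF p1(1) Ty[of i] Tx[of i]]
        by (simp add: Lp_space_def borel_measurable_integrable)
      show "AE t in M. norm (y i t - rhs (u i) x t) powr p = norm (rhs (u i) (y i) t - rhs (u i) x t) powr p"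
        using y_eq[of i] by eventually_elim simp
    qed
    also have "\<dots> \<le> 3 powr (p - 1) * \<Lambda> * pnorm (\<lambda>t. y i t - x t)"
      using y x u by (rule rhs_contraction(2))
    also have "\<dots> \<le> 1 * pnorm (\<lambda>t. y i t - x t)"
      using \<Lambda>_bounds by (intro mult_right_mono) (auto intro: integral_nonneg_AE)
    also have "1 * pnorm (\<lambda>t. y i t - x t) = pnorm (\<lambda>t. x t - y i t)"
      by (simp add: norm_minus_commute)
    finally have "pnorm (\<lambda>t. y i t - rhs (u i) x t) \<le> (1/2) ^ i"
      using xy[of i] by linarith
    then have "2 powr (p - 1) * (pnorm (\<lambda>t. x t - y i t) + pnorm (\<lambda>t. y i t - rhs (u i) x t))
        \<le> 2 powr (p - 1) * ((1/2) ^ i + (1/2) ^ i)"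
      using less_imp_le[OF xy[of i]] by (intro mult_left_mono add_mono) auto
    also have "\<dots> = 2 powr p * (1/2) ^ i"
      by (simp add: powr_diff)
    finally show ?thesis
      using pnorm_triangle[OF x y[of i] Tx[of i]] by linarith
  qed
  have "AE t in M. summable (\<lambda>i. norm (x t - rhs (u i) x t))"
    using p1(2) _ _ res_Lp res by (rule AE_summable_of_geometric) auto
  then have residual: "AE t in M. (\<lambda>i. x t - rhs (u i) x t) \<longlonglongrightarrow> 0"
    by eventually_elim (auto dest: summable_LIMSEQ_zero intro: tendsto_norm_zero_cancel)
  obtain v w where v': "\<forall>j. v j \<in> midpoint_hull (u ` {j..})"
    and wm: "w \<in> borel_measurable M" and vw: "AE t in M. (\<lambda>j. v j t) \<longlonglongrightarrow> w t"
    by (rule midpoint_hull_AE_convergent[where u = u, OF finite_M q1(1) uq uR])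
  note v = v'[rule_format]
  have v_ball: "v j \<in> Lp_space M q" "(\<integral>t. norm (v j t) powr q \<partial>M) \<le> r powr q" for j
    using midpoint_hull_Lp_ball[OF q1(1) _ v, of j M "r powr q"] uq uR by auto
  have wq: "w \<in> Lp_space M q" and wR: "(\<integral>t. norm (w t) powr q \<partial>M) \<le> r powr q"
    using Lp_space_AE_limit[OF q1(2) v_ball wm vw] by auto
  have "AE \<xi> in M. \<forall>j. norm (rhs (v j) x \<xi> - rhs w x \<xi>)
      \<le> lam * (\<integral>s. norm (K2 \<xi> s (x s)) * norm (v j s - w s) \<partial>M)"
    unfolding AE_all_countable by (intro allI AE_rhs_diff_control[OF x v_ball(1) wq])
  then have "AE \<xi> in M. x \<xi> = rhs w x \<xi>"
    using residual AE_K1_section_integrable[OF x] AE_K2_section_Lp[OF x]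
  proof eventually_elim
    fix \<xi>
    assume d: "\<forall>j. norm (rhs (v j) x \<xi> - rhs w x \<xi>)
        \<le> lam * (\<integral>s. norm (K2 \<xi> s (x s)) * norm (v j s - w s) \<partial>M)"
      and res0: "(\<lambda>i. x \<xi> - rhs (u i) x \<xi>) \<longlonglongrightarrow> 0"
      and K1: "integrable M (\<lambda>s. K1 \<xi> s (x s))"
      and K2: "(\<lambda>s. K2 \<xi> s (x s)) \<in> Lp_space M p \<and> (AE s in M. norm (K2 \<xi> s (x s)) powr p
        \<le> 2 powr (p - 1) * (norm (K2 \<xi> s 0) powr p + \<kappa>2 powr p * norm (x s) powr p))"
    have "(\<lambda>j. lam * (\<integral>s. norm (K2 \<xi> s (x s)) * norm (v j s - w s) \<partial>M)) \<longlonglongrightarrow> lam * 0"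
      by (intro tendsto_intros tendsto_integral_of_AE_bounded[OF p q pq conjunct1[OF K2] v_ball(1) wq v_ball(2) vw])
    then have lim0: "(\<lambda>j. lam * (\<integral>s. norm (K2 \<xi> s (x s)) * norm (v j s - w s) \<partial>M)) \<longlonglongrightarrow> 0"
      by (simp only: mult_zero_right)
    have "(\<lambda>j. rhs (v j) x \<xi> - rhs w x \<xi>) \<longlonglongrightarrow> 0"
      by (rule Lim_null_comparison[OF always_eventually[OF d] lim0])
    moreover have "(\<lambda>j. x \<xi> - rhs (v j) x \<xi>) \<longlonglongrightarrow> 0"
    proof (rule LIMSEQ_I)
      fix e :: real assume "e > 0"
      then obtain j0 where j0: "\<And>i. i \<ge> j0 \<Longrightarrow> norm (x \<xi> - rhs (u i) x \<xi>) < e / 2"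
        using LIMSEQ_D[OF res0, of "e / 2"] by auto
      have "norm (x \<xi> - rhs (v j) x \<xi>) \<le> e / 2" if "j \<ge> j0" for j
      proof (rule conjunct2[OF midpoint_hull_residual_le[OF K1 conjunct1[OF K2] _ v]])
        fix a assume "a \<in> u ` {j..}"
        then obtain i where "i \<ge> j" "a = u i"
          by auto
        then show "a \<in> Lp_space M q \<and> norm (x \<xi> - rhs a x \<xi>) \<le> e / 2"
          using uq[of i] j0[of i] that by simp
      qed
      then have "norm (x \<xi> - rhs (v j) x \<xi> - 0) < e" if "j \<ge> j0" for j
        using that \<open>e > 0\<close> by (simp add: order_le_less_trans[of _ "e / 2"])
      then show "\<exists>j0. \<forall>j\<ge>j0. norm (x \<xi> - rhs (v j) x \<xi> - 0) < e"
        by blast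
    qed
    ultimately have "(\<lambda>j. (x \<xi> - rhs (v j) x \<xi>) + (rhs (v j) x \<xi> - rhs w x \<xi>)) \<longlonglongrightarrow> 0 + 0"
      by (intro tendsto_add)
    then have "(\<lambda>j::nat. x \<xi> - rhs w x \<xi>) \<longlonglongrightarrow> 0"
      by simp
    then show "x \<xi> = rhs w x \<xi>"
      by (simp add: LIMSEQ_const_iff)
  qed
  then have "trajectory \<Omega> p lam f K1 K2 w x"
    using x trajectory_iff[OF wq] by blast
  then show "x \<in> trajectories_ball \<Omega> p q r lam f K1 K2"
    using wq wR q1 r by (auto simp: trajectories_ball_def Lp_norm_le_iff)
qed

end

theorem theorem3p2:
  fixes \<Omega> :: "(real ^ 'k) set"
    and p q r lam \<kappa>0 \<kappa>1 \<kappa>2 :: real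
    and f :: "real ^ 'k \<Rightarrow> real ^ 'n \<Rightarrow> real ^ 'n"
    and K1 :: "real ^ 'k \<Rightarrow> real ^ 'k \<Rightarrow> real ^ 'n \<Rightarrow> real ^ 'n"
    and K2 :: "real ^ 'k \<Rightarrow> real ^ 'k \<Rightarrow> real ^ 'n \<Rightarrow> real ^ 'm ^ 'n"
    and \<gamma>0 :: "real ^ 'k \<Rightarrow> real"
    and \<gamma>1 \<gamma>2 :: "real ^ 'k \<Rightarrow> real ^ 'k \<Rightarrow> real"
  assumes "compact \<Omega>" and "measure lebesgue \<Omega> > 0"
    and "lam \<ge> 0" and "r > 0"
    and "q > 1" and "p > 1" and "1 / p + 1 / q = 1"
    and A_meas: "\<And>x. (\<lambda>\<xi>. f \<xi> x) \<in> borel_measurable (lebesgue_on \<Omega>)"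
    and A_zero: "(\<lambda>\<xi>. f \<xi> 0) \<in> Lp_space (lebesgue_on \<Omega>) p"
    and A_nonneg: "\<And>\<xi>. \<xi> \<in> \<Omega> \<Longrightarrow> \<gamma>0 \<xi> \<ge> 0"
    and A_Linf: "\<gamma>0 \<in> Linf_space (lebesgue_on \<Omega>)"
    and A_lipschitz: "AE \<xi> in lebesgue_on \<Omega>.
      \<forall>x1 x2. norm (f \<xi> x1 - f \<xi> x2) \<le> \<gamma>0 \<xi> * norm (x1 - x2)"
    and B_meas: "\<And>x. (\<lambda>(\<xi>, s). K1 \<xi> s x) \<in> borel_measurable (lebesgue_on (\<Omega> \<times> \<Omega>))"
    and B_zero: "(\<lambda>(\<xi>, s). K1 \<xi> s 0) \<in> Lp_space (lebesgue_on (\<Omega> \<times> \<Omega>)) p"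
    and B_nonneg: "\<And>\<xi> s. \<xi> \<in> \<Omega> \<Longrightarrow> s \<in> \<Omega> \<Longrightarrow> \<gamma>1 \<xi> s \<ge> 0"
    and B_inner: "AE \<xi> in lebesgue_on \<Omega>. integrable (lebesgue_on \<Omega>) (\<lambda>s. \<gamma>1 \<xi> s powr q)"
    and B_outer: "integrable (lebesgue_on \<Omega>)
      (\<lambda>\<xi>. (\<integral>s. \<gamma>1 \<xi> s powr q \<partial>(lebesgue_on \<Omega>)) powr (p / q))"
    and B_lipschitz: "AE (\<xi>, s) in lebesgue_on (\<Omega> \<times> \<Omega>).
      \<forall>x1 x2. norm (K1 \<xi> s x1 - K1 \<xi> s x2) \<le> \<gamma>1 \<xi> s * norm (x1 - x2)"
    and C_meas: "\<And>x. (\<lambda>(\<xi>, s). K2 \<xi> s x) \<in> borel_measurable (lebesgue_on (\<Omega> \<times> \<Omega>))"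
    and C_zero: "(\<lambda>(\<xi>, s). K2 \<xi> s 0) \<in> Lp_space (lebesgue_on (\<Omega> \<times> \<Omega>)) p"
    and C_nonneg: "\<And>\<xi> s. \<xi> \<in> \<Omega> \<Longrightarrow> s \<in> \<Omega> \<Longrightarrow> \<gamma>2 \<xi> s \<ge> 0"
    and C_Linf: "(\<lambda>(\<xi>, s). \<gamma>2 \<xi> s) \<in> Linf_space (lebesgue_on (\<Omega> \<times> \<Omega>))"
    and C_lipschitz: "AE (\<xi>, s) in lebesgue_on (\<Omega> \<times> \<Omega>).
      \<forall>x1 x2. norm (K2 \<xi> s x1 - K2 \<xi> s x2) \<le> \<gamma>2 \<xi> s * norm (x1 - x2)"
    and \<kappa>0: "\<kappa>0 = Linf_norm (lebesgue_on \<Omega>) \<gamma>0"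
    and \<kappa>1: "\<kappa>1 = (\<integral>\<xi>. (\<integral>s. \<gamma>1 \<xi> s powr q \<partial>(lebesgue_on \<Omega>)) powr (p / q)
                    \<partial>(lebesgue_on \<Omega>)) powr (1 / p)"
    and \<kappa>2: "\<kappa>2 = Linf_norm (lebesgue_on (\<Omega> \<times> \<Omega>)) (\<lambda>(\<xi>, s). \<gamma>2 \<xi> s)"
    and D: "6 powr (p - 1) * (\<kappa>0 powr p + lam powr p * \<kappa>1 powr p
              + lam powr p * r powr p * \<kappa>2 powr p * measure lebesgue \<Omega>) < 1"
  shows "trajectories_ball \<Omega> p q r lam f K1 K2 =
         Lp_closure (lebesgue_on \<Omega>) p (trajectories_sphere \<Omega> p q r lam f K1 K2)"
proof -
  have \<Omega>: "\<Omega> \<in> lmeasurable"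
    using \<open>compact \<Omega>\<close> by (rule lmeasurable_compact)
  have \<kappa>0': "\<kappa>0 \<ge> 0" and \<kappa>2': "\<kappa>2 \<ge> 0"
    using Linf_norm_nonneg[OF A_Linf] Linf_norm_nonneg[OF C_Linf] by (simp_all add: \<kappa>0 \<kappa>2)
  have f_lip: "AE \<xi> in lebesgue_on \<Omega>. \<forall>x1 x2. norm (f \<xi> x1 - f \<xi> x2) \<le> \<kappa>0 * norm (x1 - x2)"
    using A_lipschitz AE_norm_le_Linf_norm[OF A_Linf]
  proof eventually_elim
    fix \<xi>
    assume l: "\<forall>x1 x2. norm (f \<xi> x1 - f \<xi> x2) \<le> \<gamma>0 \<xi> * norm (x1 - x2)"
      and "norm (\<gamma>0 \<xi>) \<le> Linf_norm (lebesgue_on \<Omega>) \<gamma>0"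
    then have "\<gamma>0 \<xi> \<le> \<kappa>0"
      by (simp add: \<kappa>0)
    then have "\<gamma>0 \<xi> * norm (x1 - x2) \<le> \<kappa>0 * norm (x1 - x2)" for x1 x2 :: "real ^ 'n"
      by (rule mult_right_mono) simp
    with l show "\<forall>x1 x2. norm (f \<xi> x1 - f \<xi> x2) \<le> \<kappa>0 * norm (x1 - x2)"
      by (meson order_trans)
  qed
  have K2_lip: "AE (\<xi>, s) in lebesgue_on (\<Omega> \<times> \<Omega>).
      \<forall>x1 x2. norm (K2 \<xi> s x1 - K2 \<xi> s x2) \<le> \<kappa>2 * norm (x1 - x2)"
    using C_lipschitz AE_norm_le_Linf_norm[OF C_Linf]
  proof eventually_elim
    fix z
    assume l: "case z of (\<xi>, s) \<Rightarrow> \<forall>x1 x2. norm (K2 \<xi> s x1 - K2 \<xi> s x2) \<le> \<gamma>2 \<xi> s * norm (x1 - x2)"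
      and b: "norm (case z of (\<xi>, s) \<Rightarrow> \<gamma>2 \<xi> s)
        \<le> Linf_norm (lebesgue_on (\<Omega> \<times> \<Omega>)) (\<lambda>(\<xi>, s). \<gamma>2 \<xi> s)"
    obtain \<xi> s where z: "z = (\<xi>, s)"
      by (cases z)
    have "\<gamma>2 \<xi> s \<le> \<kappa>2"
      using b by (simp add: \<kappa>2 z)
    then have "\<gamma>2 \<xi> s * norm (x1 - x2) \<le> \<kappa>2 * norm (x1 - x2)" for x1 x2 :: "real ^ 'n"
      by (rule mult_right_mono) simp
    with l show "case z of (\<xi>, s) \<Rightarrow> \<forall>x1 x2. norm (K2 \<xi> s x1 - K2 \<xi> s x2) \<le> \<kappa>2 * norm (x1 - x2)"
      unfolding z prod.case by (meson order_trans)
  qed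
  interpret urysohn_system \<Omega> p q r lam \<kappa>0 \<kappa>1 \<kappa>2 f K1 K2 \<gamma>1
    by (rule urysohn_system.intro) fact+
  show ?thesis
    using ball_subset_closure_sphere[OF assms(2)] closure_sphere_subset_ball by (rule antisym)
qed

end
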